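(* Let $n\ge2$, $0\le m\le n-2$, $r\ge1$, and let $\mathcal T_h$ be a conforming simplicial mesh of a bounded domain $\Omega\subset\mathbb R^n$. For each $f\in\Delta_\ell(\mathcal T_h)$ choose a global $t$-$n$ basis $\{\boldsymbol t_1^f,\dots,\boldsymbol t_\ell^f,\boldsymbol n_1^f,\dots,\boldsymbol n_{n-\ell}^f\}$ (depending only on $f$). Then the degrees of freedom (DoFs) (a) $\boldsymbol A(\mathtt v)\in\mathbb S$, for $\mathtt v\in\Delta_0(\mathcal T_h)$; (b) $\int_f((\boldsymbol n_i^f)^{\intercal}\boldsymbol A\boldsymbol n_j^f)\,q\,\mathrm ds$, for $f\in\Delta_\ell(\mathcal T_h)$, $q\in\mathbb P_{r-(\ell+1)}(f)$, $1\le i\le j\le n-\ell$, $\ell=1,\dots,n-1$; (c) $\int_f((\boldsymbol t_i^f)^{\intercal}\boldsymbol A\boldsymbol n_j^f)\,q\,\mathrm ds$, for $f\in\Delta_\ell(\mathcal T_h)$, $q\in\mathbb P_{r-(\ell+1)}(f)$, $i=1,\dots,\ell$, $j=1,\dots,n-\ell$, $\ell=1,\dots,m$; (d) $\int_f((\boldsymbol t_i^f)^{\intercal}\boldsymbol A\boldsymbol n_F)|_F\,q\,\mathrm ds$, for $F\in\Delta_{n-1}(\mathcal T_h)$, $f\in\Delta_\ell(F)$, $q\in\mathbb P_{r-(\ell+1)}(f)$, $i=1,\dots,\ell$, $\ell=m+1,\dots,n-1$; (e) $\int_T\boldsymbol A:\boldsymbol q\,\mathrm dx$, for $T\in\mathcal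 T_h$, $\boldsymbol q\in\mathbb B_r(\mathrm{div},T;\mathbb S)$, determine a finite element space $V^r(\mathbb S)\subset H(\mathrm{div},\Omega;\mathbb S)$. That is, for each $T\in\mathcal T_h$ the DoFs attached to $T$ and its sub-simplices uniquely determine an element of $\mathbb P_r(T;\mathbb S)$ (unisolvence), and the space $$V^r(\mathbb S):=\{\boldsymbol A\in L^2(\Omega;\mathbb S):\boldsymbol A|_T\in\mathbb P_r(T;\mathbb S)\ \forall T\in\mathcal T_h,\ \text{(a),(b) single-valued across } f\in\Delta_\ell(\mathcal T_h),\ \ell=0,\dots,n-1,\ \text{(c) single-valued across } f\in\Delta_\ell(\mathcal T_h),\ \ell=1,\dots,m,\ \text{(d) single-valued across } F\in\Delta_{n-1}(\mathcal T_h)\}$$ is contained in $H(\mathrm{div},\Omega;\mathbb S)$.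
   Context: $\mathbb S\subset\mathbb R^{n\times n}$ is the space of symmetric matrices; $\boldsymbol A:\boldsymbol q$ is the Frobenius product. $\Delta_\ell(\cdot)$ is the set of $\ell$-dimensional sub-simplices; a mesh is conforming if any two simplices intersect in the empty set or a common sub-simplex. A $t$-$n$ basis of an $\ell$-dimensional $f$ consists of $\ell$ linearly independent unit vectors $\boldsymbol t_i^f$ tangential to $f$ and $n-\ell$ linearly independent unit vectors $\boldsymbol n_j^f$ orthogonal to the tangent plane of $f$; $\boldsymbol n_F$ is a unit normal of the face $F$ depending only on $F$. $\mathbb P_r(f)$ is the space of polynomials of degree $\le r$ on $f$ ($\{0\}$ if $r<0$). $H(\mathrm{div},\Omega;\mathbb S)=\{\boldsymbol A\in L^2(\Omega;\mathbb S):\mathrm{div}\boldsymbol A\in L^2(\Omega;\mathbb R^n)\}$ with row-wise divergence. $\mathbb B_r(\mathrm{div},T;\mathbb S)=\{\boldsymbol A\in\mathbb P_r(T;\mathbb S):\boldsymbol A\boldsymbol n=0\text{ on }\partial T\}$, $\boldsymbol n$ the unit normal on $\partial T$. A DoF is single-valued across $f$ (or $F$) if its values computed from $\boldsymbol A|_T$ and $\boldsymbol A|_{T'}$ coincide for all $T,T'\in\mathcal T_h$ containing $f$ (or $F$). *)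

theory Defs
  imports "HOL-Analysis.Analysis"
begin

section \<open>Simplices and meshes\<close>

definition subsimplices :: "nat \<Rightarrow> 'a::euclidean_space set \<Rightarrow> 'a set set" where
  "subsimplices l S = {f. f face_of S \<and> int l simplex f}"

definition mesh_subsimplices :: "nat \<Rightarrow> 'a::euclidean_space set set \<Rightarrow> 'a set set" where
  "mesh_subsimplices l \<T> = (\<Union>T\<in>\<T>. subsimplices l T)"

text \<open>Conformity is part of the library's \<^const>\<open>triangulation\<close>: the intersection of two members
  is a (possibly empty) face of both.\<close>

definition simplicial_mesh :: "'a::euclidean_space set \<Rightarrow> 'a set set \<Rightarrow> bool" where
  "simplicial_mesh \<Omega> \<T> \<longleftrightarrow>
     triangulation \<T> \<and> (\<forall>T\<in>\<T>. int DIM('a) simplex T) \<and> \<Union>\<T> = closure \<Omega>"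

definition bounded_domain :: "'a::euclidean_space set \<Rightarrow> bool" where
  "bounded_domain \<Omega> \<longleftrightarrow> open \<Omega> \<and> connected \<Omega> \<and> \<Omega> \<noteq> {} \<and> bounded \<Omega>"

definition tangent_space :: "'a::euclidean_space set \<Rightarrow> 'a set" where
  "tangent_space f = {x - y | x y. x \<in> affine hull f \<and> y \<in> affine hull f}"

definition normal_to :: "'a::euclidean_space set \<Rightarrow> 'a \<Rightarrow> bool" where
  "normal_to f u \<longleftrightarrow> (\<forall>v\<in>tangent_space f. orthogonal u v)"

definition unit_normal :: "'a::euclidean_space set \<Rightarrow> 'a \<Rightarrow> bool" where
  "unit_normal F u \<longleftrightarrow> norm u = 1 \<and> normal_to F u"

text \<open>The conditions \<^const>\<open>inj_on\<close> are needed because \<^const>\<open>independent\<close> only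
  sees the set of vectors.\<close>

definition tn_basis :: "nat \<Rightarrow> 'a::euclidean_space set \<Rightarrow> (nat \<Rightarrow> 'a) \<Rightarrow> (nat \<Rightarrow> 'a) \<Rightarrow> bool" where
  "tn_basis l f t \<nu> \<longleftrightarrow>
     (\<forall>i\<in>{1..l}. norm (t i) = 1 \<and> t i \<in> tangent_space f) \<and>
     inj_on t {1..l} \<and> independent (t ` {1..l}) \<and>
     (\<forall>j\<in>{1..DIM('a) - l}. norm (\<nu> j) = 1 \<and> normal_to f (\<nu> j)) \<and>
     inj_on \<nu> {1..DIM('a) - l} \<and> independent (\<nu> ` {1..DIM('a) - l})"


section \<open>Integration over flat simplices\<close>

definition orthonormal_frame :: "'a::euclidean_space set \<Rightarrow> 'a \<Rightarrow> (nat \<Rightarrow> 'a) \<Rightarrow> bool" where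
  "orthonormal_frame f a e \<longleftrightarrow>
     a \<in> affine hull f \<and>
     (\<forall>i < nat (aff_dim f). e i \<in> tangent_space f) \<and>
     (\<forall>i < nat (aff_dim f). \<forall>j < nat (aff_dim f). e i \<bullet> e j = (if i = j then 1 else 0))"

definition frame_of :: "'a::euclidean_space set \<Rightarrow> 'a \<times> (nat \<Rightarrow> 'a)" where
  "frame_of f = (SOME (a, e). orthonormal_frame f a e)"

text \<open>The measure \<open>ds\<close> of an \<open>l\<close>-dimensional \<open>f\<close>: Lebesgue measure of \<open>\<real>\<^sup>l\<close>, carried to the affine
  hull of \<open>f\<close> by an isometric parametrization.  By invariance of Lebesgue measure under
  isometries it does not depend on the chosen frame.\<close>

definition flat_measure :: "'a::euclidean_space set \<Rightarrow> 'a measure" where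
  "flat_measure f =
     distr (Pi\<^sub>M {..<nat (aff_dim f)} (\<lambda>_. lborel)) borel
       (\<lambda>y. fst (frame_of f) + (\<Sum>i<nat (aff_dim f). y i *\<^sub>R snd (frame_of f) i))"

lemma subspace_tangent_space:
  assumes "f \<noteq> {}"
  shows "subspace (tangent_space f)"
    and "int (dim (tangent_space f)) = aff_dim f"
proof -
  obtain a where a: "a \<in> affine hull f"
    using assms by (metis all_not_in_conv hull_inc)
  have eq: "tangent_space f = (\<lambda>x. x - a) ` (affine hull f)"
    unfolding tangent_space_def
  proof (intro equalityI subsetI)
    fix z assume "z \<in> {x - y | x y. x \<in> affine hull f \<and> y \<in> affine hull f}"
    then obtain x y where z: "z = x - y" "x \<in> affine hull f" "y \<in> affine hull f"
      by blast
    have "a + 1 *\<^sub>R (x - y) \<in> affine hull f"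
      using mem_affine_3_minus[OF affine_affine_hull a z(2,3), of 1] by simp
    then show "z \<in> (\<lambda>x. x - a) ` (affine hull f)"
      using z(1) by (intro image_eqI[where x = "a + (x - y)"]) auto
  qed (use a in blast)
  show "subspace (tangent_space f)"
    unfolding eq using affine_diffs_subspace_subtract[OF affine_affine_hull a]
    by (simp add: image_def)
  have "aff_dim f = int (dim ((+) (-a) ` (affine hull f)))"
    using aff_dim_eq_dim[of a "affine hull f"] a by (simp add: hull_hull aff_dim_affine_hull)
  then show "int (dim (tangent_space f)) = aff_dim f"
    unfolding eq by simp
qed

lemma ex_orthonormal_frame:
  assumes "f \<noteq> {}"
  shows "\<exists>a e. orthonormal_frame f a e"
proof -
  obtain a where a: "a \<in> affine hull f"
    using assms by (metis all_not_in_conv hull_inc)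
  obtain B where B: "B \<subseteq> tangent_space f" "pairwise orthogonal B" "\<And>x. x \<in> B \<Longrightarrow> norm x = 1"
      "independent B" "card B = dim (tangent_space f)"
    using orthonormal_basis_subspace[OF subspace_tangent_space(1)[OF assms]] by metis
  have "finite B" "card B = nat (aff_dim f)"
    using B(4,5) subspace_tangent_space(2)[OF assms] by (auto simp: independent_imp_finite)
  then obtain e where e: "bij_betw e {..<nat (aff_dim f)} B"
    by (metis ex_bij_betw_nat_finite lessThan_atLeast0)
  have "e i \<bullet> e j = (if i = j then 1 else 0)" if "i < nat (aff_dim f)" "j < nat (aff_dim f)" for i j
  proof (cases "i = j")
    case True
    then show ?thesis
      using e B(3) that by (auto simp: bij_betw_def norm_eq_1)
  next
    case False
    then have "e i \<noteq> e j" "e i \<in> B" "e j \<in> B"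
      using e that by (auto simp: bij_betw_def inj_on_def)
    then show ?thesis
      using B(2) False by (auto simp: pairwise_def orthogonal_def)
  qed
  then have "orthonormal_frame f a e"
    using a e B(1) by (auto simp: orthonormal_frame_def bij_betw_def)
  then show ?thesis by blast
qed

lemma frame_of: "f \<noteq> {} \<Longrightarrow> orthonormal_frame f (fst (frame_of f)) (snd (frame_of f))"
  unfolding frame_of_def
  by (metis (mono_tags, lifting) case_prod_beta ex_orthonormal_frame fst_conv snd_conv someI_ex)

lemma flat_chart_measurable:
  "(\<lambda>y. a + (\<Sum>i<l. y i *\<^sub>R e i)) \<in>
     Pi\<^sub>M {..<l} (\<lambda>_. lborel) \<rightarrow>\<^sub>M (borel :: 'a::euclidean_space measure)"
  by measurable


section \<open>Polynomials\<close>

text \<open>Total degree at most \<open>k\<close>; for \<open>k < 0\<close> the sum is empty and only the zero polynomial remains.\<close>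

definition polynomials :: "int \<Rightarrow> (real^'n \<Rightarrow> 'b::real_vector) set" where
  "polynomials k =
     {p. \<exists>c :: ('n \<Rightarrow> nat) \<Rightarrow> 'b.
        p = (\<lambda>x. \<Sum>\<alpha> | int (\<Sum>i\<in>UNIV. \<alpha> i) \<le> k. (\<Prod>i\<in>UNIV. (x $ i) ^ \<alpha> i) *\<^sub>R c \<alpha>)}"

lemma finite_multi_indices: "finite {\<alpha> :: 'n::finite \<Rightarrow> nat. int (\<Sum>i\<in>UNIV. \<alpha> i) \<le> k}"
proof (rule finite_subset)
  show "{\<alpha> :: 'n \<Rightarrow> nat. int (\<Sum>i\<in>UNIV. \<alpha> i) \<le> k} \<subseteq> PiE UNIV (\<lambda>_. {..nat k})"
  proof
    fix \<alpha> :: "'n \<Rightarrow> nat" assume "\<alpha> \<in> {\<alpha>. int (\<Sum>i\<in>UNIV. \<alpha> i) \<le> k}"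
    then have "(\<Sum>i\<in>UNIV. \<alpha> i) \<le> nat k"
      by (metis mem_Collect_eq nat_int nat_mono)
    then have "\<alpha> i \<le> nat k" for i
      using member_le_sum[of i UNIV \<alpha>] by force
    then show "\<alpha> \<in> PiE UNIV (\<lambda>_. {..nat k})" by auto
  qed
qed (simp add: finite_PiE)

text \<open>A function on \<open>D\<close> is represented by its extension by zero, so that equality of functions is
  equality on \<open>D\<close>.\<close>

definition polys_on :: "int \<Rightarrow> (real^'n) set \<Rightarrow> (real^'n \<Rightarrow> 'b::real_vector) set" where
  "polys_on k D = {\<lambda>x. if x \<in> D then p x else 0 | p. p \<in> polynomials k}"

definition sym_matrices :: "(real^'n^'n) set" where
  "sym_matrices = {M. transpose M = M}"

definition sym_polys_on :: "int \<Rightarrow> (real^'n) set \<Rightarrow> (real^'n \<Rightarrow> real^'n^'n) set" where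
  "sym_polys_on r T = {A \<in> polys_on r T. \<forall>x\<in>T. A x \<in> sym_matrices}"

definition div_bubbles :: "int \<Rightarrow> (real^'n) set \<Rightarrow> (real^'n \<Rightarrow> real^'n^'n) set" where
  "div_bubbles r T = {A \<in> sym_polys_on r T.
     \<forall>F\<in>subsimplices (CARD('n) - 1) T. \<forall>x\<in>F. \<forall>u. unit_normal F u \<longrightarrow> A x *v u = 0}"


section \<open>The space of symmetric fields with square-integrable divergence\<close>

definition L2_on :: "(real^'n) set \<Rightarrow> (real^'n \<Rightarrow> 'b::euclidean_space) set" where
  "L2_on \<Omega> = {u. u \<in> borel_measurable (lebesgue_on \<Omega>) \<and>
                 integrable (lebesgue_on \<Omega>) (\<lambda>x. (norm (u x))\<^sup>2)}"

definition L2_sym :: "(real^'n) set \<Rightarrow> (real^'n \<Rightarrow> real^'n^'n) set" where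
  "L2_sym \<Omega> = {A \<in> L2_on \<Omega>. AE x in lebesgue_on \<Omega>. A x \<in> sym_matrices}"

primrec Ck :: "nat \<Rightarrow> ('a::euclidean_space \<Rightarrow> real) \<Rightarrow> bool" where
  "Ck 0 \<phi> \<longleftrightarrow> continuous_on UNIV \<phi>"
| "Ck (Suc k) \<phi> \<longleftrightarrow>
     (\<forall>x. \<phi> differentiable (at x)) \<and> (\<forall>v. Ck k (\<lambda>x. frechet_derivative \<phi> (at x) v))"

definition test_function :: "'a::euclidean_space set \<Rightarrow> ('a \<Rightarrow> real) \<Rightarrow> bool" where
  "test_function \<Omega> \<phi> \<longleftrightarrow>
     (\<forall>k. Ck k \<phi>) \<and> (\<exists>K. compact K \<and> K \<subseteq> \<Omega> \<and> (\<forall>x. x \<notin> K \<longrightarrow> \<phi> x = 0))"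

text \<open>\<open>frechet_derivative \<phi> (at x) w\<close> is \<open>\<nabla>\<phi>(x) \<bullet> w\<close>.\<close>

definition weak_row_div ::
  "(real^'n) set \<Rightarrow> (real^'n \<Rightarrow> real^'n^'n) \<Rightarrow> (real^'n \<Rightarrow> real^'n) \<Rightarrow> bool" where
  "weak_row_div \<Omega> A g \<longleftrightarrow>
     (\<forall>\<phi> i. test_function \<Omega> \<phi> \<longrightarrow>
        (\<integral>x. frechet_derivative \<phi> (at x) (row i (A x)) \<partial>lebesgue_on \<Omega>)
          = - (\<integral>x. (g x $ i) * \<phi> x \<partial>lebesgue_on \<Omega>))"

definition H_div_sym :: "(real^'n) set \<Rightarrow> (real^'n \<Rightarrow> real^'n^'n) set" where
  "H_div_sym \<Omega> = {A \<in> L2_sym \<Omega>. \<exists>g \<in> L2_on \<Omega>. weak_row_div \<Omega> A g}"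


section \<open>Degrees of freedom\<close>

definition moment ::
  "(real^'n) set \<Rightarrow> real^'n \<Rightarrow> real^'n \<Rightarrow> (real^'n \<Rightarrow> real) \<Rightarrow> (real^'n \<Rightarrow> real^'n^'n) \<Rightarrow> real" where
  "moment f u w q A = (LINT x:f|flat_measure f. (u \<bullet> (A x *v w)) * q x)"

text \<open>The inner product of \<open>real^'n^'n\<close> is the Frobenius product.\<close>

definition interior_moment ::
  "(real^'n) set \<Rightarrow> (real^'n \<Rightarrow> real^'n^'n) \<Rightarrow> (real^'n \<Rightarrow> real^'n^'n) \<Rightarrow> real" where
  "interior_moment T q A = (\<integral>x. A x \<bullet> q x \<partial>lebesgue_on T)"

definition functional_on :: "('a \<Rightarrow> 'b::real_vector) set \<Rightarrow> (('a \<Rightarrow> 'b) \<Rightarrow> real) \<Rightarrow> bool" where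
  "functional_on P L \<longleftrightarrow>
     (\<forall>p\<in>P. \<forall>q\<in>P. \<forall>a b. L (\<lambda>x. a *\<^sub>R p x + b *\<^sub>R q x) = a * L p + b * L q)"

text \<open>Unisolvence: the DoFs attached to \<open>T\<close> can be prescribed arbitrarily and then determine exactly
  one element of \<open>\<P>\<^sub>r(T;\<S>)\<close>.  A moment against all \<open>q\<close> in a polynomial space takes a value for every
  \<open>q\<close>, linearly in \<open>q\<close>; prescribing these DoFs means prescribing a linear functional on that space,
  equivalently a number for each member of a basis of it.  The arguments \<open>t\<close>, \<open>\<nu>\<close> and \<open>\<nu>F\<close> are the
  tangential and normal vectors of each sub-simplex and the unit normal of each face.\<close>

definition unisolvent ::
  "nat \<Rightarrow> nat \<Rightarrow> ((real^'n) set \<Rightarrow> nat \<Rightarrow> real^'n) \<Rightarrow> ((real^'n) set \<Rightarrow> nat \<Rightarrow> real^'n)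
    \<Rightarrow> ((real^'n) set \<Rightarrow> real^'n) \<Rightarrow> (real^'n) set \<Rightarrow> bool" where
  "unisolvent r m t \<nu> \<nu>F T \<longleftrightarrow>
     (\<forall>a b c d e.
        (\<forall>v. {v} \<in> subsimplices 0 T \<longrightarrow> a v \<in> sym_matrices) \<and>
        (\<forall>l\<in>{1..CARD('n) - 1}. \<forall>f\<in>subsimplices l T.
           \<forall>i\<in>{1..CARD('n) - l}. \<forall>j\<in>{i..CARD('n) - l}.
             functional_on (polys_on (int r - (int l + 1)) f) (b f i j)) \<and>
        (\<forall>l\<in>{1..m}. \<forall>f\<in>subsimplices l T.
           \<forall>i\<in>{1..l}. \<forall>j\<in>{1..CARD('n) - l}.
             functional_on (polys_on (int r - (int l + 1)) f) (c f i j)) \<and>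
        (\<forall>F\<in>subsimplices (CARD('n) - 1) T.
           \<forall>l\<in>{m+1..CARD('n) - 1}. \<forall>f\<in>subsimplices l F. \<forall>i\<in>{1..l}.
             functional_on (polys_on (int r - (int l + 1)) f) (d F f i)) \<and>
        functional_on (div_bubbles (int r) T) e
      \<longrightarrow>
        (\<exists>!A. A \<in> sym_polys_on (int r) T \<and>
           (\<forall>v. {v} \<in> subsimplices 0 T \<longrightarrow> A v = a v) \<and>
           (\<forall>l\<in>{1..CARD('n) - 1}. \<forall>f\<in>subsimplices l T.
              \<forall>i\<in>{1..CARD('n) - l}. \<forall>j\<in>{i..CARD('n) - l}.
                \<forall>q\<in>polys_on (int r - (int l + 1)) f.
                  moment f (\<nu> f i) (\<nu> f j) q A = b f i j q) \<and>
           (\<forall>l\<in>{1..m}. \<forall>f\<in>subsimplices l T.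
              \<forall>i\<in>{1..l}. \<forall>j\<in>{1..CARD('n) - l}.
                \<forall>q\<in>polys_on (int r - (int l + 1)) f.
                  moment f (t f i) (\<nu> f j) q A = c f i j q) \<and>
           (\<forall>F\<in>subsimplices (CARD('n) - 1) T.
              \<forall>l\<in>{m+1..CARD('n) - 1}. \<forall>f\<in>subsimplices l F. \<forall>i\<in>{1..l}.
                \<forall>q\<in>polys_on (int r - (int l + 1)) f.
                  moment f (t f i) (\<nu>F F) q A = d F f i q) \<and>
           (\<forall>q\<in>div_bubbles (int r) T. interior_moment T q A = e q)))"

text \<open>\<open>p T\<close> is the restriction to \<open>T\<close> of a piecewise polynomial field, \<open>D\<close> a DoF.\<close>

definition single_valued_across ::
  "'a set set \<Rightarrow> ('a set \<Rightarrow> 'b) \<Rightarrow> 'a set \<Rightarrow> ('b \<Rightarrow> 'c) \<Rightarrow> bool" where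
  "single_valued_across \<T> p f D \<longleftrightarrow>
     (\<forall>T\<in>\<T>. \<forall>T'\<in>\<T>. f \<subseteq> T \<and> f \<subseteq> T' \<longrightarrow> D (p T) = D (p T'))"

text \<open>Elements of \<open>L\<^sup>2\<close> matter up to null sets, hence \<open>A|\<^sub>T \<in> \<P>\<^sub>r(T;\<S>)\<close> means that \<open>A\<close> agrees almost
  everywhere on \<open>T\<close> with a polynomial field \<open>p T\<close>, and the DoFs of \<open>A|\<^sub>T\<close> are those of \<open>p T\<close>.  This
  \<open>p T\<close> is unique, since \<open>T \<inter> \<Omega>\<close> contains a nonempty open set.\<close>

definition fe_space ::
  "(real^'n) set \<Rightarrow> (real^'n) set set \<Rightarrow> nat \<Rightarrow> nat
    \<Rightarrow> ((real^'n) set \<Rightarrow> nat \<Rightarrow> real^'n) \<Rightarrow> ((real^'n) set \<Rightarrow> nat \<Rightarrow> real^'n)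
    \<Rightarrow> ((real^'n) set \<Rightarrow> real^'n) \<Rightarrow> (real^'n \<Rightarrow> real^'n^'n) set" where
  "fe_space \<Omega> \<T> r m t \<nu> \<nu>F = {A \<in> L2_sym \<Omega>. \<exists>p.
     (\<forall>T\<in>\<T>. p T \<in> sym_polys_on (int r) T \<and> (AE x in lebesgue_on (T \<inter> \<Omega>). A x = p T x)) \<and>
     (\<forall>v. {v} \<in> mesh_subsimplices 0 \<T> \<longrightarrow> single_valued_across \<T> p {v} (\<lambda>B. B v)) \<and>
     (\<forall>l\<in>{1..CARD('n) - 1}. \<forall>f\<in>mesh_subsimplices l \<T>.
        \<forall>i\<in>{1..CARD('n) - l}. \<forall>j\<in>{i..CARD('n) - l}.
          \<forall>q\<in>polys_on (int r - (int l + 1)) f.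
            single_valued_across \<T> p f (moment f (\<nu> f i) (\<nu> f j) q)) \<and>
     (\<forall>l\<in>{1..m}. \<forall>f\<in>mesh_subsimplices l \<T>.
        \<forall>i\<in>{1..l}. \<forall>j\<in>{1..CARD('n) - l}.
          \<forall>q\<in>polys_on (int r - (int l + 1)) f.
            single_valued_across \<T> p f (moment f (t f i) (\<nu> f j) q)) \<and>
     (\<forall>F\<in>mesh_subsimplices (CARD('n) - 1) \<T>.
        \<forall>l\<in>{m+1..CARD('n) - 1}. \<forall>f\<in>subsimplices l F. \<forall>i\<in>{1..l}.
          \<forall>q\<in>polys_on (int r - (int l + 1)) f.
            single_valued_across \<T> p F (moment f (t f i) (\<nu>F F) q))}"

end

theory Submission
  imports Defs "HOL-Library.Function_Algebras"
begin

text \<open>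
  On a face \<open>f\<close> spanned by the vertices \<open>W\<close>, a polynomial that vanishes on the boundary of \<open>f\<close> is the
  bubble function (the product of the barycentric coordinates \<open>\<lambda>\<^sub>v\<close>, \<open>v \<in> W\<close>) times a polynomial of degree
  \<open>r - |W|\<close>, and the moments against polynomials of that degree determine the cofactor.  By induction
  on the dimension of the faces of a facet \<open>F\<close>, vanishing degrees of freedom on \<open>F\<close> therefore force
  \<open>A n\<^sub>F = 0\<close> on \<open>F\<close>; if this happens on all facets, \<open>A\<close> is a bubble and is killed by its moments
  against bubbles.  Conversely, multiples of the bubble functions by suitable constant matrices allow
  prescribed moments to be matched face by face, in order of increasing dimension, and a bubble field
  then adjusts the interior moments.

  For the inclusion in \<open>H(div)\<close> it remains to see that the integrals of \<open>div (\<phi> A\<^sub>i)\<close> over the simplices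
  add up to zero when the normal components agree across common facets.  A field without normal
  component on the boundary of a simplex has zero mean divergence, by dominated convergence with
  cutoffs along the facets.  Modulo such fields, a field on a simplex is a sum over the vertices \<open>v\<close> of
  multiples of \<open>x - v\<close>, whose normal component lives on the facet opposite \<open>v\<close> only.  These terms
  cancel in pairs of neighbouring simplices.
\<close>


section \<open>Polynomials of bounded total degree\<close>

text \<open>Two points decide the shape of the proof. First, the moments (c) for l <= m and (d) for
  l > m play the same role. If a facet F contains f, then n_F is a combination of the normals of f,
  so (c) controls the moments against n_F as well. Conversely, f of dimension l lies in exactly n -
  l facets of T, and their normals are linearly independent. They can therefore replace the n_j^f as
  a basis of the normal space, and the moments (d) can be prescribed as freely as (c). Second, no
  surface integral of a flux occurs. Of the measure on faces only finiteness on compact sets,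
  linearity and positivity are used: they yield pointwise equality of A n_F on a common facet. The
  H(div) part starts from this pointwise equality and integrates divergences over open sets only. Up
  to sign, the flux through the facet opposite v is represented by the volume integral of div((grad
  lambda_v . u)(x - v)). This is why vertex fields appear in place of boundary terms.\<close>

lemma polynomials_zero [simp]: "(\<lambda>x. 0) \<in> polynomials k"
  unfolding polynomials_def by (auto intro!: exI[of _ "\<lambda>_. 0"])

lemma polynomials_linear_image:
  assumes "linear f" "p \<in> polynomials k"
  shows "(\<lambda>x. f (p x)) \<in> polynomials k"
proof -
  obtain c where c: "p = (\<lambda>x. \<Sum>\<alpha> | int (\<Sum>i\<in>UNIV. \<alpha> i) \<le> k. (\<Prod>i\<in>UNIV. (x $ i) ^ \<alpha> i) *\<^sub>R c \<alpha>)"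
    using assms(2) unfolding polynomials_def by auto
  show ?thesis
    unfolding polynomials_def c
    by (auto intro!: exI[of _ "\<lambda>\<alpha>. f (c \<alpha>)"] simp: linear_sum[OF assms(1)] linear_scale[OF assms(1)])
qed

lemma polynomials_add:
  assumes "p \<in> polynomials k" "q \<in> polynomials k"
  shows "(\<lambda>x. p x + q x) \<in> polynomials k"
proof -
  obtain c where c: "p = (\<lambda>x. \<Sum>\<alpha> | int (\<Sum>i\<in>UNIV. \<alpha> i) \<le> k. (\<Prod>i\<in>UNIV. (x $ i) ^ \<alpha> i) *\<^sub>R c \<alpha>)"
    using assms(1) unfolding polynomials_def by auto
  obtain d where d: "q = (\<lambda>x. \<Sum>\<alpha> | int (\<Sum>i\<in>UNIV. \<alpha> i) \<le> k. (\<Prod>i\<in>UNIV. (x $ i) ^ \<alpha> i) *\<^sub>R d \<alpha>)"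
    using assms(2) unfolding polynomials_def by auto
  show ?thesis
    unfolding polynomials_def c d
    by (auto intro!: exI[of _ "\<lambda>\<alpha>. c \<alpha> + d \<alpha>"] simp: sum.distrib scaleR_right_distrib)
qed

lemma polynomials_scaleR:
  "p \<in> polynomials k \<Longrightarrow> (\<lambda>x. a *\<^sub>R p x) \<in> polynomials k"
  by (rule polynomials_linear_image[where f = "\<lambda>v. a *\<^sub>R v"])
     (auto intro!: linearI simp: scaleR_right_distrib)

lemma polynomials_sum:
  "(\<And>i. i \<in> I \<Longrightarrow> p i \<in> polynomials k) \<Longrightarrow> (\<lambda>x. \<Sum>i\<in>I. p i x) \<in> polynomials k"
  by (induction I rule: infinite_finite_induct) (auto intro: polynomials_add)

lemma polynomials_monomial:
  fixes \<alpha> :: "'n::finite \<Rightarrow> nat"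
  assumes "int (\<Sum>i\<in>UNIV. \<alpha> i) \<le> k"
  shows "(\<lambda>x. (\<Prod>i\<in>UNIV. (x $ i) ^ \<alpha> i) *\<^sub>R c) \<in> polynomials k"
proof -
  have "(\<Sum>\<beta> | int (\<Sum>i\<in>UNIV. \<beta> i) \<le> k. (\<Prod>i\<in>UNIV. (x $ i) ^ \<beta> i) *\<^sub>R (if \<beta> = \<alpha> then c else 0))
      = (\<Prod>i\<in>UNIV. (x $ i) ^ \<alpha> i) *\<^sub>R c" for x :: "real^'n"
    using assms by (subst sum.mono_neutral_right[where S = "{\<alpha>}"])
      (auto simp: finite_multi_indices simp del: of_nat_sum)
  then show ?thesis
    unfolding polynomials_def by (auto intro!: exI[of _ "\<lambda>\<beta>. if \<beta> = \<alpha> then c else 0"])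
qed

lemma polynomials_const: "0 \<le> k \<Longrightarrow> (\<lambda>_. c) \<in> polynomials k"
  using polynomials_monomial[of "\<lambda>_. 0" k c] by simp

lemma polynomials_mono:
  assumes "j \<le> k" "p \<in> polynomials j"
  shows "p \<in> polynomials k"
proof -
  obtain c where c: "p = (\<lambda>x. \<Sum>\<alpha> | int (\<Sum>i\<in>UNIV. \<alpha> i) \<le> j. (\<Prod>i\<in>UNIV. (x $ i) ^ \<alpha> i) *\<^sub>R c \<alpha>)"
    using assms(2) unfolding polynomials_def by auto
  show ?thesis
    unfolding c using assms(1) by (intro polynomials_sum polynomials_monomial) auto
qed

lemma polynomials_coord_mult:
  fixes p :: "real^'n \<Rightarrow> 'b::real_vector"
  assumes "p \<in> polynomials k"
  shows "(\<lambda>x. (x $ j) *\<^sub>R p x) \<in> polynomials (k + 1)"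
proof -
  obtain c where c: "p = (\<lambda>x. \<Sum>\<alpha> | int (\<Sum>i\<in>UNIV. \<alpha> i) \<le> k. (\<Prod>i\<in>UNIV. (x $ i) ^ \<alpha> i) *\<^sub>R c \<alpha>)"
    using assms unfolding polynomials_def by auto
  have eq: "(x $ j) *\<^sub>R ((\<Prod>i\<in>UNIV. (x $ i) ^ \<alpha> i) *\<^sub>R c \<alpha>)
      = (\<Prod>i\<in>UNIV. (x $ i) ^ (\<alpha>(j := Suc (\<alpha> j))) i) *\<^sub>R c \<alpha>" for x :: "real^'n" and \<alpha>
    by (simp add: prod.remove[of UNIV j] mult.assoc)
  have deg: "(\<Sum>i\<in>UNIV. (\<alpha>(j := Suc (\<alpha> j))) i) = Suc (\<Sum>i\<in>UNIV. \<alpha> i)" for \<alpha> :: "'n \<Rightarrow> nat"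
    by (simp add: sum.remove[of UNIV j])
  show ?thesis
    unfolding c scaleR_sum_right eq
    by (intro polynomials_sum polynomials_monomial) (simp only: deg, simp)
qed

text \<open>Degree bounds have to survive the induction, so \<open>P\<close> receives the degree as
  an argument. Multiplication by a coordinate raises it by one, and \<open>mono\<close> passes from
  the degree of a monomial to the common bound. For negative degree only the case
  \<open>zero\<close> remains.\<close>

lemma polynomials_induct [consumes 1, case_names zero const coord add mono]:
  fixes p :: "real^'n \<Rightarrow> 'b::real_vector"
  assumes "p \<in> polynomials k"
    and zero: "\<And>k. P k (\<lambda>_. 0)"
    and const: "\<And>c. P 0 (\<lambda>_. c)"
    and coord: "\<And>k p j. p \<in> polynomials k \<Longrightarrow> P k p \<Longrightarrow> P (k + 1) (\<lambda>x. (x $ j) *\<^sub>R p x)"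
    and add: "\<And>k p q. P k p \<Longrightarrow> P k q \<Longrightarrow> P k (\<lambda>x. p x + q x)"
    and mono: "\<And>j k p. j \<le> k \<Longrightarrow> P j p \<Longrightarrow> P k p"
  shows "P k p"
proof -
  have mon: "P (int (\<Sum>i\<in>UNIV. \<alpha> i)) (\<lambda>x. (\<Prod>i\<in>UNIV. (x $ i) ^ \<alpha> i) *\<^sub>R c)" for \<alpha> :: "'n \<Rightarrow> nat" and c
  proof (induction "\<Sum>i\<in>UNIV. \<alpha> i" arbitrary: \<alpha>)
    case 0
    then have "\<alpha> = (\<lambda>_. 0)" by auto
    then show ?case using const[of c] by simp
  next
    case (Suc d)
    then obtain j where j: "\<alpha> j > 0"
      by (metis (no_types, lifting) bot_nat_0.not_eq_extremum nat.simps(3) sum.not_neutral_contains_not_neutral)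
    define \<beta> where "\<beta> = \<alpha>(j := \<alpha> j - 1)"
    have \<alpha>: "\<alpha> = \<beta>(j := Suc (\<beta> j))" using j by (auto simp: \<beta>_def)
    have deg: "(\<Sum>i\<in>UNIV. \<alpha> i) = Suc (\<Sum>i\<in>UNIV. \<beta> i)"
      unfolding \<alpha> by (simp add: sum.remove[of UNIV j])
    have eq: "(\<Prod>i\<in>UNIV. (x $ i) ^ \<alpha> i) *\<^sub>R c = (x $ j) *\<^sub>R ((\<Prod>i\<in>UNIV. (x $ i) ^ \<beta> i) *\<^sub>R c)" for x :: "real^'n"
      unfolding \<alpha> by (simp add: prod.remove[of UNIV j] mult.assoc)
    have "P (int (\<Sum>i\<in>UNIV. \<beta> i)) (\<lambda>x. (\<Prod>i\<in>UNIV. (x $ i) ^ \<beta> i) *\<^sub>R c)"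
      using Suc deg by simp
    from coord[OF polynomials_monomial[OF order_refl] this, of j] show ?case
      unfolding eq deg by (simp add: add.commute)
  qed
  have sums: "P k (\<lambda>x. \<Sum>i\<in>I. q i x)" if "finite I" "\<And>i. i \<in> I \<Longrightarrow> P k (q i)"
    for I :: "('n \<Rightarrow> nat) set" and q
    using that by (induction I rule: finite_induct) (auto intro: zero add)
  obtain c where c: "p = (\<lambda>x. \<Sum>\<alpha> | int (\<Sum>i\<in>UNIV. \<alpha> i) \<le> k. (\<Prod>i\<in>UNIV. (x $ i) ^ \<alpha> i) *\<^sub>R c \<alpha>)"
    using assms(1) unfolding polynomials_def by auto
  show ?thesis
    unfolding c
  proof (rule sums[OF finite_multi_indices])
    fix \<alpha> :: "'n \<Rightarrow> nat" assume "\<alpha> \<in> {\<alpha>. int (\<Sum>i\<in>UNIV. \<alpha> i) \<le> k}"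
    then show "P k (\<lambda>x. (\<Prod>i\<in>UNIV. (x $ i) ^ \<alpha> i) *\<^sub>R c \<alpha>)"
      by (intro mono[OF _ mon]) simp
  qed
qed

lemma polynomials_affine: "(\<lambda>x. g \<bullet> x + c) \<in> polynomials 1"
proof -
  have "(\<lambda>x. (x $ j) *\<^sub>R (g $ j)) \<in> polynomials 1" for j
    using polynomials_coord_mult[OF polynomials_const[of 0 "g $ j"]] by simp
  then have "(\<lambda>x. (\<Sum>j\<in>UNIV. (x $ j) *\<^sub>R (g $ j)) + c) \<in> polynomials 1"
    by (intro polynomials_add polynomials_sum polynomials_const) auto
  then show ?thesis by (simp add: inner_vec_def mult.commute)
qed

lemma polynomials_mult:
  fixes p :: "real^'n \<Rightarrow> real" and q :: "real^'n \<Rightarrow> 'b::real_vector"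
  assumes "p \<in> polynomials j" "q \<in> polynomials k"
  shows "(\<lambda>x. p x *\<^sub>R q x) \<in> polynomials (j + k)"
  using assms(1)
proof (induction rule: polynomials_induct)
  case (const c)
  then show ?case using polynomials_scaleR[OF assms(2)] by simp
next
  case (coord k' p i)
  from polynomials_coord_mult[OF coord(2), of i] show ?case
    by (simp add: algebra_simps)
next
  case (add k p q)
  from polynomials_add[OF this] show ?case by (simp add: scaleR_left_distrib)
next
  case (mono j' k' p)
  then show ?case by (auto intro: polynomials_mono[of "j' + k"])
qed auto

text \<open>The displacement is a multiple of the affine function s = g . x + c, so every monomial
  changes by a multiple of s, and the quotient loses one degree. In the coordinate step, (x_j + s
  d_j)(p + s h) - x_j p = s (x_j h + d_j p + s d_j h), and all three terms respect the degree bound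
  of p.\<close>

lemma polynomials_affine_shift:
  fixes p :: "real^'n \<Rightarrow> 'b::real_vector"
  assumes "p \<in> polynomials k"
  shows "\<exists>h\<in>polynomials (k - 1). \<forall>x. p (x + (g \<bullet> x + c) *\<^sub>R d) = p x + (g \<bullet> x + c) *\<^sub>R h x"
  using assms
proof (induction rule: polynomials_induct)
  case (coord k p j)
  then obtain h where h: "h \<in> polynomials (k - 1)"
    "\<And>x. p (x + (g \<bullet> x + c) *\<^sub>R d) = p x + (g \<bullet> x + c) *\<^sub>R h x" by blast
  have "(\<lambda>x. (x $ j) *\<^sub>R h x + d $ j *\<^sub>R p x + d $ j *\<^sub>R ((g \<bullet> x + c) *\<^sub>R h x)) \<in> polynomials k"
    using polynomials_coord_mult[OF h(1), of j] polynomials_scaleR[OF coord(1), of "d $ j"]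
      polynomials_scaleR[OF polynomials_mult[OF polynomials_affine[of g c] h(1)], of "d $ j"]
    by (intro polynomials_add) auto
  moreover have "((x + s *\<^sub>R d) $ j) *\<^sub>R (p x + s *\<^sub>R h x)
      = (x $ j) *\<^sub>R p x + s *\<^sub>R ((x $ j) *\<^sub>R h x + d $ j *\<^sub>R p x + d $ j *\<^sub>R (s *\<^sub>R h x))" for x s
    by (simp add: algebra_simps)
  ultimately show ?case
    by (intro bexI[where x = "\<lambda>x. (x $ j) *\<^sub>R h x + d $ j *\<^sub>R p x + d $ j *\<^sub>R ((g \<bullet> x + c) *\<^sub>R h x)"])
       (auto simp only: h(2) add_diff_cancel_right')
next
  case (add k p q)
  then obtain h h' where h: "h \<in> polynomials (k - 1)" "h' \<in> polynomials (k - 1)"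
    "\<And>x. p (x + (g \<bullet> x + c) *\<^sub>R d) = p x + (g \<bullet> x + c) *\<^sub>R h x"
    "\<And>x. q (x + (g \<bullet> x + c) *\<^sub>R d) = q x + (g \<bullet> x + c) *\<^sub>R h' x" by blast
  then show ?case
    by (intro bexI[OF _ polynomials_add[OF h(1,2)]]) (auto simp: algebra_simps)
next
  case (mono j k p)
  then show ?case by (meson diff_right_mono polynomials_mono)
qed (auto intro!: bexI[where x = "\<lambda>_. 0"])

lemma continuous_on_polynomial:
  fixes p :: "real^'n \<Rightarrow> 'b::real_normed_vector"
  assumes "p \<in> polynomials k"
  shows "continuous_on S p"
  using assms by (auto simp: polynomials_def intro!: continuous_intros)


section \<open>Barycentric coordinates\<close>

locale full_simplex =
  fixes V :: "(real^'n) set"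
  assumes affine_independent: "\<not> affine_dependent V"
    and card_vertices: "card V = CARD('n) + 1"

text \<open>An affine function is stored as its gradient and its constant. Barycentric coordinates
  then make sense on all of R^n, and the gradient doubles as a normal of the facet opposite
  \<open>v\<close>. For the vertices of a full simplex the pair is unique.\<close>

definition bary_pair :: "(real^'n) set \<Rightarrow> real^'n \<Rightarrow> (real^'n) \<times> real" where
  "bary_pair V v = (SOME (g, c). \<forall>w\<in>V. g \<bullet> w + c = (if w = v then 1 else 0))"

definition bary_grad :: "(real^'n) set \<Rightarrow> real^'n \<Rightarrow> real^'n" where
  "bary_grad V v = fst (bary_pair V v)"

definition bary :: "(real^'n) set \<Rightarrow> real^'n \<Rightarrow> real^'n \<Rightarrow> real" where
  "bary V v x = bary_grad V v \<bullet> x + snd (bary_pair V v)"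

lemma bary_diff: "bary V v x - bary V v y = bary_grad V v \<bullet> (x - y)"
  by (simp add: bary_def inner_diff_right)

lemma bary_add: "bary V v (x + y) = bary V v x + bary_grad V v \<bullet> y"
  by (simp add: bary_def inner_add_right)

lemma bary_affine_comb:
  "sum u S = 1 \<Longrightarrow> bary V v (\<Sum>w\<in>S. u w *\<^sub>R w) = (\<Sum>w\<in>S. u w * bary V v w)"
  by (simp add: bary_def inner_sum_right distrib_left sum.distrib sum_distrib_right[symmetric])

lemma bary_convex_comb:
  "bary V v ((1 - s) *\<^sub>R x + s *\<^sub>R y) = (1 - s) * bary V v x + s * bary V v y"
  by (simp add: bary_def inner_add_right algebra_simps)

lemma continuous_on_bary [continuous_intros]:
  "continuous_on S f \<Longrightarrow> continuous_on S (\<lambda>x. bary V v (f x))"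
  unfolding bary_def by (intro continuous_intros)

lemma bary_polynomial: "bary V v \<in> polynomials 1"
  using polynomials_affine[of "bary_grad V v" "snd (bary_pair V v)"] by (simp add: bary_def[abs_def])

lemma tangent_space_convex_hull:
  "tangent_space (convex hull W) = {x - y | x y. x \<in> affine hull W \<and> y \<in> affine hull W}"
  by (simp add: tangent_space_def)

context full_simplex
begin

lemma finite_vertices [simp]: "finite V"
  using card_vertices card.infinite by fastforce

lemma finite_subset_vertices: "W \<subseteq> V \<Longrightarrow> finite W"
  by (rule finite_subset[OF _ finite_vertices])

lemma other_vertex:
  obtains w where "w \<in> V" "w \<noteq> v"
proof -
  have "\<not> V \<subseteq> {v}" using card_vertices card_mono[of "{v}" V] by auto
  then show ?thesis using that by auto
qed

text \<open>The pair demanded by the choice operator exists: after translation by a vertex a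
  different from v, the remaining vertices are linearly independent and a linear functional can be
  prescribed on them. At the origin, the image of a, it is 0 as desired.\<close>

lemma bary_vertex:
  assumes "v \<in> V" "w \<in> V"
  shows "bary V v w = (if w = v then 1 else 0)"
proof -
  obtain a where a: "a \<in> V" "a \<noteq> v" by (rule other_vertex)
  have ind: "independent ((\<lambda>x. -a + x) ` (V - {a}))"
    using affine_dependent_iff_dependent2[OF a(1)] affine_independent by simp
  obtain f :: "real^'n \<Rightarrow> real" where f: "linear f"
    "\<And>x. x \<in> (\<lambda>x. -a + x) ` (V - {a}) \<Longrightarrow> f x = (if x = -a + v then 1 else 0)"
    using linear_independent_extend[OF ind, of "\<lambda>x. if x = -a + v then 1 else 0"] by blast
  have fx: "f x = adjoint f 1 \<bullet> x" for x
    using adjoint_works[OF f(1), of x 1] by (simp add: inner_commute)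
  have f': "f (-a + x) = (if x = v then 1 else 0)" if "x \<in> V" for x
    using f(2)[of "-a + x"] that a linear_0[OF f(1)] by (cases "x = a") auto
  have "\<forall>w\<in>V. adjoint f 1 \<bullet> w + f (-a) = (if w = v then 1 else 0)"
    using f' linear_add[OF f(1)] by (metis add.commute fx)
  then have "\<exists>p. case p of (g, c) \<Rightarrow> \<forall>w\<in>V. g \<bullet> w + c = (if w = v then 1 else 0)" by blast
  from someI_ex[OF this]
  have "\<forall>w\<in>V. fst (bary_pair V v) \<bullet> w + snd (bary_pair V v) = (if w = v then 1 else 0)"
    by (simp only: bary_pair_def case_prod_unfold)
  then show ?thesis
    using assms(2) by (simp add: bary_def bary_grad_def)
qed

lemma bary_comb:
  assumes "sum u V = 1" "v \<in> V"
  shows "bary V v (\<Sum>w\<in>V. u w *\<^sub>R w) = u v"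
  using assms by (simp add: bary_affine_comb bary_vertex if_distrib cong: if_cong)

lemma affine_hull_vertices: "affine hull V = UNIV"
proof -
  have "aff_dim V = int CARD('n)"
    using aff_dim_unique[of V V] affine_independent card_vertices
    by (simp add: aff_dim_affine_independent)
  then show ?thesis using aff_dim_eq_full[of V] by simp
qed

lemma bary_expand_ex:
  obtains u where "sum u V = 1" "(\<Sum>w\<in>V. u w *\<^sub>R w) = x"
proof -
  have "x \<in> {y. \<exists>u. sum u V = 1 \<and> (\<Sum>w\<in>V. u w *\<^sub>R w) = y}"
    using affine_hull_finite[OF finite_vertices] affine_hull_vertices by blast
  then show ?thesis using that by blast
qed

lemma sum_bary: "(\<Sum>v\<in>V. bary V v x) = 1"
  and bary_expand: "(\<Sum>v\<in>V. bary V v x *\<^sub>R v) = x"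
proof -
  obtain u where u: "sum u V = 1" "(\<Sum>w\<in>V. u w *\<^sub>R w) = x" by (rule bary_expand_ex)
  then have "bary V v x = u v" if "v \<in> V" for v using bary_comb[OF u(1) that] by simp
  then show "(\<Sum>v\<in>V. bary V v x) = 1" "(\<Sum>v\<in>V. bary V v x *\<^sub>R v) = x" using u by simp_all
qed

lemma affine_hull_iff:
  assumes "W \<subseteq> V"
  shows "x \<in> affine hull W \<longleftrightarrow> (\<forall>v\<in>V - W. bary V v x = 0)"
proof
  assume "x \<in> affine hull W"
  then obtain u where u: "sum u W = 1" "(\<Sum>w\<in>W. u w *\<^sub>R w) = x"
    using affine_hull_finite[OF finite_subset_vertices[OF assms]] by auto
  show "\<forall>v\<in>V - W. bary V v x = 0"
    using assms by (auto simp: u(2)[symmetric] bary_affine_comb[OF u(1)] bary_vertex subset_iff intro!: sum.neutral)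
next
  assume *: "\<forall>v\<in>V - W. bary V v x = 0"
  have "(\<Sum>v\<in>W. bary V v x) = 1" "(\<Sum>v\<in>W. bary V v x *\<^sub>R v) = x"
    using sum.mono_neutral_right[OF finite_vertices assms, of "\<lambda>v. bary V v x"]
      sum.mono_neutral_right[OF finite_vertices assms, of "\<lambda>v. bary V v x *\<^sub>R v"] * sum_bary bary_expand
    by auto
  then show "x \<in> affine hull W"
    unfolding affine_hull_finite[OF finite_subset_vertices[OF assms]]
    by (auto intro!: exI[of _ "\<lambda>v. bary V v x"])
qed

lemma convex_hull_iff:
  assumes "W \<subseteq> V"
  shows "x \<in> convex hull W \<longleftrightarrow> (\<forall>v\<in>V. 0 \<le> bary V v x) \<and> (\<forall>v\<in>V - W. bary V v x = 0)"
proof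
  assume x: "x \<in> convex hull W"
  then obtain u where u: "\<forall>w\<in>W. 0 \<le> u w" "sum u W = 1" "(\<Sum>w\<in>W. u w *\<^sub>R w) = x"
    using convex_hull_finite[OF finite_subset_vertices[OF assms]] by auto
  have "0 \<le> bary V v x" if "v \<in> V" for v
    using assms u(1) that
    by (auto simp: u(3)[symmetric] bary_affine_comb[OF u(2)] bary_vertex subset_iff intro!: sum_nonneg)
  then show "(\<forall>v\<in>V. 0 \<le> bary V v x) \<and> (\<forall>v\<in>V - W. bary V v x = 0)"
    using affine_hull_iff[OF assms] x convex_hull_subset_affine_hull by blast
next
  assume *: "(\<forall>v\<in>V. 0 \<le> bary V v x) \<and> (\<forall>v\<in>V - W. bary V v x = 0)"
  have "(\<Sum>v\<in>W. bary V v x) = 1" "(\<Sum>v\<in>W. bary V v x *\<^sub>R v) = x"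
    using sum.mono_neutral_right[OF finite_vertices assms, of "\<lambda>v. bary V v x"]
      sum.mono_neutral_right[OF finite_vertices assms, of "\<lambda>v. bary V v x *\<^sub>R v"] * sum_bary bary_expand
    by auto
  then show "x \<in> convex hull W"
    unfolding convex_hull_finite[OF finite_subset_vertices[OF assms]]
    using * assms by (auto intro!: exI[of _ "\<lambda>v. bary V v x"])
qed

lemma simplex_iff: "x \<in> convex hull V \<longleftrightarrow> (\<forall>v\<in>V. 0 \<le> bary V v x)"
  using convex_hull_iff[of V] by simp

section \<open>Faces of a simplex as sets of vertices\<close>

lemma vertices_in_hull:
  assumes "W \<subseteq> V"
  shows "V \<inter> convex hull W = W"
proof -
  have "v \<in> W" if "v \<in> V" "v \<in> convex hull W" for v
    using that(2) convex_hull_iff[OF assms] that(1) bary_vertex[OF that(1,1)] by (metis DiffI zero_neq_one)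
  then show ?thesis using assms hull_subset[of W convex] by blast
qed

lemma aff_dim_hull: "W \<subseteq> V \<Longrightarrow> aff_dim (convex hull W) = int (card W) - 1"
  using aff_dim_affine_independent[OF affine_independent_subset[OF affine_independent]]
  by (simp add: aff_dim_convex_hull)

lemma face_iff: "f face_of convex hull V \<longleftrightarrow> (\<exists>W\<subseteq>V. f = convex hull W)"
  using face_of_convex_hull_affine_independent[OF affine_independent] by blast

lemma hull_in_subsimplices:
  assumes "W \<subseteq> V" "card W = l + 1"
  shows "convex hull W \<in> subsimplices l (convex hull V)"
  using assms face_iff affine_independent_subset[OF affine_independent assms(1)]
  by (auto simp: subsimplices_def simplex_def)

lemma subsimplices_iff:
  "f \<in> subsimplices l (convex hull V) \<longleftrightarrow> (\<exists>W\<subseteq>V. card W = l + 1 \<and> f = convex hull W)"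
proof
  assume f: "f \<in> subsimplices l (convex hull V)"
  then obtain W where W: "W \<subseteq> V" "f = convex hull W"
    using face_iff by (auto simp: subsimplices_def)
  have "aff_dim f = int l" using f by (auto simp: subsimplices_def aff_dim_simplex)
  then have "card W = l + 1" using aff_dim_hull[OF W(1)] W(2) by simp
  then show "\<exists>W\<subseteq>V. card W = l + 1 \<and> f = convex hull W" using W by blast
qed (use hull_in_subsimplices in blast)

text \<open>The moments (d) run over sub-simplices of a facet rather than of T. A face of a face is
  a face of T, and inclusion of hulls is inclusion of vertex sets, so these are again given by
  subsets of vertices.\<close>

lemma subsimplices_hull_iff:
  assumes "U \<subseteq> V"
  shows "f \<in> subsimplices l (convex hull U) \<longleftrightarrow> (\<exists>W\<subseteq>U. card W = l + 1 \<and> f = convex hull W)"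
proof -
  have U: "convex hull U face_of convex hull V" using face_iff assms by blast
  have "f face_of convex hull U \<longleftrightarrow> f face_of convex hull V \<and> f \<subseteq> convex hull U"
    using face_of_trans[OF _ U] face_of_imp_subset face_of_subset[OF _ _ face_of_imp_subset[OF U]] by metis
  then have "f \<in> subsimplices l (convex hull U) \<longleftrightarrow> f \<in> subsimplices l (convex hull V) \<and> f \<subseteq> convex hull U"
    by (auto simp: subsimplices_def)
  also have "\<dots> \<longleftrightarrow> (\<exists>W\<subseteq>V. card W = l + 1 \<and> f = convex hull W \<and> convex hull W \<subseteq> convex hull U)"
    unfolding subsimplices_iff by blast
  also have "\<dots> \<longleftrightarrow> (\<exists>W\<subseteq>U. card W = l + 1 \<and> f = convex hull W)"
  proof -
    have "W \<subseteq> U" if "W \<subseteq> V" "convex hull W \<subseteq> convex hull U" for W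
      using vertices_in_hull[OF assms] vertices_in_hull[OF that(1)] that by blast
    moreover have "convex hull W \<subseteq> convex hull U" if "W \<subseteq> U" for W
      using that by (rule hull_mono)
    ultimately show ?thesis using assms by (metis order_trans)
  qed
  finally show ?thesis .
qed

section \<open>Gradients of barycentric coordinates as normals of faces\<close>

lemma bary_grad_vertex:
  assumes "v \<in> V" "w \<in> V" "a \<in> V"
  shows "bary_grad V v \<bullet> (w - a) = (if w = v then 1 else 0) - (if a = v then 1 else 0)"
  using assms by (simp add: bary_diff[symmetric] bary_vertex)

lemma bary_grad_nonzero:
  assumes "v \<in> V"
  shows "bary_grad V v \<noteq> 0"
proof -
  obtain a where "a \<in> V" "a \<noteq> v" by (rule other_vertex)
  then have "bary_grad V v \<bullet> (v - a) = 1" using bary_grad_vertex[OF assms assms] by simp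
  then show ?thesis by auto
qed

text \<open>Pairing with y turns the left side into w . y: the gradients sum to zero because the
  coordinates sum to one, and y is the sum of the vertices weighted by grad lambda_v . y because the
  coordinates reproduce points. By the first fact the base vertex \<open>a\<close> drops
  out.\<close>

lemma bary_grad_expand:
  assumes "a \<in> V"
  shows "(\<Sum>v\<in>V. (w \<bullet> (v - a)) *\<^sub>R bary_grad V v) = w"
proof -
  have "(\<Sum>v\<in>V. (w \<bullet> (v - a)) *\<^sub>R bary_grad V v) \<bullet> y = w \<bullet> y" for y
  proof -
    have "(\<Sum>v\<in>V. (bary_grad V v \<bullet> y)) = 0" 
      using sum_bary[of "y"] sum_bary[of 0] bary_diff[of V _ y 0]
      by (metis (no_types, lifting) diff_0_right diff_self sum.cong sum_subtractf)
    moreover have "(\<Sum>v\<in>V. (bary_grad V v \<bullet> y) *\<^sub>R v) = y"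
    proof -
      have "(\<Sum>v\<in>V. (bary_grad V v \<bullet> (y - 0)) *\<^sub>R v) = y - 0"
        unfolding bary_diff[symmetric] scaleR_left_diff_distrib sum_subtractf bary_expand by simp
      then show ?thesis by simp
    qed
    ultimately have "w \<bullet> y = w \<bullet> (\<Sum>v\<in>V. (bary_grad V v \<bullet> y) *\<^sub>R v) - (w \<bullet> a) * (\<Sum>v\<in>V. (bary_grad V v \<bullet> y))"
      by simp
    also have "\<dots> = (\<Sum>v\<in>V. (w \<bullet> (v - a)) *\<^sub>R bary_grad V v) \<bullet> y"
      by (simp add: inner_sum_left inner_sum_right inner_diff_right sum_distrib_left sum_subtractf[symmetric] algebra_simps)
    finally show ?thesis by simp
  qed
  then show ?thesis by (metis vector_eq_rdot)
qed

lemma normal_to_iff: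
  assumes "W \<subseteq> V" "a \<in> W"
  shows "normal_to (convex hull W) w \<longleftrightarrow> (\<forall>v\<in>W. w \<bullet> (v - a) = 0)"
proof
  assume "normal_to (convex hull W) w"
  then show "\<forall>v\<in>W. w \<bullet> (v - a) = 0"
    using assms hull_inc[of _ W affine]
    by (fastforce simp: normal_to_def tangent_space_convex_hull orthogonal_def)
next
  assume *: "\<forall>v\<in>W. w \<bullet> (v - a) = 0"
  have "w \<bullet> x = w \<bullet> a" if "x \<in> affine hull W" for x
  proof -
    have "x \<in> {y. \<exists>u. sum u W = 1 \<and> (\<Sum>w\<in>W. u w *\<^sub>R w) = y}"
      using that affine_hull_finite[OF finite_subset_vertices[OF assms(1)]] by blast
    then obtain u where u: "sum u W = 1" "(\<Sum>w\<in>W. u w *\<^sub>R w) = x" by blast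
    have "w \<bullet> x = (\<Sum>v\<in>W. u v * (w \<bullet> a))"
      unfolding u(2)[symmetric] inner_sum_right using * by (intro sum.cong) (auto simp: inner_diff_right)
    then show ?thesis by (simp add: sum_distrib_right[symmetric] u(1))
  qed
  then show "normal_to (convex hull W) w"
    by (auto simp: normal_to_def tangent_space_convex_hull orthogonal_def inner_diff_right)
qed

text \<open>In the expansion of an arbitrary vector the coefficients belonging to vertices of W are
  products with edges of the face, which vanish for a normal. Thus the gradients of the vertices
  outside W span the normal space of the face.\<close>

lemma normal_expand:
  assumes "W \<subseteq> V" "a \<in> W" "normal_to (convex hull W) w"
  shows "w = (\<Sum>v\<in>V - W. (w \<bullet> (v - a)) *\<^sub>R bary_grad V v)"
proof -
  have "a \<in> V" using assms by auto
  from bary_grad_expand[OF this, of w] show ?thesis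
    using assms normal_to_iff[OF assms(1,2)]
    by (subst sum.mono_neutral_left[of V "V - W"]) auto
qed

lemma normal_to_bary_grad:
  assumes "W \<subseteq> V" "W \<noteq> {}" "v \<in> V - W"
  shows "normal_to (convex hull W) (bary_grad V v)"
proof -
  obtain a where a: "a \<in> W" using assms(2) by auto
  have "bary_grad V v \<bullet> (w - a) = 0" if "w \<in> W" for w
    using assms a that by (subst bary_grad_vertex) auto
  then show ?thesis using normal_to_iff[OF assms(1) a] by blast
qed

lemma facet_iff: 
  "F \<in> subsimplices (CARD('n) - 1) (convex hull V) \<longleftrightarrow> (\<exists>v\<in>V. F = convex hull (V - {v}))"
proof -
  have "(\<exists>W\<subseteq>V. card W = CARD('n) - 1 + 1 \<and> F = convex hull W) \<longleftrightarrow> (\<exists>v\<in>V. F = convex hull (V - {v}))"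
  proof
    assume "\<exists>W\<subseteq>V. card W = CARD('n) - 1 + 1 \<and> F = convex hull W"
    then obtain W where W: "W \<subseteq> V" "card W = CARD('n)" "F = convex hull W" by auto
    then have "card (V - W) = 1"
      using card_vertices by (simp add: card_Diff_subset finite_subset_vertices)
    then obtain v where "V - W = {v}" by (auto simp: card_1_singleton_iff)
    then have "W = V - {v}" "v \<in> V" using W by auto
    then show "\<exists>v\<in>V. F = convex hull (V - {v})" using W by auto
  next
    assume "\<exists>v\<in>V. F = convex hull (V - {v})"
    then obtain v where "v \<in> V" "F = convex hull (V - {v})" by blast
    then show "\<exists>W\<subseteq>V. card W = CARD('n) - 1 + 1 \<and> F = convex hull W"
      using card_vertices by (intro exI[of _ "V - {v}"]) auto
  qed
  then show ?thesis using subsimplices_iff by blast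
qed

lemma facet_nonempty: "V - {v} \<noteq> {}"
  using other_vertex[of v] by auto

text \<open>Only one vertex lies outside a facet, so the expansion of its normal has a single term.
  Statements about the chosen normals and about gradients can therefore be exchanged.\<close>

lemma facet_normal:
  assumes "v \<in> V" "unit_normal (convex hull (V - {v})) u"
  obtains s where "u = s *\<^sub>R bary_grad V v" "s \<noteq> 0"
proof -
  obtain a where a: "a \<in> V - {v}" using facet_nonempty by auto
  have "V - (V - {v}) = {v}" using assms(1) by auto
  then have "u = (u \<bullet> (v - a)) *\<^sub>R bary_grad V v"
    using normal_expand[OF _ a, of u] assms(2) by (auto simp: unit_normal_def)
  moreover have "u \<noteq> 0" using assms(2) by (auto simp: unit_normal_def)
  ultimately show ?thesis using that by (metis scaleR_zero_left)
qed

end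

lemma full_simplexE:
  fixes T :: "(real^'n) set"
  assumes "int DIM(real^'n) simplex T"
  obtains V where "full_simplex V" "T = convex hull V"
proof -
  obtain V where V: "\<not> affine_dependent V" "int (card V) = int DIM(real^'n) + 1" "T = convex hull V"
    using assms by (auto simp: simplex_def)
  moreover have "card V = CARD('n) + 1" using V(2) by simp
  ultimately show ?thesis using that by (auto simp: full_simplex_def)
qed


section \<open>Bubble functions\<close>

definition bubble :: "(real^'n) set \<Rightarrow> (real^'n) set \<Rightarrow> real^'n \<Rightarrow> real" where
  "bubble V W x = (\<Prod>v\<in>W. bary V v x)"

lemma continuous_on_bubble [continuous_intros]:
  "continuous_on S f \<Longrightarrow> continuous_on S (\<lambda>x. bubble V W (f x))"
  unfolding bubble_def by (intro continuous_intros)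

lemma bubble_polynomial: "finite W \<Longrightarrow> bubble V W \<in> polynomials (int (card W))"
proof (induction W rule: finite_induct)
  case empty
  then show ?case using polynomials_const[of 0 1] by (simp add: bubble_def[abs_def])
next
  case (insert v W)
  from polynomials_mult[OF bary_polynomial[of V v] insert(3)] insert(1,2) show ?case
    by (simp add: bubble_def[abs_def])
qed

context full_simplex
begin

lemma bubble_nonneg: "W \<subseteq> V \<Longrightarrow> x \<in> convex hull V \<Longrightarrow> 0 \<le> bubble V W x"
  using simplex_iff by (auto simp: bubble_def intro!: prod_nonneg)

lemma face_barycenter:
  assumes "W \<subseteq> V" "W \<noteq> {}"
  obtains b where "b \<in> convex hull W" "\<And>v. v \<in> W \<Longrightarrow> 0 < bary V v b"
proof -
  define b where "b = (\<Sum>w\<in>W. (1 / card W) *\<^sub>R w)"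
  have fin: "finite W" using finite_subset_vertices assms(1) .
  have 1: "(\<Sum>w\<in>W. 1 / real (card W)) = 1" using assms(2) fin by simp
  have "b \<in> convex hull W" unfolding convex_hull_finite[OF fin] b_def
    using 1 by (intro CollectI exI[of _ "\<lambda>_. 1 / card W"]) auto
  moreover have "0 < bary V v b" if "v \<in> W" for v
  proof -
    have "bary V v b = (\<Sum>w\<in>W. 1 / card W * bary V v w)"
      unfolding b_def by (rule bary_affine_comb[OF 1])
    also have "\<dots> = (\<Sum>w\<in>W. if w = v then 1 / card W else 0)"
      using assms that by (intro sum.cong) (auto simp: bary_vertex subset_iff)
    also have "\<dots> = 1 / card W" using that fin by simp
    finally show ?thesis using that fin by (auto simp: card_gt_0_iff)
  qed
  ultimately show ?thesis using that by blast
qed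

text \<open>Points moved towards the barycentre of the face have positive coordinates and converge
  back, so the relative interior is dense. Bubble functions can be cancelled only there; continuity
  then extends the conclusion to the whole face.\<close>

lemma zero_on_face_by_density:
  fixes h :: "real^'n \<Rightarrow> 'b::real_normed_vector"
  assumes "W \<subseteq> V" "continuous_on (convex hull W) h"
    and zero: "\<And>x. x \<in> convex hull W \<Longrightarrow> (\<And>v. v \<in> W \<Longrightarrow> 0 < bary V v x) \<Longrightarrow> h x = 0"
    and x: "x \<in> convex hull W"
  shows "h x = 0"
proof -
  have "W \<noteq> {}" using x by auto
  then obtain b where b: "b \<in> convex hull W" "\<And>v. v \<in> W \<Longrightarrow> 0 < bary V v b"
    using face_barycenter[OF assms(1)] by blast
  define y where "y k = (1 - inverse (real (Suc k))) *\<^sub>R x + inverse (real (Suc k)) *\<^sub>R b" for k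
  have y: "y k \<in> convex hull W" for k
    unfolding y_def using x b(1) convex_convex_hull by (intro convexD) (auto simp: field_simps)
  have "h (y k) = 0" for k
  proof (rule zero[OF y])
    fix v assume v: "v \<in> W"
    then have "0 \<le> bary V v x" using x convex_hull_iff[OF assms(1)] assms(1) by auto
    then show "0 < bary V v (y k)"
      unfolding y_def bary_convex_comb using b(2)[OF v]
      by (intro add_nonneg_pos mult_nonneg_nonneg mult_pos_pos) (auto simp: field_simps)
  qed
  moreover have "y \<longlonglongrightarrow> (1 - 0) *\<^sub>R x + 0 *\<^sub>R b"
    unfolding y_def by (intro tendsto_intros LIMSEQ_inverse_real_of_nat)
  then have "(\<lambda>k. h (y k)) \<longlonglongrightarrow> h x"
    using assms(2) x y by (auto simp: continuous_on_sequentially o_def)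
  ultimately show ?thesis by (simp add: LIMSEQ_const_iff)
qed

text \<open>The full weight of v is transferred to j, so the point stays in the face. The
  displacement is proportional to lambda_v(x), which serves twice: for dividing a polynomial by
  lambda_v, and for bounding a Lipschitz function near a facet by lambda_v.\<close>

lemma slide_to_facet:
  assumes "W \<subseteq> V" "v \<in> W" "j \<in> W" "j \<noteq> v" "x \<in> convex hull W"
  shows "x + bary V v x *\<^sub>R (j - v) \<in> convex hull (W - {v})"
proof -
  have vj: "v \<in> V" "j \<in> V" using assms by auto
  have eq: "bary V u (x + bary V v x *\<^sub>R (j - v))
      = bary V u x + bary V v x * ((if u = j then 1 else 0) - (if u = v then 1 else 0))" if "u \<in> V" for u
    unfolding bary_add using bary_grad_vertex[OF that vj(2,1)] by (auto)
  have sub: "W - {v} \<subseteq> V" using assms by auto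
  show ?thesis
    unfolding convex_hull_iff[OF sub]
  proof (intro conjI ballI)
    fix u assume u: "u \<in> V"
    then show "0 \<le> bary V u (x + bary V v x *\<^sub>R (j - v))"
      unfolding eq[OF u] using assms(5,4) convex_hull_iff[OF assms(1)] vj(1) by auto
  next
    fix u assume u: "u \<in> V - (W - {v})"
    then have "u \<in> V" "u = v \<or> u \<notin> W" by auto
    then show "bary V u (x + bary V v x *\<^sub>R (j - v)) = 0"
      using eq[of u] assms(5,4,3,2) convex_hull_iff[OF assms(1)] by auto
  qed
qed

text \<open>One barycentric coordinate \<open>\<lambda>\<^sub>v\<close> is divided off at a time: the shift \<open>x + \<lambda>\<^sub>v(x) (j - v)\<close> maps the
  face into the facet \<open>\<lambda>\<^sub>v = 0\<close>, where the cofactor vanishes, and changes it by a multiple of \<open>\<lambda>\<^sub>v\<close>.\<close>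

lemma bubble_divides:
  fixes s :: "real^'n \<Rightarrow> real"
  assumes W: "W \<subseteq> V" "card W \<ge> 2" and s: "s \<in> polynomials k"
    and zero: "\<And>v x. v \<in> W \<Longrightarrow> x \<in> convex hull (W - {v}) \<Longrightarrow> s x = 0"
  obtains h where "h \<in> polynomials (k - int (card W))" 
    "\<And>x. x \<in> convex hull W \<Longrightarrow> s x = bubble V W x * h x"
proof -
  have fin: "finite W" using finite_subset_vertices W(1) .
  have "\<exists>h\<in>polynomials (k - int (card U)). \<forall>x\<in>convex hull W. s x = bubble V U x * h x"
    if "U \<subseteq> W" for U
    using finite_subset[OF that fin] that
  proof (induction U rule: finite_induct)
    case empty
    then show ?case using s by (auto simp: bubble_def)
  next
    case (insert v U)
    then obtain h where h: "h \<in> polynomials (k - int (card U))"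
      "\<And>x. x \<in> convex hull W \<Longrightarrow> s x = bubble V U x * h x" by auto
    have v: "v \<in> W" "v \<notin> U" using insert by auto
    have sub: "W - {v} \<subseteq> V" using W by auto
    have face: "x \<in> convex hull W" if "x \<in> convex hull (W - {v})" for x
      using that hull_mono[of "W - {v}" W convex] by auto
    have h0: "h x = 0" if "x \<in> convex hull (W - {v})" for x
    proof (rule zero_on_face_by_density[OF sub _ _ that])
      show "continuous_on (convex hull (W - {v})) h" using continuous_on_polynomial[OF h(1)] .
    next
      fix y assume y: "y \<in> convex hull (W - {v})" "\<And>u. u \<in> W - {v} \<Longrightarrow> 0 < bary V u y"
      \<comment> \<open>The factors in U do not include lambda_v, hence are positive in the relative
        interior of the facet, and the zero of s passes to the cofactor.\<close>
      have "bubble V U y > 0" unfolding bubble_def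
        using y(2) insert by (intro prod_pos) auto
      then show "h y = 0" using h(2)[OF face[OF y(1)]] zero[OF v(1) y(1)] by simp
    qed
    \<comment> \<open>The slide needs a second vertex to receive the weight; this is where faces of
      dimension zero are excluded.\<close>
    have "\<not> W \<subseteq> {v}" using W(2) card_mono[of "{v}" W] by auto
    then obtain j where j: "j \<in> W" "j \<noteq> v" by auto
    obtain h' where h': "h' \<in> polynomials (k - int (card U) - 1)"
      "\<And>x. h (x + bary V v x *\<^sub>R (j - v)) = h x + bary V v x *\<^sub>R h' x"
      using polynomials_affine_shift[OF h(1), of "bary_grad V v" "snd (bary_pair V v)" "j - v"]
      by (auto simp: bary_def)
    have "s x = bubble V (insert v U) x * - h' x" if x: "x \<in> convex hull W" for x
    proof -
      have "h x = bary V v x * - h' x"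
        using h'(2)[of x] h0[OF slide_to_facet[OF W(1) v(1) j x]] by simp
      then show ?thesis using h(2)[OF x] insert(1,2) by (simp add: bubble_def)
    qed
    moreover have "(\<lambda>x. - h' x) \<in> polynomials (k - int (card (insert v U)))"
      using polynomials_scaleR[OF h'(1), of "-1"] insert(1,2) by (simp add: algebra_simps)
    ultimately show ?case by (intro bexI[where x = "\<lambda>x. - h' x"] ballI)
  qed
  from this[OF order_refl] show ?thesis using that by blast
qed

end


section \<open>Positivity of the flat measure\<close>

definition flat_chart :: "'a::euclidean_space set \<Rightarrow> (nat \<Rightarrow> real) \<Rightarrow> 'a" where
  "flat_chart f y = fst (frame_of f) + (\<Sum>i<nat (aff_dim f). y i *\<^sub>R snd (frame_of f) i)"

lemma flat_measure_eq:
  "flat_measure f = distr (Pi\<^sub>M {..<nat (aff_dim f)} (\<lambda>_. lborel)) borel (flat_chart f)"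
  by (simp add: flat_measure_def flat_chart_def[abs_def])

lemma sets_flat_measure [simp, measurable_cong]: "sets (flat_measure f) = sets borel"
  and space_flat_measure [simp]: "space (flat_measure f) = UNIV"
  by (simp_all add: flat_measure_eq)

lemma flat_chart_measurable' [measurable]:
  "flat_chart f \<in> Pi\<^sub>M {..<nat (aff_dim f)} (\<lambda>_. lborel) \<rightarrow>\<^sub>M borel"
  unfolding flat_chart_def[abs_def] by (rule flat_chart_measurable)

lemma frame_of_simps:
  assumes "f \<noteq> {}" 
  shows "fst (frame_of f) \<in> affine hull f"
    and "i < nat (aff_dim f) \<Longrightarrow> snd (frame_of f) i \<in> tangent_space f"
    and "i < nat (aff_dim f) \<Longrightarrow> j < nat (aff_dim f) \<Longrightarrow>
      snd (frame_of f) i \<bullet> snd (frame_of f) j = (if i = j then 1 else 0)"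
  using frame_of[OF assms] unfolding orthonormal_frame_def by blast+

lemma affine_hull_add_tangent:
  assumes "x \<in> affine hull f" "u \<in> tangent_space f"
  shows "x + u \<in> affine hull f"
proof -
  obtain y z where u: "u = y - z" "y \<in> affine hull f" "z \<in> affine hull f"
    using assms(2) by (auto simp: tangent_space_def)
  then show ?thesis
    using mem_affine_3_minus[OF affine_affine_hull assms(1) u(2,3), of 1] by simp
qed

lemma flat_chart_in_affine_hull:
  assumes "f \<noteq> {}"
  shows "flat_chart f y \<in> affine hull f"
  unfolding flat_chart_def
  using subspace_tangent_space(1)[OF assms] frame_of_simps[OF assms]
  by (intro affine_hull_add_tangent subspace_sum subspace_mul) auto

lemma flat_chart_coord:
  assumes "f \<noteq> {}" "j < nat (aff_dim f)"
  shows "(flat_chart f y - fst (frame_of f)) \<bullet> snd (frame_of f) j = y j"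
proof -
  have "(flat_chart f y - fst (frame_of f)) \<bullet> snd (frame_of f) j
      = (\<Sum>i<nat (aff_dim f). if i = j then y i else 0)"
    unfolding flat_chart_def add_diff_cancel_left' inner_sum_left
    using frame_of_simps(3)[OF assms(1) _ assms(2)] by (intro sum.cong) auto
  then show ?thesis using assms(2) by simp
qed

lemma flat_chart_surj:
  assumes "f \<noteq> {}" "x \<in> affine hull f"
  obtains y where "y \<in> PiE {..<nat (aff_dim f)} (\<lambda>_. UNIV)" "flat_chart f y = x"
proof -
  let ?l = "nat (aff_dim f)" and ?a = "fst (frame_of f)" and ?e = "snd (frame_of f)"
  have ip: "?e i \<bullet> ?e j = (if i = j then 1 else 0)" if "i < ?l" "j < ?l" for i j
    using frame_of_simps(3)[OF assms(1) that] .
  have inj: "inj_on ?e {..<?l}"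
    by (rule inj_onI) (metis ip lessThan_iff zero_neq_one)
  have orth: "pairwise orthogonal (?e ` {..<?l})"
    using ip by (auto simp: pairwise_def orthogonal_def)
  have "norm v = 1" if "v \<in> ?e ` {..<?l}" for v using that ip by (auto simp: norm_eq_1)
  note norm = this
  have "0 \<notin> ?e ` {..<?l}" using norm[of 0] by auto
  then have ind: "independent (?e ` {..<?l})" using orth pairwise_orthogonal_independent by blast
  have "card (?e ` {..<?l}) = dim (tangent_space f)"
    using inj subspace_tangent_space(2)[OF assms(1)] by (simp add: card_image)
  then have "tangent_space f \<subseteq> span (?e ` {..<?l})"
    using ind frame_of_simps(2)[OF assms(1)] card_ge_dim_independent[of "?e ` {..<?l}" "tangent_space f"]
    by auto
  moreover have "x - ?a \<in> tangent_space f"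
    using assms(2) frame_of_simps(1)[OF assms(1)] by (auto simp: tangent_space_def)
  ultimately have "(\<Sum>v\<in>?e ` {..<?l}. ((x - ?a) \<bullet> v) *\<^sub>R v) = x - ?a"
    using orthonormal_basis_expand[OF orth norm] by auto
  then have *: "(\<Sum>i<?l. ((x - ?a) \<bullet> ?e i) *\<^sub>R ?e i) = x - ?a"
    by (simp add: sum.reindex[OF inj])
  define y where "y = restrict (\<lambda>i. (x - ?a) \<bullet> ?e i) {..<?l}"
  have "flat_chart f y = x" unfolding flat_chart_def y_def using * by simp
  moreover have "y \<in> PiE {..<?l} (\<lambda>_. UNIV)" by (auto simp: y_def)
  ultimately show ?thesis using that by blast
qed

lemma emeasure_flat_box:
  fixes A :: "nat \<Rightarrow> real set"
  assumes "\<And>i. i < nat (aff_dim f) \<Longrightarrow> A i \<in> sets borel"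
  shows "emeasure (Pi\<^sub>M {..<nat (aff_dim f)} (\<lambda>_. lborel)) (PiE {..<nat (aff_dim f)} A)
    = (\<Prod>i<nat (aff_dim f). emeasure lborel (A i))"
proof -
  interpret product_sigma_finite "\<lambda>_. lborel :: real measure" ..
  show ?thesis using assms by (intro emeasure_PiM) auto
qed

text \<open>Orthonormality bounds every coordinate of a point by its distance from the base point,
  so the preimage of a bounded set under the chart lies in a box.\<close>

lemma emeasure_flat_measure_finite:
  assumes "compact f" "f \<noteq> {}"
  shows "emeasure (flat_measure f) f < \<infinity>"
proof -
  let ?l = "nat (aff_dim f)" and ?M = "Pi\<^sub>M {..<nat (aff_dim f)} (\<lambda>_. lborel :: real measure)"
  obtain R where R: "\<And>x. x \<in> f \<Longrightarrow> norm (x - fst (frame_of f)) \<le> R"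
    using compact_imp_bounded[OF assms(1)] bounded_translation_minus[of f "fst (frame_of f)"]
    by (auto simp: bounded_iff)
  have f: "f \<in> sets borel" using assms(1) by (simp add: compact_imp_closed)
  have "y \<in> PiE {..<?l} (\<lambda>_. {-R..R})" if "y \<in> space ?M" "flat_chart f y \<in> f" for y
  proof (rule PiE_I)
    fix j assume j: "j \<in> {..<?l}"
    have "norm (snd (frame_of f) j) = 1" using frame_of_simps(3)[OF assms(2), of j j] j by (simp add: norm_eq_1)
    then have "\<bar>y j\<bar> \<le> norm (flat_chart f y - fst (frame_of f))"
      using flat_chart_coord[OF assms(2), of j y] j
        Cauchy_Schwarz_ineq2[of "flat_chart f y - fst (frame_of f)" "snd (frame_of f) j"] by simp
    then show "y j \<in> {-R..R}" using R[OF that(2)] by auto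
  qed (use that in \<open>auto simp: space_PiM PiE_def extensional_def\<close>)
  then have "flat_chart f -` f \<inter> space ?M \<subseteq> PiE {..<?l} (\<lambda>_. {-R..R})" by auto
  then have "emeasure (flat_measure f) f \<le> emeasure ?M (PiE {..<?l} (\<lambda>_. {-R..R}))"
    unfolding flat_measure_eq using f
    by (subst emeasure_distr) (auto intro!: emeasure_mono sets_PiM_I_finite)
  also have "\<dots> = (\<Prod>i<?l. emeasure lborel {-R..R})" by (rule emeasure_flat_box) auto
  also have "\<dots> < \<infinity>" by (simp add: emeasure_lborel_Icc_eq ennreal_power)
  finally show ?thesis .
qed

lemma set_integrable_flat_measure:
  fixes g :: "'a::euclidean_space \<Rightarrow> real"
  assumes "compact f" "f \<noteq> {}" "continuous_on f g"
  shows "set_integrable (flat_measure f) f g"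
proof -
  have f: "f \<in> sets borel" using assms(1) by (simp add: compact_imp_closed)
  obtain B where B: "\<And>x. x \<in> f \<Longrightarrow> norm (g x) \<le> B"
    using compact_imp_bounded[OF compact_continuous_image[OF assms(3,1)]] by (auto simp: bounded_iff)
  show ?thesis
    unfolding set_integrable_def
  proof (rule Bochner_Integration.integrable_bound)
    show "integrable (flat_measure f) (\<lambda>x. indicat_real f x * B)"
      using emeasure_flat_measure_finite[OF assms(1,2)] f by (intro integrable_mult_left integrable_real_indicator) auto
    show "(\<lambda>x. indicat_real f x *\<^sub>R g x) \<in> borel_measurable (flat_measure f)"
      using borel_measurable_continuous_on_indicator[OF f assms(3)] by simp
    show "AE x in flat_measure f. norm (indicat_real f x *\<^sub>R g x) \<le> norm (indicat_real f x * B)"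
      using B by (intro AE_I2) (force simp: indicator_def)
  qed
qed

text \<open>If g were positive at a point of the relative interior, it would be positive on the
  chart image of a small open box, and boxes have positive measure. A single vertex is covered too:
  the box is then the unique point of the empty product, of mass one.\<close>

lemma (in full_simplex) flat_integral_zero_imp:
  fixes g :: "real^'n \<Rightarrow> real"
  assumes W: "W \<subseteq> V" "W \<noteq> {}" and cont: "continuous_on (convex hull W) g"
    and nonneg: "\<And>x. x \<in> convex hull W \<Longrightarrow> 0 \<le> g x"
    and zero: "(LINT x:convex hull W|flat_measure (convex hull W). g x) = 0"
    and x: "x \<in> convex hull W"
  shows "g x = 0"
proof (rule zero_on_face_by_density[OF W(1) cont _ x])
  fix x assume x: "x \<in> convex hull W" "\<And>v. v \<in> W \<Longrightarrow> 0 < bary V v x"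
  let ?f = "convex hull W"
  let ?l = "nat (aff_dim ?f)" and ?e = "snd (frame_of ?f)"
  let ?M = "Pi\<^sub>M {..<?l} (\<lambda>_. lborel :: real measure)"
  have ne: "?f \<noteq> {}" and comp: "compact ?f"
    using W finite_subset_vertices by (auto intro: finite_imp_compact_convex_hull)
  have f: "?f \<in> sets borel" using comp by (simp add: compact_imp_closed)
  have "integrable (flat_measure ?f) (\<lambda>x. indicat_real ?f x *\<^sub>R g x)"
    using set_integrable_flat_measure[OF comp ne cont] by (simp add: set_integrable_def)
  moreover have "AE x in flat_measure ?f. 0 \<le> indicat_real ?f x *\<^sub>R g x"
    using nonneg by (auto simp: indicator_def)
  ultimately have "AE x in flat_measure ?f. indicat_real ?f x *\<^sub>R g x = 0"
    using integral_nonneg_eq_0_iff_AE[of "flat_measure ?f" "\<lambda>x. indicat_real ?f x *\<^sub>R g x"] zero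
    unfolding set_lebesgue_integral_def by blast
  moreover have gm: "(\<lambda>x. indicat_real ?f x *\<^sub>R g x) \<in> borel_measurable borel"
    using borel_measurable_continuous_on_indicator[OF f cont] .
  have "{x \<in> space borel. indicat_real ?f x *\<^sub>R g x = 0} \<in> sets borel"
    using gm by measurable
  ultimately have ae: "AE y in ?M. indicat_real ?f (flat_chart ?f y) *\<^sub>R g (flat_chart ?f y) = 0"
    unfolding flat_measure_eq by (subst (asm) AE_distr_iff) (auto simp: space_borel)
  show "g x = 0"
  proof (rule ccontr)
    assume "g x \<noteq> 0"
    then have gx: "g x > 0" using nonneg[OF x(1)] by simp
    then obtain d1 where d1: "d1 > 0" "\<And>z. z \<in> ?f \<Longrightarrow> dist z x < d1 \<Longrightarrow> dist (g z) (g x) < g x"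
      using cont x(1) unfolding continuous_on_iff by blast
    have "open (\<Inter>v\<in>W. {z. 0 < bary V v z})"
      using finite_subset_vertices[OF W(1)]
      by (intro open_INT ballI open_Collect_less continuous_intros) auto
    then obtain d2 where d2: "d2 > 0" "ball x d2 \<subseteq> (\<Inter>v\<in>W. {z. 0 < bary V v z})"
      using x(2) open_contains_ball by blast
    \<comment> \<open>Close to x inside the affine hull one does not leave the face: coordinates of
      its vertices stay positive, all others vanish on the affine hull.\<close>
    have pos: "g z > 0 \<and> z \<in> ?f" if "z \<in> affine hull ?f" "dist z x < min d1 d2" for z
    proof -
      have nn: "0 \<le> bary V v z" if "v \<in> W" for v
      proof -
        have "z \<in> ball x d2" using \<open>dist z x < min d1 d2\<close> by (simp add: dist_commute)
        then have "0 < bary V v z" using d2(2) that by blast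
        then show ?thesis by simp
      qed
      have z0: "bary V v z = 0" if "v \<in> V - W" for v
        using \<open>z \<in> affine hull ?f\<close> affine_hull_iff[OF W(1)] that by (simp add: affine_hull_convex_hull)
      have "0 \<le> bary V v z" if "v \<in> V" for v
        using nn[of v] z0[of v] that by (cases "v \<in> W") auto
      then have "z \<in> ?f"
        unfolding convex_hull_iff[OF W(1)] using z0 by blast
      then show ?thesis using d1(2)[of z] that(2) by (auto simp: dist_real_def)
    qed
    obtain y0 where y0: "flat_chart ?f y0 = x"
      using flat_chart_surj[OF ne] x(1) hull_inc by metis
    \<comment> \<open>The image of a box point differs from x by at most the number of coordinates
      times \<eta>; the summand 1 makes the estimate strict and covers dimension zero.\<close>
    define \<eta> where "\<eta> = min d1 d2 / (real ?l + 1)"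
    have \<eta>: "\<eta> > 0" unfolding \<eta>_def using d1(1) d2(1) by (intro divide_pos_pos) auto
    define box where "box = PiE {..<?l} (\<lambda>i. {y0 i - \<eta> <..< y0 i + \<eta>})"
    have "dist (flat_chart ?f y) x < min d1 d2" if "y \<in> box" for y
    proof -
      have "flat_chart ?f y - x = (\<Sum>i<?l. (y i - y0 i) *\<^sub>R ?e i)"
        unfolding y0[symmetric] flat_chart_def by (simp add: scaleR_diff_left sum_subtractf)
      then have "norm (flat_chart ?f y - x) \<le> (\<Sum>i<?l. norm ((y i - y0 i) *\<^sub>R ?e i))"
        by (metis norm_sum)
      also have "\<dots> \<le> (\<Sum>i<?l. \<eta>)"
      proof (rule sum_mono)
        fix i assume i: "i \<in> {..<?l}"
        have "norm (?e i) = 1" using frame_of_simps(3)[OF ne, of i i] i by (simp add: norm_eq_1)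
        moreover have "\<bar>y i - y0 i\<bar> \<le> \<eta>" using PiE_mem[OF that[unfolded box_def] i] by auto
        ultimately show "norm ((y i - y0 i) *\<^sub>R ?e i) \<le> \<eta>" by simp
      qed
      also have "\<dots> < min d1 d2"
      proof -
        have "(real ?l + 1) * \<eta> = min d1 d2"
          unfolding \<eta>_def times_divide_eq_right by (rule nonzero_mult_div_cancel_left) linarith
        moreover have "(\<Sum>i<?l. \<eta>) < (real ?l + 1) * \<eta>"
          unfolding sum_constant card_lessThan distrib_right using \<eta> by simp
        ultimately show ?thesis by simp
      qed
      finally show ?thesis by (simp add: dist_norm)
    qed
    then have "indicat_real ?f (flat_chart ?f y) *\<^sub>R g (flat_chart ?f y) \<noteq> 0" if "y \<in> box" for y
      using pos[OF flat_chart_in_affine_hull[OF ne]] that by fastforce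
    moreover have "box \<in> sets ?M" unfolding box_def by (intro sets_PiM_I_finite) auto
    ultimately have "emeasure ?M box = 0"
      using ae sets.sets_into_space[of box ?M] 
      by (intro AE_iff_null_sets[THEN iffD2, THEN null_setsD1]) (auto elim!: eventually_mono)
    moreover have "emeasure ?M box = (\<Prod>i<?l. emeasure lborel {y0 i - \<eta> <..< y0 i + \<eta>})"
      unfolding box_def by (rule emeasure_flat_box) auto
    ultimately show False using \<eta> by auto
  qed
qed


section \<open>Representing functionals on finite-dimensional function spaces\<close>

interpretation fun_space: vector_space "\<lambda>a (f :: 'x \<Rightarrow> 'b::real_vector) x. a *\<^sub>R f x"
  by unfold_locales (auto simp: fun_eq_iff scaleR_add_right scaleR_add_left)

definition fun_subspace :: "('x \<Rightarrow> 'b::real_vector) set \<Rightarrow> bool" where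
  "fun_subspace P \<longleftrightarrow> (\<lambda>_. 0) \<in> P \<and> (\<forall>p\<in>P. \<forall>q\<in>P. \<forall>a b. (\<lambda>x. a *\<^sub>R p x + b *\<^sub>R q x) \<in> P)"

lemma fun_subspace_comb:
  "fun_subspace P \<Longrightarrow> p \<in> P \<Longrightarrow> q \<in> P \<Longrightarrow> (\<lambda>x. a *\<^sub>R p x + b *\<^sub>R q x) \<in> P"
  by (simp add: fun_subspace_def)

lemma fun_subspace_subspace:
  assumes "fun_subspace P"
  shows "fun_space.subspace P"
proof (rule fun_space.subspaceI)
  show "0 \<in> P" using assms by (simp add: fun_subspace_def zero_fun_def)
next
  fix p q assume "p \<in> P" "q \<in> P"
  from fun_subspace_comb[OF assms this, of 1 1] show "p + q \<in> P" by (simp add: plus_fun_def)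
next
  fix a p assume "p \<in> P"
  from fun_subspace_comb[OF assms this this, of a 0] show "(\<lambda>x. a *\<^sub>R p x) \<in> P" by simp
qed

lemma functional_on_comb:
  "functional_on P L \<Longrightarrow> p \<in> P \<Longrightarrow> q \<in> P \<Longrightarrow> L (\<lambda>x. a *\<^sub>R p x + b *\<^sub>R q x) = a * L p + b * L q"
  by (simp add: functional_on_def)

text \<open>Gram--Schmidt, carried out for the pairing directly so that no inner product type is needed.\<close>

lemma fun_riesz:
  fixes P :: "('x \<Rightarrow> 'b::real_vector) set"
  assumes P: "fun_subspace P" and fin: "finite G" "P \<subseteq> fun_space.span G"
    and ip: "\<And>p. p \<in> P \<Longrightarrow> functional_on P (ip p)"
    and sym: "\<And>p q. p \<in> P \<Longrightarrow> q \<in> P \<Longrightarrow> ip p q = ip q p"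
    and pos: "\<And>p. p \<in> P \<Longrightarrow> ip p p = 0 \<Longrightarrow> p = (\<lambda>_. 0)"
    and L: "functional_on P L"
  obtains p where "p \<in> P" "\<And>q. q \<in> P \<Longrightarrow> ip p q = L q"
proof -
  note comb = fun_subspace_comb[OF P]
  obtain B where B: "B \<subseteq> P" "fun_space.independent B" "P \<subseteq> fun_space.span B"
    using fun_space.maximal_independent_subset[of P] by blast
  have "finite B"
    using fun_space.independent_span_bound[OF fin(1) B(2)] B(1) fin(2) by auto
  have zero: "(\<lambda>_. 0) \<in> P" using P by (simp add: fun_subspace_def)
  have L0: "M (\<lambda>_. 0) = 0" if "functional_on P M" for M
    using functional_on_comb[OF that zero zero, of 0 0] by simp
  have spanP: "fun_space.span C \<subseteq> P" if "C \<subseteq> P" for C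
    using fun_space.span_minimal[OF that fun_subspace_subspace[OF P]] .
  have "q \<in> P \<and> ip p q = M q"
    if "C \<subseteq> P" "p \<in> P" "functional_on P M" "\<And>q. q \<in> C \<Longrightarrow> ip p q = M q" "q \<in> fun_space.span C"
    for C p q M
    using that(5)
  proof (induction rule: fun_space.span_induct_alt)
    case base
    then show ?case using L0[OF that(3)] L0[OF ip[OF that(2)]] zero by (simp add: zero_fun_def)
  next
    case (step c x y)
    then have xy: "x \<in> P" "y \<in> P" using that(1) by auto
    then show ?case
      using comb[OF xy, of c 1] functional_on_comb[OF that(3) xy, of c 1] functional_on_comb[OF ip[OF that(2)] xy, of c 1]
        step that(4)[of x] by (simp add: plus_fun_def)
  qed
  then have extend: "ip p q = M q"
    if "C \<subseteq> P" "p \<in> P" "functional_on P M" "\<And>q. q \<in> C \<Longrightarrow> ip p q = M q" "q \<in> fun_space.span C"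
    for C p q M using that by blast
  have "\<exists>p\<in>fun_space.span C. \<forall>q\<in>C. ip p q = M q" if "C \<subseteq> B" "functional_on P M" for C M
    using finite_subset[OF that(1) \<open>finite B\<close>] that
  proof (induction C arbitrary: M rule: finite_induct)
    case empty
    then show ?case using fun_space.span_zero by auto
  next
    case (insert b C)
    have C: "C \<subseteq> P" and b: "b \<in> P" using insert B(1) by auto
    obtain p where p: "p \<in> fun_space.span C" "\<forall>q\<in>C. ip p q = M q"
      using insert by blast
    \<comment> \<open>The induction hypothesis applied to the functional of b gives the projection
      of b onto the span of C; \<psi> is the part of b orthogonal to it.\<close>
    obtain s where s: "s \<in> fun_space.span C" "\<forall>q\<in>C. ip s q = ip b q"
      using insert.IH[OF _ ip[OF b]] insert.prems by auto
    have pP: "p \<in> P" and sP: "s \<in> P" using p(1) s(1) spanP[OF C] by auto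
    define \<psi> where "\<psi> = (\<lambda>x. 1 *\<^sub>R b x + (-1) *\<^sub>R s x)"
    have \<psi>: "\<psi> \<in> P" unfolding \<psi>_def by (rule comb[OF b sP])
    have ip\<psi>: "ip q \<psi> = ip q b - ip q s" if "q \<in> P" for q
      using functional_on_comb[OF ip[OF that] b sP, of 1 "-1"] by (simp add: \<psi>_def)
    have orth: "ip \<psi> q = 0" if "q \<in> fun_space.span C" for q
    proof -
      have q: "q \<in> P" using that spanP[OF C] by auto
      have "ip s q = ip b q"
        by (rule extend[OF C sP ip[OF b] _ that]) (use s(2) in auto)
      then show ?thesis using ip\<psi>[OF q] sym \<psi> q b sP by simp
    qed
    show ?case
    proof (cases "ip \<psi> \<psi> = 0")
      \<comment> \<open>No new direction: b already lies in the span of C, and linearity fixes the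
        value there.\<close>
      case True
      then have "\<psi> = (\<lambda>_. 0)" by (rule pos[OF \<psi>])
      then have "b = s" by (auto simp: \<psi>_def fun_eq_iff)
      then have "ip p b = M b"
        using extend[OF C pP insert.prems(2) _ s(1)] p(2) by auto
      then show ?thesis using p fun_space.span_mono[of C "insert b C"] by (intro bexI[of _ p]) auto
    next
      case False
      \<comment> \<open>Adding a multiple of \<psi> does not disturb the values on C. The factor
        repairs the value at b, since pairing \<psi> with b gives the same number as pairing it with
        itself.\<close>
      define c where "c = (M b - ip p b) / ip \<psi> \<psi>"
      define p' where "p' = (\<lambda>x. 1 *\<^sub>R p x + c *\<^sub>R \<psi> x)"
      have p'P: "p' \<in> P" unfolding p'_def by (rule comb[OF pP \<psi>])
      have ip': "ip p' q = ip p q + c * ip \<psi> q" if "q \<in> P" for q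
        using functional_on_comb[OF ip[OF that] pP \<psi>, of 1 c] sym[OF that] p'P pP \<psi>
        by (simp add: p'_def)
      have "ip \<psi> b = ip \<psi> \<psi>"
        using ip\<psi>[OF \<psi>] orth[OF s(1)] by simp
      then have "ip p' b = M b" using ip'[OF b] False by (simp add: c_def)
      moreover have "ip p' q = M q" if "q \<in> C" for q
        using ip'[of q] orth[OF fun_space.span_base[OF that]] p(2) that C by auto
      moreover have "p' \<in> fun_space.span (insert b C)"
      proof -
        have sub: "p \<in> fun_space.span (insert b C)" "s \<in> fun_space.span (insert b C)"
          using p(1) s(1) fun_space.span_mono[of C "insert b C"] by auto
        have "p + (\<lambda>x. c *\<^sub>R (b - s) x) \<in> fun_space.span (insert b C)"
          by (intro fun_space.span_add fun_space.span_scale fun_space.span_diff sub fun_space.span_base) auto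
        moreover have "p + (\<lambda>x. c *\<^sub>R (b - s) x) = p'"
          by (auto simp: p'_def \<psi>_def fun_eq_iff)
        ultimately show ?thesis by simp
      qed
      ultimately show ?thesis by (intro bexI[of _ p']) auto
    qed
  qed
  from this[OF order_refl L] obtain p where p: "p \<in> fun_space.span B" "\<forall>q\<in>B. ip p q = L q" by blast
  have pP: "p \<in> P" using p(1) spanP[OF B(1)] by auto
  have "ip p q = L q" if "q \<in> P" for q
    using extend[OF B(1) pP L _ subsetD[OF B(3) that]] p(2) by auto
  then show ?thesis using that pP by blast
qed

section \<open>Polynomial spaces on a set and linearity of the moments\<close>

lemma polys_on_cases:
  assumes "A \<in> polys_on k D"
  obtains p where "p \<in> polynomials k" "A = (\<lambda>x. if x \<in> D then p x else 0)"
  using assms unfolding polys_on_def by blast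

lemma polys_onI: "p \<in> polynomials k \<Longrightarrow> (\<lambda>x. if x \<in> D then p x else 0) \<in> polys_on k D"
  by (auto simp: polys_on_def)

lemma continuous_on_polys_on:
  fixes A :: "real^'n \<Rightarrow> 'b::real_normed_vector"
  assumes "A \<in> polys_on k D"
  shows "continuous_on D A"
proof -
  obtain p where p: "p \<in> polynomials k" "A = (\<lambda>x. if x \<in> D then p x else 0)"
    using polys_on_cases[OF assms] .
  have "continuous_on D p" using continuous_on_polynomial[OF p(1)] .
  then show ?thesis using p(2) by (simp cong: continuous_on_cong)
qed

lemma fun_subspace_polys_on: "fun_subspace (polys_on k D)"
  unfolding fun_subspace_def
proof (intro conjI ballI allI)
  show "(\<lambda>_. 0) \<in> polys_on k D" using polys_onI[OF polynomials_zero, of D] by simp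
next
  fix p q :: "real^'a \<Rightarrow> 'b" and a b assume "p \<in> polys_on k D" "q \<in> polys_on k D"
  then obtain p' q' where *: "p' \<in> polynomials k" "p = (\<lambda>x. if x \<in> D then p' x else 0)"
    "q' \<in> polynomials k" "q = (\<lambda>x. if x \<in> D then q' x else 0)" by (elim polys_on_cases)
  have "(\<lambda>x. if x \<in> D then a *\<^sub>R p' x + b *\<^sub>R q' x else 0) \<in> polys_on k D"
    by (intro polys_onI polynomials_add polynomials_scaleR *)
  then show "(\<lambda>x. a *\<^sub>R p x + b *\<^sub>R q x) \<in> polys_on k D"
    unfolding * by (simp add: if_distrib cong: if_cong)
qed

lemma polys_on_finite_span:
  fixes D :: "(real^'n) set"
  obtains G :: "(real^'n \<Rightarrow> 'b::euclidean_space) set"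
  where "finite G" "polys_on k D \<subseteq> fun_space.span G"
proof -
  define \<phi> where "\<phi> = (\<lambda>(\<alpha> :: 'n \<Rightarrow> nat, b :: 'b). \<lambda>x :: real^'n. if x \<in> D then (\<Prod>i\<in>UNIV. (x $ i) ^ \<alpha> i) *\<^sub>R b else 0)"
  define I where "I = {\<alpha> :: 'n \<Rightarrow> nat. int (\<Sum>i\<in>UNIV. \<alpha> i) \<le> k}"
  define G where "G = \<phi> ` (I \<times> Basis)"
  have sum_apply: "(\<Sum>i\<in>J. F i) x = (\<Sum>i\<in>J. F i x)" for J and F :: "'i \<Rightarrow> (real^'n) \<Rightarrow> 'b" and x
    by (induction J rule: infinite_finite_induct) auto
  have "A \<in> fun_space.span G" if A: "A \<in> polys_on k D" for A
  proof -
    obtain p where p: "p \<in> polynomials k" "A = (\<lambda>x. if x \<in> D then p x else 0)"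
      using polys_on_cases[OF A] .
    then obtain c where c: "p = (\<lambda>x. \<Sum>\<alpha>\<in>I. (\<Prod>i\<in>UNIV. (x $ i) ^ \<alpha> i) *\<^sub>R c \<alpha>)"
      unfolding polynomials_def I_def by auto
    have "A = (\<Sum>\<alpha>\<in>I. \<Sum>b\<in>Basis. (\<lambda>x. (c \<alpha> \<bullet> b) *\<^sub>R \<phi> (\<alpha>, b) x))"
    proof
      fix x
      have "(\<Prod>i\<in>UNIV. (x $ i) ^ \<alpha> i) *\<^sub>R c \<alpha> = (\<Sum>b\<in>Basis. (c \<alpha> \<bullet> b) *\<^sub>R (\<Prod>i\<in>UNIV. (x $ i) ^ \<alpha> i) *\<^sub>R b)" for \<alpha>
        by (subst euclidean_representation[of "c \<alpha>", symmetric]) (simp add: scaleR_sum_right mult.commute)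
      then show "A x = (\<Sum>\<alpha>\<in>I. \<Sum>b\<in>Basis. (\<lambda>x. (c \<alpha> \<bullet> b) *\<^sub>R \<phi> (\<alpha>, b) x)) x"
        unfolding p(2) c by (simp add: \<phi>_def sum_apply)
    qed
    also have "\<dots> \<in> fun_space.span G"
      by (intro fun_space.span_sum fun_space.span_scale fun_space.span_base) (auto simp: G_def)
    finally show ?thesis .
  qed
  moreover have "finite G"
    unfolding G_def I_def using finite_multi_indices by (intro finite_imageI finite_cartesian_product) auto
  ultimately show ?thesis using that by blast
qed

lemma moment_comb:
  assumes f: "compact f" "f \<noteq> {}" 
    and c: "continuous_on f A" "continuous_on f B" "continuous_on f q"
  shows "moment f u w q (\<lambda>x. a *\<^sub>R A x + b *\<^sub>R B x) = a * moment f u w q A + b * moment f u w q B"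
proof -
  have i: "set_integrable (flat_measure f) f (\<lambda>x. (u \<bullet> (C x *v w)) * q x)" if "continuous_on f C" for C
    using that c by (intro set_integrable_flat_measure[OF f]) (auto simp: matrix_vector_mult_def intro!: continuous_intros)
  have eq: "(u \<bullet> ((a *\<^sub>R A x + b *\<^sub>R B x) *v w)) * q x
     = a * ((u \<bullet> (A x *v w)) * q x) + b * ((u \<bullet> (B x *v w)) * q x)" for x
    by (simp add: matrix_vector_mult_add_rdistrib scaleR_matrix_vector_assoc[symmetric] inner_add_right algebra_simps)
  show ?thesis
    unfolding moment_def eq
    using set_integral_add(2)[OF set_integrable_mult_right[OF i[OF c(1)], of a] set_integrable_mult_right[OF i[OF c(2)], of b]]
    by simp
qed

lemma moment_cong:
  "f = g \<Longrightarrow> (\<And>x. x \<in> f \<Longrightarrow> A x = B x) \<Longrightarrow> moment f u w q A = moment g u w q B"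
  unfolding moment_def by (auto simp: set_lebesgue_integral_def indicator_def intro!: Bochner_Integration.integral_cong)

lemma moment_sum_right:
  assumes f: "compact f" "f \<noteq> {}" and c: "continuous_on f A" "continuous_on f q" and "finite J"
  shows "moment f u (\<Sum>j\<in>J. c j *\<^sub>R w j) q A = (\<Sum>j\<in>J. c j * moment f u (w j) q A)"
proof -
  have i: "set_integrable (flat_measure f) f (\<lambda>x. c j * ((u \<bullet> (A x *v w j)) * q x))" for j
    using c by (intro set_integrable_flat_measure[OF f]) (auto simp: matrix_vector_mult_def intro!: continuous_intros)
  have eq: "(u \<bullet> (A x *v (\<Sum>j\<in>J. c j *\<^sub>R w j))) * q x = (\<Sum>j\<in>J. c j * ((u \<bullet> (A x *v w j)) * q x))" for x
    by (simp add: linear_sum[OF matrix_vector_mul_linear] matrix_vector_mult_scaleR inner_sum_right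
        sum_distrib_right mult.assoc)
  have "(LINT x:f|flat_measure f. (\<Sum>j\<in>J. c j * ((u \<bullet> (A x *v w j)) * q x)))
      = (\<Sum>j\<in>J. (LINT x:f|flat_measure f. c j * ((u \<bullet> (A x *v w j)) * q x)))"
    using i unfolding set_integrable_def set_lebesgue_integral_def scaleR_sum_right
    by (intro Bochner_Integration.integral_sum) auto
  then show ?thesis unfolding moment_def eq by simp
qed


section \<open>Tangential-normal bases and dual matrices\<close>

lemma independent_spans_subspace:
  fixes S :: "'a::euclidean_space set"
  assumes "subspace S" "e ` I \<subseteq> S" "inj_on e I" "independent (e ` I)" "card I = dim S"
  shows "span (e ` I) = S"
proof
  show "span (e ` I) \<subseteq> S" using assms(1,2) by (simp add: span_minimal)
  show "S \<subseteq> span (e ` I)"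
    using assms card_ge_dim_independent[of "e ` I" S] by (simp add: card_image)
qed

lemma tn_basis_spans:
  fixes f :: "'a::euclidean_space set"
  assumes tn: "tn_basis l f t \<nu>" and f: "f \<noteq> {}" "aff_dim f = int l"
  shows "span (t ` {1..l}) = tangent_space f"
    and "span (\<nu> ` {1..DIM('a) - l}) = {w. normal_to f w}"
proof -
  have sub: "subspace (tangent_space f)" and dim: "dim (tangent_space f) = l"
    using subspace_tangent_space[OF f(1)] f(2) by auto
  show "span (t ` {1..l}) = tangent_space f"
    using tn dim by (intro independent_spans_subspace[OF sub]) (auto simp: tn_basis_def)
  have eq: "{w. normal_to f w} = {y \<in> UNIV. \<forall>x\<in>tangent_space f. orthogonal x y}"
    by (auto simp: normal_to_def orthogonal_commute)
  have "dim {w. normal_to f w} + l = DIM('a)"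
    unfolding eq using dim_subspace_orthogonal_to_vectors[OF sub subspace_UNIV] dim by simp
  moreover have "subspace {w. normal_to f w}"
    by (auto simp: subspace_def normal_to_def orthogonal_def inner_add_left)
  ultimately show "span (\<nu> ` {1..DIM('a) - l}) = {w. normal_to f w}"
    using tn by (intro independent_spans_subspace) (auto simp: tn_basis_def)
qed

text \<open>Orthogonality to the tangents makes y a normal, hence a combination of the \<nu> j, to
  which it is also orthogonal. So a vector is determined by its products with a tn-basis, although
  tangents and normals need not be orthogonal among themselves.\<close>

lemma tn_basis_total:
  fixes f :: "'a::euclidean_space set"
  assumes tn: "tn_basis l f t \<nu>" and f: "f \<noteq> {}" "aff_dim f = int l"
    and y: "\<And>i. i \<in> {1..l} \<Longrightarrow> t i \<bullet> y = 0" "\<And>j. j \<in> {1..DIM('a) - l} \<Longrightarrow> \<nu> j \<bullet> y = 0"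
  shows "y = 0"
proof -
  have "x \<in> span (t ` {1..l}) \<Longrightarrow> orthogonal y x" for x
    by (rule orthogonal_to_span) (use y(1) in \<open>auto simp: orthogonal_def inner_commute\<close>)
  then have "normal_to f y" using tn_basis_spans(1)[OF tn f] by (auto simp: normal_to_def)
  then have "y \<in> span (\<nu> ` {1..DIM('a) - l})" using tn_basis_spans(2)[OF tn f] by auto
  then have "orthogonal y y"
    by (rule orthogonal_to_span) (use y(2) in \<open>auto simp: orthogonal_def inner_commute\<close>)
  then show ?thesis by (simp add: orthogonal_self)
qed

lemma tn_basis_normal_expand:
  fixes f :: "'a::euclidean_space set"
  assumes tn: "tn_basis l f t \<nu>" and f: "f \<noteq> {}" "aff_dim f = int l" and "normal_to f w"
  obtains c where "w = (\<Sum>j\<in>{1..DIM('a) - l}. c j *\<^sub>R \<nu> j)"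
proof -
  have "w \<in> span (\<nu> ` {1..DIM('a) - l})" using tn_basis_spans(2)[OF tn f] assms(4) by auto
  then obtain u where "w = (\<Sum>v\<in>\<nu> ` {1..DIM('a) - l}. u v *\<^sub>R v)"
    unfolding span_finite[OF finite_imageI[OF finite_atLeastAtMost]] by auto
  moreover have "inj_on \<nu> {1..DIM('a) - l}" using tn by (simp add: tn_basis_def)
  ultimately show ?thesis using that[of "u \<circ> \<nu>"] by (simp add: sum.reindex)
qed

text \<open>The vector representing a coordinate functional is projected to S, which does not change
  its values on the family. Duals that stay in S matter later: dual tangents remain orthogonal to
  all normals, and dual normals to all tangents.\<close>

lemma dual_family:
  fixes e :: "'i \<Rightarrow> 'a::euclidean_space"
  assumes S: "subspace S" "e ` I \<subseteq> S" and e: "inj_on e I" "independent (e ` I)"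
  obtains d where "\<And>i. i \<in> I \<Longrightarrow> d i \<in> S" "\<And>i j. i \<in> I \<Longrightarrow> j \<in> I \<Longrightarrow> d i \<bullet> e j = (if i = j then 1 else 0)"
proof -
  have "\<exists>d. d \<in> S \<and> (\<forall>j\<in>I. d \<bullet> e j = (if i = j then 1 else 0))" if i: "i \<in> I" for i
  proof -
    obtain h :: "'a \<Rightarrow> real" where h: "linear h" "\<And>x. x \<in> e ` I \<Longrightarrow> h x = (if x = e i then 1 else 0)"
      using linear_independent_extend[OF e(2), of "\<lambda>x. if x = e i then 1 else 0"] by blast
    have hx: "h x = adjoint h 1 \<bullet> x" for x
      using adjoint_works[OF h(1), of x 1] by (simp add: inner_commute)
    obtain y z where yz: "y \<in> span S" "\<And>w. w \<in> span S \<Longrightarrow> orthogonal z w" "adjoint h 1 = y + z"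
      using orthogonal_subspace_decomp_exists[of S "adjoint h 1"] by blast
    have "y \<bullet> e j = (if i = j then 1 else 0)" if "j \<in> I" for j
    proof -
      have "e j \<in> span S" using S that by (auto intro: span_base)
      then have "y \<bullet> e j = h (e j)"
        using yz(2)[of "e j"] by (simp add: hx yz(3) inner_add_left orthogonal_def)
      then show ?thesis using h(2)[of "e j"] e(1) i that by (auto simp: inj_on_def)
    qed
    then show ?thesis using yz(1) S(1) by (metis span_eq_iff)
  qed
  then show ?thesis using that by metis
qed

lemma independent_by_dual:
  fixes e d :: "'i \<Rightarrow> 'a::real_inner"
  assumes "\<And>i. i \<in> I \<Longrightarrow> d i \<bullet> e i \<noteq> 0" "\<And>i j. i \<in> I \<Longrightarrow> j \<in> I \<Longrightarrow> i \<noteq> j \<Longrightarrow> d i \<bullet> e j = 0"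
  shows "inj_on e I" "independent (e ` I)"
proof -
  show inj: "inj_on e I" by (rule inj_onI) (metis assms)
  show "independent (e ` I)"
  proof
    assume "dependent (e ` I)"
    then obtain i where i: "i \<in> I" "e i \<in> span (e ` I - {e i})" by (auto simp: dependent_def)
    have "orthogonal (d i) (e i)"
      by (rule orthogonal_to_span[OF i(2)]) (use assms(2) i(1) in \<open>auto simp: orthogonal_def\<close>)
    then show False using assms(1)[OF i(1)] by (simp add: orthogonal_def)
  qed
qed

section \<open>Rank-one and symmetric matrices\<close>

definition outer :: "real^'n \<Rightarrow> real^'n \<Rightarrow> real^'n^'n" where
  "outer a b = (\<chi> i j. a $ i * b $ j)"

lemma outer_mult_vec: "outer a b *v w = (b \<bullet> w) *\<^sub>R a"
  by (simp add: outer_def matrix_vector_mult_def vec_eq_iff inner_vec_def sum_distrib_left mult_ac)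

lemma transpose_outer: "transpose (outer a b) = outer b a"
  by (simp add: outer_def transpose_def vec_eq_iff mult.commute)

lemma transpose_add: "transpose (A + B) = transpose A + transpose (B :: 'a::plus^'n^'m)"
  by (simp add: transpose_def vec_eq_iff)

lemma transpose_sum: "transpose (\<Sum>i\<in>I. A i) = (\<Sum>i\<in>I. transpose (A i :: 'a::comm_monoid_add^'n^'m))"
  by (simp add: transpose_def vec_eq_iff)

lemma matrix_sum_mult_vec: "(\<Sum>i\<in>I. A i) *v w = (\<Sum>i\<in>I. A i *v (w :: real^'n))"
  by (induction I rule: infinite_finite_induct) (auto simp: matrix_vector_mult_add_rdistrib)

lemma symmetric_swap:
  fixes M :: "real^'n^'n"
  assumes "transpose M = M"
  shows "u \<bullet> (M *v w) = w \<bullet> (M *v u)"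
  using dot_lmul_matrix[of u M w] transpose_matrix_vector[of M u] assms by (simp add: inner_commute)

context full_simplex
begin

lemma compact_face: "W \<subseteq> V \<Longrightarrow> compact (convex hull W)"
  using finite_subset_vertices by (auto intro: finite_imp_compact_convex_hull)

text \<open>The bubble function is positive in the relative interior, so it is the weight of a
  positive definite pairing of polynomials, and functionals are represented by this pairing. The
  representing p is the factor that gives bubble times p the prescribed moments.\<close>

lemma weighted_representer:
  assumes W: "W \<subseteq> V" "W \<noteq> {}" and L: "functional_on (polys_on k (convex hull W)) L"
  shows "\<exists>p. p \<in> polynomials k \<and> (\<forall>q\<in>polys_on k (convex hull W).
       (LINT x:convex hull W|flat_measure (convex hull W). bubble V W x * p x * q x) = L q)"
proof -
  let ?f = "convex hull W"
  define ip where "ip = (\<lambda>p q. LINT x:?f|flat_measure ?f. bubble V W x * p x * q x)"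
  obtain G :: "(real^'n \<Rightarrow> real) set" where G: "finite G" "polys_on k ?f \<subseteq> fun_space.span G"
    by (rule polys_on_finite_span)
  have int: "set_integrable (flat_measure ?f) ?f (\<lambda>x. bubble V W x * p x * q x)"
    if "p \<in> polys_on k ?f" "q \<in> polys_on k ?f" for p q
    using continuous_on_polys_on[OF that(1)] continuous_on_polys_on[OF that(2)] W
    by (intro set_integrable_flat_measure compact_face continuous_intros) auto
  have lin: "functional_on (polys_on k ?f) (ip p)" if p: "p \<in> polys_on k ?f" for p
    unfolding functional_on_def
  proof (intro ballI allI)
    fix q s :: "real^'n \<Rightarrow> real" and a b :: real assume qs: "q \<in> polys_on k ?f" "s \<in> polys_on k ?f"
    have "ip p (\<lambda>x. a *\<^sub>R q x + b *\<^sub>R s x)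
      = (LINT x:?f|flat_measure ?f. a * (bubble V W x * p x * q x) + b * (bubble V W x * p x * s x))"
      by (simp add: ip_def algebra_simps)
    also have "\<dots> = a * ip p q + b * ip p s"
      using set_integral_add(2)[OF set_integrable_mult_right[OF int[OF p qs(1)], of a] set_integrable_mult_right[OF int[OF p qs(2)], of b]]
      by (simp add: ip_def)
    finally show "ip p (\<lambda>x. a *\<^sub>R q x + b *\<^sub>R s x) = a * ip p q + b * ip p s" .
  qed
  have pos: "p = (\<lambda>_. 0)" if p: "p \<in> polys_on k ?f" and 0: "ip p p = 0" for p
  proof -
    have "bubble V W x * p x * p x = 0" if x: "x \<in> ?f" for x
    proof (rule flat_integral_zero_imp[OF W _ _ _ x])
      show "continuous_on ?f (\<lambda>x. bubble V W x * p x * p x)"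
        using continuous_on_polys_on[OF p] by (intro continuous_intros)
      show "0 \<le> bubble V W x * p x * p x" if "x \<in> ?f" for x
        using bubble_nonneg[OF W(1), of x] that hull_mono[OF W(1), of convex] by (auto simp: mult.assoc)
    qed (use 0 in \<open>simp add: ip_def\<close>)
    then have "p x = 0" if x: "x \<in> ?f" for x
    proof (intro zero_on_face_by_density[OF W(1) continuous_on_polys_on[OF p] _ x])
      fix x assume x: "x \<in> ?f" "\<And>v. v \<in> W \<Longrightarrow> 0 < bary V v x"
      then have "bubble V W x > 0" unfolding bubble_def by (intro prod_pos)
      then show "p x = 0" using \<open>\<And>x. x \<in> ?f \<Longrightarrow> bubble V W x * p x * p x = 0\<close>[OF x(1)] by auto
    qed
    moreover have "p x = 0" if "x \<notin> ?f" for x using p that by (auto simp: polys_on_def)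
    ultimately show ?thesis by blast
  qed
  have sym: "ip p q = ip q p" for p q
    by (simp add: ip_def mult_ac)
  obtain p where p: "p \<in> polys_on k ?f" "\<And>q. q \<in> polys_on k ?f \<Longrightarrow> ip p q = L q"
    by (rule fun_riesz[OF fun_subspace_polys_on G lin sym pos L]) blast+
  obtain p' where p': "p' \<in> polynomials k" "p = (\<lambda>x. if x \<in> ?f then p' x else 0)"
    using polys_on_cases[OF p(1)] .
  have "(LINT x:?f|flat_measure ?f. bubble V W x * p' x * q x) = ip p q" for q
    unfolding ip_def p'(2) by (auto simp: set_lebesgue_integral_def indicator_def intro!: Bochner_Integration.integral_cong)
  then show ?thesis using p'(1) p(2) by (intro exI[of _ p']) simp
qed

text \<open>\<open>C\<close> is the bubble function of the face times a combination of symmetric matrices dual to the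
  functionals \<open>M \<mapsto> \<nu>\<^sub>i \<bullet> M \<nu>\<^sub>j\<close> and \<open>M \<mapsto> t\<^sub>i \<bullet> M w\<close>.  The set \<open>N\<close> covers both choices of normals in the
  tangential-normal moments: the \<open>\<nu>\<^sub>j\<close> of the face itself, or the normals of the facets containing it.\<close>

lemma face_correction:
  fixes N :: "(real^'n) set"
  assumes W: "W \<subseteq> V" "card W = l + 1" and tn: "tn_basis l (convex hull W) t \<nu>"
    and N: "independent N" "\<And>w. w \<in> N \<Longrightarrow> normal_to (convex hull W) w"
    and \<beta>: "\<And>i j. i \<in> {1..CARD('n) - l} \<Longrightarrow> j \<in> {i..CARD('n) - l} \<Longrightarrow>
      functional_on (polys_on (k - (int l + 1)) (convex hull W)) (\<beta> i j)"
    and \<gamma>: "\<And>i w. i \<in> {1..l} \<Longrightarrow> w \<in> N \<Longrightarrow>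
      functional_on (polys_on (k - (int l + 1)) (convex hull W)) (\<gamma> i w)"
  obtains C where "C \<in> polynomials k" "\<And>x. transpose (C x) = C x"
    "\<And>x v. v \<in> W \<Longrightarrow> bary V v x = 0 \<Longrightarrow> C x = 0"
    "\<And>i j q. i \<in> {1..CARD('n) - l} \<Longrightarrow> j \<in> {i..CARD('n) - l} \<Longrightarrow> q \<in> polys_on (k - (int l + 1)) (convex hull W) \<Longrightarrow>
       moment (convex hull W) (\<nu> i) (\<nu> j) q C = \<beta> i j q"
    "\<And>i w q. i \<in> {1..l} \<Longrightarrow> w \<in> N \<Longrightarrow> q \<in> polys_on (k - (int l + 1)) (convex hull W) \<Longrightarrow>
       moment (convex hull W) (t i) w q C = \<gamma> i w q"
proof -
  let ?f = "convex hull W" and ?k = "k - (int l + 1)" and ?m = "CARD('n) - l"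
  have Wne: "W \<noteq> {}" using W by auto
  have fne: "?f \<noteq> {}" using Wne by simp
  have finN: "finite N" using N(1) independent_imp_finite by auto
  have tnd: "\<And>i. i \<in> {1..l} \<Longrightarrow> t i \<in> tangent_space ?f" "inj_on t {1..l}" "independent (t ` {1..l})"
    "\<And>i. i \<in> {1..?m} \<Longrightarrow> normal_to ?f (\<nu> i)" "inj_on \<nu> {1..?m}" "independent (\<nu> ` {1..?m})"
    using tn by (auto simp: tn_basis_def)
  have subn: "subspace {w. normal_to ?f w}"
    by (auto simp: subspace_def normal_to_def orthogonal_def inner_add_left)
  obtain ts where ts: "\<And>i. i \<in> {1..l} \<Longrightarrow> ts i \<in> tangent_space ?f"
    "\<And>i j. i \<in> {1..l} \<Longrightarrow> j \<in> {1..l} \<Longrightarrow> ts i \<bullet> t j = (if i = j then 1 else 0)"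
    using dual_family[OF subspace_tangent_space(1)[OF fne] _ tnd(2,3)] tnd(1) by blast
  have sub: "t ` {1..l} \<subseteq> tangent_space ?f" "\<nu> ` {1..?m} \<subseteq> {w. normal_to ?f w}"
    using tnd(1,4) by blast+
  obtain \<nu>s where \<nu>s: "\<And>i. i \<in> {1..?m} \<Longrightarrow> normal_to ?f (\<nu>s i)"
    "\<And>i j. i \<in> {1..?m} \<Longrightarrow> j \<in> {1..?m} \<Longrightarrow> \<nu>s i \<bullet> \<nu> j = (if i = j then 1 else 0)"
    using dual_family[OF subn sub(2) tnd(5,6)] unfolding mem_Collect_eq by blast
  obtain ws where ws: "\<And>w. w \<in> N \<Longrightarrow> normal_to ?f (ws w)"
    "\<And>w w'. w \<in> N \<Longrightarrow> w' \<in> N \<Longrightarrow> ws w \<bullet> w' = (if w = w' then 1 else 0)"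
    using dual_family[OF subn, of "\<lambda>w. w" N] N by auto
  have perp: "x \<bullet> w = 0" "w \<bullet> x = 0" if "x \<in> tangent_space ?f" "normal_to ?f w" for x w
    using that by (auto simp: normal_to_def orthogonal_def inner_commute)
  \<comment> \<open>Only pairs i \<le> j are indexed: the normal-normal part of a symmetric matrix
    has one free entry for each of them.\<close>
  define PB where "PB = Sigma {1..?m} (\<lambda>i. {i..?m})"
  define PC where "PC = {1..l} \<times> N"
  \<comment> \<open>For i = j the symmetrised sum would yield 2 instead of 1, hence the separate
    diagonal case.\<close>
  define MB where "MB = (\<lambda>(i, j). if i = j then outer (\<nu>s i) (\<nu>s i) else outer (\<nu>s i) (\<nu>s j) + outer (\<nu>s j) (\<nu>s i))"
  define MC where "MC = (\<lambda>(i, w). outer (ts i) (ws w) + outer (ws w) (ts i))"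
  have "\<forall>z\<in>PB. \<exists>p. p \<in> polynomials ?k \<and> (\<forall>q\<in>polys_on ?k ?f.
      (LINT x:?f|flat_measure ?f. bubble V W x * p x * q x) = \<beta> (fst z) (snd z) q)"
  proof
    fix z assume "z \<in> PB"
    then have "functional_on (polys_on ?k ?f) (\<beta> (fst z) (snd z))"
      by (cases z) (auto simp: PB_def intro: \<beta>)
    then show "\<exists>p. p \<in> polynomials ?k \<and> (\<forall>q\<in>polys_on ?k ?f.
      (LINT x:?f|flat_measure ?f. bubble V W x * p x * q x) = \<beta> (fst z) (snd z) q)"
      by (rule weighted_representer[OF W(1) Wne])
  qed
  from bchoice[OF this] obtain pB where "\<forall>z\<in>PB. pB z \<in> polynomials ?k \<and> (\<forall>q\<in>polys_on ?k ?f.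
      (LINT x:?f|flat_measure ?f. bubble V W x * pB z x * q x) = \<beta> (fst z) (snd z) q)" by blast
  then have pB: "\<And>z. z \<in> PB \<Longrightarrow> pB z \<in> polynomials ?k"
    "\<And>z q. z \<in> PB \<Longrightarrow> q \<in> polys_on ?k ?f \<Longrightarrow>
      (LINT x:?f|flat_measure ?f. bubble V W x * pB z x * q x) = \<beta> (fst z) (snd z) q"
    by blast+
  have "\<forall>z\<in>PC. \<exists>p. p \<in> polynomials ?k \<and> (\<forall>q\<in>polys_on ?k ?f.
      (LINT x:?f|flat_measure ?f. bubble V W x * p x * q x) = \<gamma> (fst z) (snd z) q)"
  proof
    fix z assume "z \<in> PC"
    then have "functional_on (polys_on ?k ?f) (\<gamma> (fst z) (snd z))"
      by (cases z) (auto simp: PC_def intro: \<gamma>)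
    then show "\<exists>p. p \<in> polynomials ?k \<and> (\<forall>q\<in>polys_on ?k ?f.
      (LINT x:?f|flat_measure ?f. bubble V W x * p x * q x) = \<gamma> (fst z) (snd z) q)"
      by (rule weighted_representer[OF W(1) Wne])
  qed
  from bchoice[OF this] obtain pC where "\<forall>z\<in>PC. pC z \<in> polynomials ?k \<and> (\<forall>q\<in>polys_on ?k ?f.
      (LINT x:?f|flat_measure ?f. bubble V W x * pC z x * q x) = \<gamma> (fst z) (snd z) q)" by blast
  then have pC: "\<And>z. z \<in> PC \<Longrightarrow> pC z \<in> polynomials ?k"
    "\<And>z q. z \<in> PC \<Longrightarrow> q \<in> polys_on ?k ?f \<Longrightarrow>
      (LINT x:?f|flat_measure ?f. bubble V W x * pC z x * q x) = \<gamma> (fst z) (snd z) q"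
    by blast+
  have finP: "finite PB" "finite PC" using finN by (auto simp: PB_def PC_def)
  define C where "C x = (\<Sum>z\<in>PB. bubble V W x *\<^sub>R (pB z x *\<^sub>R MB z)) + (\<Sum>z\<in>PC. bubble V W x *\<^sub>R (pC z x *\<^sub>R MC z))" for x
  have summand: "(\<lambda>x. bubble V W x *\<^sub>R (p x *\<^sub>R M)) \<in> polynomials k" if "p \<in> polynomials ?k" for p and M :: "real^'n^'n"
  proof -
    have "(\<lambda>x. p x *\<^sub>R M) \<in> polynomials ?k"
      using that by (rule polynomials_linear_image[rotated]) (auto intro!: linearI simp: scaleR_add_left)
    from polynomials_mult[OF bubble_polynomial[OF finite_subset_vertices[OF W(1)]] this] W(2)
    show ?thesis by simp
  qed
  have Cpoly: "C \<in> polynomials k"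
    unfolding C_def[abs_def] by (intro polynomials_add polynomials_sum summand pB(1) pC(1))
  have Csym: "transpose (C x) = C x" for x
  proof -
    have "transpose (MB z) = MB z" "transpose (MC z') = MC z'" for z z'
      by (auto simp: MB_def MC_def transpose_outer transpose_add add.commute split: prod.splits)
    then show ?thesis by (simp add: C_def transpose_add transpose_sum transpose_scalar)
  qed
  have Cvan: "C x = 0" if "v \<in> W" "bary V v x = 0" for x v
  proof -
    have "bubble V W x = 0" using that finite_subset_vertices[OF W(1)] by (auto simp: bubble_def)
    then show ?thesis by (simp add: C_def)
  qed
  have uCw: "u \<bullet> (C x *v w) = (\<Sum>z\<in>PB. bubble V W x * (pB z x * (u \<bullet> (MB z *v w)))) + (\<Sum>z\<in>PC. bubble V W x * (pC z x * (u \<bullet> (MC z *v w))))" for u w x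
    by (simp add: C_def matrix_vector_mult_add_rdistrib matrix_sum_mult_vec scaleR_matrix_vector_assoc[symmetric] inner_add_right inner_sum_right mult.assoc)
  have MB_nn: "\<nu> i \<bullet> (MB z *v \<nu> j) = (if z = (i, j) then 1 else 0)"
    if A: "i \<in> {1..?m}" "j \<in> {i..?m}" "z \<in> PB" for i j z
  proof -
    obtain a b where z: "z = (a, b)" "a \<in> {1..?m}" "b \<in> {a..?m}" using A(3) by (auto simp: PB_def)
    define \<delta> :: "nat \<Rightarrow> nat \<Rightarrow> real" where "\<delta> a b = (if a = b then 1 else 0)" for a b
    have "\<nu>s x \<bullet> \<nu> y = \<delta> x y" "\<nu> y \<bullet> \<nu>s x = \<delta> x y" if "x \<in> {1..?m}" "y \<in> {1..?m}" for x y
      using \<nu>s(2)[OF that] by (simp_all add: inner_commute \<delta>_def)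
    then have "\<nu> i \<bullet> (MB z *v \<nu> j) = (if a = b then \<delta> a i * \<delta> a j else \<delta> a i * \<delta> b j + \<delta> b i * \<delta> a j)"
      using A(1,2) z by (auto simp: MB_def matrix_vector_mult_add_rdistrib outer_mult_vec inner_add_right)
    then show ?thesis using A z by (auto simp: \<delta>_def)
  qed
  \<comment> \<open>Dual tangents are orthogonal to normals and dual normals to tangents, so the two
    kinds of matrices do not interfere.\<close>
  have MC_nn: "\<nu> i \<bullet> (MC z *v \<nu> j) = 0" if "i \<in> {1..?m}" "j \<in> {i..?m}" "z \<in> PC" for i j z
    using that perp[OF ts(1) tnd(4)] by (auto simp: MC_def PC_def matrix_vector_mult_add_rdistrib outer_mult_vec inner_add_right)
  have MB_tn: "t i \<bullet> (MB z *v w) = 0" if "i \<in> {1..l}" "w \<in> N" "z \<in> PB" for i w z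
    using that perp[OF tnd(1) \<nu>s(1)] by (auto simp: MB_def PB_def matrix_vector_mult_add_rdistrib outer_mult_vec inner_add_right)
  have MC_tn: "t i \<bullet> (MC z *v w) = (if z = (i, w) then 1 else 0)"
    if A: "i \<in> {1..l}" "w \<in> N" "z \<in> PC" for i w z
  proof -
    obtain x y where z: "z = (x, y)" "x \<in> {1..l}" "y \<in> N" using A(3) by (auto simp: PC_def)
    have "t i \<bullet> (MC z *v w) = (ws y \<bullet> w) * (ts x \<bullet> t i) + (ts x \<bullet> w) * (t i \<bullet> ws y)"
      by (simp add: z(1) MC_def matrix_vector_mult_add_rdistrib outer_mult_vec inner_add_right inner_commute)
    also have "\<dots> = (if y = w then 1 else 0) * (if x = i then 1 else 0)"
      using ws(2)[OF z(3) A(2)] ts(2)[OF z(2) A(1)] perp[OF tnd(1)[OF A(1)] ws(1)[OF z(3)]] by simp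
    finally show ?thesis using z(1) by auto
  qed
  have nn: "\<nu> i \<bullet> (C x *v \<nu> j) = bubble V W x * pB (i, j) x" if ij: "i \<in> {1..?m}" "j \<in> {i..?m}" for i j x
  proof -
    have "\<nu> i \<bullet> (C x *v \<nu> j) = (\<Sum>z\<in>PB. if z = (i, j) then bubble V W x * pB z x else 0)"
      unfolding uCw using ij by (simp add: MB_nn MC_nn if_distrib cong: if_cong)
    then show ?thesis using ij finP by (simp add: PB_def)
  qed
  have tn': "t i \<bullet> (C x *v w) = bubble V W x * pC (i, w) x" if iw: "i \<in> {1..l}" "w \<in> N" for i w x
  proof -
    have "t i \<bullet> (C x *v w) = (\<Sum>z\<in>PC. if z = (i, w) then bubble V W x * pC z x else 0)"
      unfolding uCw using iw by (simp add: MB_tn MC_tn if_distrib cong: if_cong)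
    then show ?thesis using iw finP by (simp add: PC_def)
  qed
  show ?thesis
  proof (rule that[OF Cpoly Csym Cvan])
    fix i j and q :: "real^'n \<Rightarrow> real" assume ij: "i \<in> {1..?m}" "j \<in> {i..?m}" and q: "q \<in> polys_on ?k ?f"
    have "(i, j) \<in> PB" using ij by (simp add: PB_def)
    from pB(2)[OF this q] show "moment ?f (\<nu> i) (\<nu> j) q C = \<beta> i j q"
      by (simp add: moment_def nn[OF ij])
  next
    fix i w and q :: "real^'n \<Rightarrow> real" assume iw: "i \<in> {1..l}" "w \<in> N" and q: "q \<in> polys_on ?k ?f"
    have "(i, w) \<in> PC" using iw by (simp add: PC_def)
    from pC(2)[OF this q] show "moment ?f (t i) w q C = \<gamma> i w q"
      by (simp add: moment_def tn'[OF iw])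
  qed
qed

end


section \<open>Vanishing degrees of freedom on a facet\<close>

lemma polynomial_component:
  fixes B :: "real^'n \<Rightarrow> real^'n^'n"
  assumes "B \<in> polynomials k"
  shows "(\<lambda>x. u \<bullet> (B x *v w)) \<in> polynomials k"
  using assms
  by (rule polynomials_linear_image[rotated, where f = "\<lambda>M. u \<bullet> (M *v w)"])
     (auto intro!: linearI simp: matrix_vector_mult_add_rdistrib inner_add_right scaleR_matrix_vector_assoc[symmetric])

context full_simplex
begin

text \<open>On a face \<open>f\<close> whose boundary values are already known to vanish, every component of \<open>B w\<close> is
  the bubble function of \<open>f\<close> times some \<open>h\<close>; testing with \<open>h\<close> itself kills it.\<close>

lemma moments_determine_on_face:
  fixes B :: "real^'n \<Rightarrow> real^'n^'n"
  assumes W: "W \<subseteq> V" "card W \<ge> 2" and B: "B \<in> polynomials k"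
    and zero: "\<And>v x. v \<in> W \<Longrightarrow> x \<in> convex hull (W - {v}) \<Longrightarrow> B x *v w = 0"
    and mom: "\<And>q. q \<in> polys_on (k - int (card W)) (convex hull W) \<Longrightarrow> moment (convex hull W) u w q B = 0"
    and x: "x \<in> convex hull W"
  shows "u \<bullet> (B x *v w) = 0"
proof -
  let ?f = "convex hull W"
  have Wne: "W \<noteq> {}" using W(2) by auto
  obtain h where h: "h \<in> polynomials (k - int (card W))"
    "\<And>x. x \<in> ?f \<Longrightarrow> u \<bullet> (B x *v w) = bubble V W x * h x"
  proof (rule bubble_divides[OF W polynomial_component[OF B, of u w]])
    show "u \<bullet> (B x *v w) = 0" if "v \<in> W" "x \<in> convex hull (W - {v})" for v x
      using zero[OF that] by simp
  qed blast+
  have cont: "continuous_on ?f h" using continuous_on_polynomial[OF h(1)] .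
  have "moment ?f u w (\<lambda>x. if x \<in> ?f then h x else 0) B
      = (LINT x:?f|flat_measure ?f. bubble V W x * (h x)\<^sup>2)"
    unfolding moment_def using h(2)
    by (auto simp: set_lebesgue_integral_def indicator_def power2_eq_square intro!: Bochner_Integration.integral_cong)
  then have "(LINT x:?f|flat_measure ?f. bubble V W x * (h x)\<^sup>2) = 0"
    using mom[OF polys_onI[OF h(1)]] by simp
  moreover have "0 \<le> bubble V W y * (h y)\<^sup>2" if "y \<in> ?f" for y
    using bubble_nonneg[OF W(1), of y] subsetD[OF hull_mono[OF W(1), of convex] that] by simp
  moreover have "continuous_on ?f (\<lambda>x. bubble V W x * (h x)\<^sup>2)"
    by (intro continuous_intros cont)
  ultimately have "bubble V W x * (h x)\<^sup>2 = 0"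
    using flat_integral_zero_imp[OF W(1) Wne _ _ _ x] by blast
  then show ?thesis using h(2)[OF x] by simp
qed

text \<open>Induction over the faces of U: vertices are given, and on a larger face the boundary
  values vanish by induction, so that the moments apply. The directions u are only required to form
  a total family S, which may depend on the face.\<close>

lemma normal_component_vanishes:
  fixes B :: "real^'n \<Rightarrow> real^'n^'n"
  assumes U: "U \<subseteq> V" and B: "B \<in> polynomials k"
    and vert: "\<And>v. v \<in> U \<Longrightarrow> B v = 0"
    and mom: "\<And>W. W \<subseteq> U \<Longrightarrow> card W \<ge> 2 \<Longrightarrow> \<exists>S. (\<forall>y. (\<forall>u\<in>S. u \<bullet> y = 0) \<longrightarrow> y = 0) \<and>
       (\<forall>u\<in>S. \<forall>q\<in>polys_on (k - int (card W)) (convex hull W). moment (convex hull W) u w q B = 0)"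
    and x: "x \<in> convex hull U"
  shows "B x *v w = 0"
proof -
  have "\<forall>x\<in>convex hull W. B x *v w = 0" if "W \<subseteq> U" for W
    using finite_subset[OF that finite_subset_vertices[OF U]] that
  proof (induction W rule: finite_psubset_induct)
    case (psubset W)
    consider "W = {}" | v where "W = {v}" | "card W \<ge> 2"
    proof -
      have "card W = 0 \<or> card W = 1 \<or> card W \<ge> 2" by linarith
      then show ?thesis using that psubset.hyps(1) by (auto simp: card_1_singleton_iff)
    qed
    then show ?case
    proof cases
      case 3
      have WV: "W \<subseteq> V" using psubset.prems U by auto
      obtain S where S: "\<And>y. (\<And>u. u \<in> S \<Longrightarrow> u \<bullet> y = 0) \<Longrightarrow> y = 0"
        "\<And>u q. u \<in> S \<Longrightarrow> q \<in> polys_on (k - int (card W)) (convex hull W) \<Longrightarrow> moment (convex hull W) u w q B = 0"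
        using mom[OF psubset.prems 3] by metis
      have zero: "B x *v w = 0" if "v \<in> W" "x \<in> convex hull (W - {v})" for v x
      proof -
        have "W - {v} \<subset> W" "W - {v} \<subseteq> U" using that(1) psubset.prems by auto
        then show ?thesis using psubset.IH that(2) by blast
      qed
      show ?thesis
      proof
        fix x assume x: "x \<in> convex hull W"
        show "B x *v w = 0"
          by (rule S(1), rule moments_determine_on_face[OF WV 3 B zero S(2) x])
      qed
    qed (use psubset.prems vert in auto)
  qed
  from this[OF order_refl] x show ?thesis by blast
qed

lemma face_nonempty_aff_dim:
  assumes "W \<subseteq> V" "card W = l + 1"
  shows "convex hull W \<noteq> {}" "aff_dim (convex hull W) = int l"
  using assms aff_dim_hull[OF assms(1)] by auto

text \<open>The normal w of the facet is normal to each of its faces, hence a combination of the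
  \<nu> j there. Normal-normal moments and, for l \<le> m, tangential-normal moments against w
  follow by this expansion; for l > m the latter are given directly. Together they test B w in all
  directions of a tn-basis.\<close>

lemma facet_dofs_zero_imp:
  fixes B :: "real^'n \<Rightarrow> real^'n^'n"
  assumes U: "U \<subseteq> V" "card U = CARD('n)" and w: "normal_to (convex hull U) w"
    and B: "B \<in> polynomials k" and sym: "\<And>x. x \<in> convex hull U \<Longrightarrow> transpose (B x) = B x"
    and tn: "\<And>W l. W \<subseteq> U \<Longrightarrow> card W = l + 1 \<Longrightarrow> tn_basis l (convex hull W) (t (convex hull W)) (\<nu> (convex hull W))"
    and vert: "\<And>v. v \<in> U \<Longrightarrow> B v = 0"
    and nn: "\<And>W l i j q. W \<subseteq> U \<Longrightarrow> card W = l + 1 \<Longrightarrow> l \<in> {1..CARD('n) - 1} \<Longrightarrow> i \<in> {1..CARD('n) - l} \<Longrightarrow>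
       j \<in> {i..CARD('n) - l} \<Longrightarrow> q \<in> polys_on (k - (int l + 1)) (convex hull W) \<Longrightarrow>
       moment (convex hull W) (\<nu> (convex hull W) i) (\<nu> (convex hull W) j) q B = 0"
    and tn_low: "\<And>W l i j q. W \<subseteq> U \<Longrightarrow> card W = l + 1 \<Longrightarrow> l \<in> {1..m} \<Longrightarrow> i \<in> {1..l} \<Longrightarrow>
       j \<in> {1..CARD('n) - l} \<Longrightarrow> q \<in> polys_on (k - (int l + 1)) (convex hull W) \<Longrightarrow>
       moment (convex hull W) (t (convex hull W) i) (\<nu> (convex hull W) j) q B = 0"
    and tn_high: "\<And>W l i q. W \<subseteq> U \<Longrightarrow> card W = l + 1 \<Longrightarrow> l \<in> {m+1..CARD('n) - 1} \<Longrightarrow> i \<in> {1..l} \<Longrightarrow>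
       q \<in> polys_on (k - (int l + 1)) (convex hull W) \<Longrightarrow>
       moment (convex hull W) (t (convex hull W) i) w q B = 0"
    and x: "x \<in> convex hull U"
  shows "B x *v w = 0"
proof (rule normal_component_vanishes[OF U(1) B vert _ x])
  fix W assume W: "W \<subseteq> U" "2 \<le> card W"
  let ?f = "convex hull W"
  define l where "l = card W - 1"
  have WV: "W \<subseteq> V" using W U by auto
  have l: "card W = l + 1" using W by (simp add: l_def)
  have lr: "l \<in> {1..CARD('n) - 1}"
    using W card_mono[OF finite_subset_vertices[OF U(1)] W(1)] U(2) by (auto simp: l_def)
  note tnf = tn[OF W(1) l] and fd = face_nonempty_aff_dim[OF WV l]
  have sub: "?f \<subseteq> convex hull U" using hull_mono[OF W(1)] .
  have comp: "compact ?f" using compact_face[OF WV] .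
  have wf: "normal_to ?f w"
    using w hull_mono[OF W(1), of affine]
    unfolding normal_to_def tangent_space_convex_hull by blast
  then obtain c where c: "w = (\<Sum>j\<in>{1..CARD('n) - l}. c j *\<^sub>R \<nu> ?f j)"
    using tn_basis_normal_expand[OF tnf fd wf] by auto
  have expand: "moment ?f u w q B = (\<Sum>j\<in>{1..CARD('n) - l}. c j * moment ?f u (\<nu> ?f j) q B)"
    if "q \<in> polys_on (k - (int l + 1)) ?f" for u q
    unfolding c by (intro moment_sum_right comp fd(1) continuous_on_polynomial[OF B] continuous_on_polys_on[OF that]) simp
  have nu: "moment ?f (\<nu> ?f i) w q B = 0" 
    if i: "i \<in> {1..CARD('n) - l}" and q: "q \<in> polys_on (k - (int l + 1)) ?f" for i q
    unfolding expand[OF q]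
  proof (intro sum.neutral ballI)
    fix j assume j: "j \<in> {1..CARD('n) - l}"
    have "moment ?f (\<nu> ?f i) (\<nu> ?f j) q B = 0"
    proof (cases "i \<le> j")
      case True
      then show ?thesis using nn[OF W(1) l lr i _ q] j by auto
    next
      \<comment> \<open>Only pairs i \<le> j are among the degrees of freedom; the others are
        obtained from the symmetry of B on the face.\<close>
      case False
      have "moment ?f (\<nu> ?f i) (\<nu> ?f j) q B = moment ?f (\<nu> ?f j) (\<nu> ?f i) q B"
        unfolding moment_def using symmetric_swap[OF sym] sub
        by (auto simp: set_lebesgue_integral_def indicator_def subset_iff intro!: Bochner_Integration.integral_cong)
      then show ?thesis using nn[OF W(1) l lr j _ q] i False by auto
    qed
    then show "c j * moment ?f (\<nu> ?f i) (\<nu> ?f j) q B = 0" by simp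
  qed
  have tt: "moment ?f (t ?f i) w q B = 0"
    if i: "i \<in> {1..l}" and q: "q \<in> polys_on (k - (int l + 1)) ?f" for i q
  proof (cases "l \<le> m")
    case True
    then have "l \<in> {1..m}" using lr by auto
    then show ?thesis unfolding expand[OF q] using tn_low[OF W(1) l _ i _ q] by simp
  next
    case False
    then show ?thesis using tn_high[OF W(1) l _ i q] lr by auto
  qed
  let ?S = "t ?f ` {1..l} \<union> \<nu> ?f ` {1..CARD('n) - l}"
  have deg: "k - int (card W) = k - (int l + 1)" using l by simp
  have "\<forall>y. (\<forall>u\<in>?S. u \<bullet> y = 0) \<longrightarrow> y = 0"
    using tn_basis_total[OF tnf fd] by auto
  moreover have "\<forall>u\<in>?S. \<forall>q\<in>polys_on (k - int (card W)) ?f. moment ?f u w q B = 0"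
    unfolding deg using nu tt by blast
  ultimately show "\<exists>S. (\<forall>y. (\<forall>u\<in>S. u \<bullet> y = 0) \<longrightarrow> y = 0) \<and>
       (\<forall>u\<in>S. \<forall>q\<in>polys_on (k - int (card W)) ?f. moment ?f u w q B = 0)" by blast
qed

end


section \<open>Unisolvence\<close>

lemma moment_functional:
  fixes A :: "real^'n \<Rightarrow> real^'n^'n"
  assumes f: "compact f" "f \<noteq> {}" and A: "continuous_on f A"
  shows "functional_on (polys_on k f) (\<lambda>q. moment f u w q A)"
  unfolding functional_on_def
proof (intro ballI allI)
  fix q s :: "real^'n \<Rightarrow> real" and a b :: real assume qs: "q \<in> polys_on k f" "s \<in> polys_on k f"
  have i: "set_integrable (flat_measure f) f (\<lambda>x. (u \<bullet> (A x *v w)) * p x)" if "p \<in> polys_on k f" for p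
    using A continuous_on_polys_on[OF that]
    by (intro set_integrable_flat_measure[OF f]) (auto simp: matrix_vector_mult_def intro!: continuous_intros)
  have "moment f u w (\<lambda>x. a *\<^sub>R q x + b *\<^sub>R s x) A
    = (LINT x:f|flat_measure f. a * ((u \<bullet> (A x *v w)) * q x) + b * ((u \<bullet> (A x *v w)) * s x))"
    by (simp add: moment_def algebra_simps)
  also have "\<dots> = a * moment f u w q A + b * moment f u w s A"
    using set_integral_add(2)[OF set_integrable_mult_right[OF i[OF qs(1)], of a] set_integrable_mult_right[OF i[OF qs(2)], of b]]
    by (simp add: moment_def)
  finally show "moment f u w (\<lambda>x. a *\<^sub>R q x + b *\<^sub>R s x) A = a * moment f u w q A + b * moment f u w s A" .
qed

lemma functional_on_diff:
  assumes "functional_on P L" "functional_on P M"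
  shows "functional_on P (\<lambda>q. L q - M q)"
  using assms by (auto simp: functional_on_def algebra_simps)

context full_simplex
begin

text \<open>Induction on the dimension L of the faces treated. The correction for an l-dimensional
  face W vanishes wherever a barycentric coordinate of one of its vertices does, hence on every
  other face with at most l + 1 vertices, since such a face misses a vertex of W. Corrections of
  equal dimension thus do not affect each other and leave the earlier data intact. The data \<gamma>
  are indexed by the normal vectors themselves, so that \<open>N W\<close> may be any independent
  set of normals.\<close>

lemma boundary_dofs_exist:
  fixes \<beta> :: "(real^'n) set \<Rightarrow> nat \<Rightarrow> nat \<Rightarrow> (real^'n \<Rightarrow> real) \<Rightarrow> real"
    and \<gamma> :: "(real^'n) set \<Rightarrow> nat \<Rightarrow> real^'n \<Rightarrow> (real^'n \<Rightarrow> real) \<Rightarrow> real"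
  assumes k: "k \<ge> 1"
    and tn: "\<And>W l. W \<subseteq> V \<Longrightarrow> card W = l + 1 \<Longrightarrow> tn_basis l (convex hull W) (t W) (\<nu> W)"
    and N: "\<And>W l. W \<subseteq> V \<Longrightarrow> card W = l + 1 \<Longrightarrow> l \<in> {1..CARD('n) - 1} \<Longrightarrow> independent (N W)"
      "\<And>W l w. W \<subseteq> V \<Longrightarrow> card W = l + 1 \<Longrightarrow> l \<in> {1..CARD('n) - 1} \<Longrightarrow> w \<in> N W \<Longrightarrow> normal_to (convex hull W) w"
    and a: "\<And>v. v \<in> V \<Longrightarrow> transpose (a v) = a v"
    and \<beta>: "\<And>W l i j. W \<subseteq> V \<Longrightarrow> card W = l + 1 \<Longrightarrow> l \<in> {1..CARD('n) - 1} \<Longrightarrow> i \<in> {1..CARD('n) - l} \<Longrightarrow>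
       j \<in> {i..CARD('n) - l} \<Longrightarrow> functional_on (polys_on (k - (int l + 1)) (convex hull W)) (\<beta> W i j)"
    and \<gamma>: "\<And>W l i w. W \<subseteq> V \<Longrightarrow> card W = l + 1 \<Longrightarrow> l \<in> {1..CARD('n) - 1} \<Longrightarrow> i \<in> {1..l} \<Longrightarrow>
       w \<in> N W \<Longrightarrow> functional_on (polys_on (k - (int l + 1)) (convex hull W)) (\<gamma> W i w)"
    and L: "L \<le> CARD('n) - 1"
  shows "\<exists>A\<in>polynomials k. (\<forall>x. transpose (A x) = A x) \<and> (\<forall>v\<in>V. A v = a v) \<and>
    (\<forall>W l. W \<subseteq> V \<longrightarrow> card W = l + 1 \<longrightarrow> l \<in> {1..L} \<longrightarrow>
      (\<forall>i\<in>{1..CARD('n) - l}. \<forall>j\<in>{i..CARD('n) - l}. \<forall>q\<in>polys_on (k - (int l + 1)) (convex hull W).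
         moment (convex hull W) (\<nu> W i) (\<nu> W j) q A = \<beta> W i j q) \<and>
      (\<forall>i\<in>{1..l}. \<forall>w\<in>N W. \<forall>q\<in>polys_on (k - (int l + 1)) (convex hull W).
         moment (convex hull W) (t W i) w q A = \<gamma> W i w q))"
  using L
proof (induction L)
  case 0
  \<comment> \<open>The affine interpolant of the vertex values; its degree 1 is admissible because
    k is at least 1.\<close>
  define A where "A x = (\<Sum>v\<in>V. bary V v x *\<^sub>R a v)" for x
  have "(\<lambda>x. bary V v x *\<^sub>R a v) \<in> polynomials 1" for v
    using polynomials_mult[OF bary_polynomial polynomials_const[of 0 "a v"]] by simp
  then have "A \<in> polynomials k"
    unfolding A_def[abs_def] by (intro polynomials_mono[OF k] polynomials_sum)
  moreover have "transpose (A x) = A x" for x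
    using a by (simp add: A_def transpose_sum transpose_scalar)
  moreover have "A v = a v" if "v \<in> V" for v
  proof -
    have "A v = (\<Sum>w\<in>V. if w = v then a w else 0)"
      unfolding A_def using that by (intro sum.cong) (auto simp: bary_vertex)
    then show ?thesis using that by simp
  qed
  ultimately show ?case by (intro bexI[of _ A]) auto
next
  case (Suc L)
  obtain A0 where A0': "A0 \<in> polynomials k" "\<forall>x. transpose (A0 x) = A0 x" "\<forall>v\<in>V. A0 v = a v"
    "\<forall>W l. W \<subseteq> V \<longrightarrow> card W = l + 1 \<longrightarrow> l \<in> {1..L} \<longrightarrow>
      (\<forall>i\<in>{1..CARD('n) - l}. \<forall>j\<in>{i..CARD('n) - l}. \<forall>q\<in>polys_on (k - (int l + 1)) (convex hull W).
         moment (convex hull W) (\<nu> W i) (\<nu> W j) q A0 = \<beta> W i j q) \<and>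
      (\<forall>i\<in>{1..l}. \<forall>w\<in>N W. \<forall>q\<in>polys_on (k - (int l + 1)) (convex hull W).
         moment (convex hull W) (t W i) w q A0 = \<gamma> W i w q)"
    using Suc.IH[OF Suc_leD[OF Suc.prems]] by (elim bexE conjE)
  have A0: "A0 \<in> polynomials k" "\<And>x. transpose (A0 x) = A0 x" "\<And>v. v \<in> V \<Longrightarrow> A0 v = a v"
    using A0' by blast+
  have low: "\<And>W l i j q. W \<subseteq> V \<Longrightarrow> card W = l + 1 \<Longrightarrow> l \<in> {1..L} \<Longrightarrow> i \<in> {1..CARD('n) - l} \<Longrightarrow> j \<in> {i..CARD('n) - l} \<Longrightarrow>
         q \<in> polys_on (k - (int l + 1)) (convex hull W) \<Longrightarrow>
         moment (convex hull W) (\<nu> W i) (\<nu> W j) q A0 = \<beta> W i j q"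
      "\<And>W l i w q. W \<subseteq> V \<Longrightarrow> card W = l + 1 \<Longrightarrow> l \<in> {1..L} \<Longrightarrow> i \<in> {1..l} \<Longrightarrow> w \<in> N W \<Longrightarrow>
         q \<in> polys_on (k - (int l + 1)) (convex hull W) \<Longrightarrow>
         moment (convex hull W) (t W i) w q A0 = \<gamma> W i w q"
    using A0'(4) by blast+
  define l where "l = Suc L"
  have l: "l \<in> {1..CARD('n) - 1}" using Suc.prems by (simp add: l_def)
  define \<W> where "\<W> = {W. W \<subseteq> V \<and> card W = l + 1}"
  have fin\<W>: "finite \<W>" by (rule finite_subset[of _ "Pow V"]) (auto simp: \<W>_def)
  have comp: "compact (convex hull W)" if "W \<subseteq> V" for W using compact_face[OF that] .
  have "\<forall>W\<in>\<W>. \<exists>C. C \<in> polynomials k \<and> (\<forall>x. transpose (C x) = C x) \<and>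
    (\<forall>x. \<forall>v\<in>W. bary V v x = 0 \<longrightarrow> C x = 0) \<and>
    (\<forall>i\<in>{1..CARD('n) - l}. \<forall>j\<in>{i..CARD('n) - l}. \<forall>q\<in>polys_on (k - (int l + 1)) (convex hull W).
       moment (convex hull W) (\<nu> W i) (\<nu> W j) q C = \<beta> W i j q - moment (convex hull W) (\<nu> W i) (\<nu> W j) q A0) \<and>
    (\<forall>i\<in>{1..l}. \<forall>w\<in>N W. \<forall>q\<in>polys_on (k - (int l + 1)) (convex hull W).
       moment (convex hull W) (t W i) w q C = \<gamma> W i w q - moment (convex hull W) (t W i) w q A0)"
    (is "\<forall>W\<in>\<W>. \<exists>C. ?good W C")
  proof
    fix W assume "W \<in> \<W>"
    then have W: "W \<subseteq> V" "card W = l + 1" by (auto simp: \<W>_def)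
    have ne: "convex hull W \<noteq> {}" using W by auto
    note mf = moment_functional[OF comp[OF W(1)] ne continuous_on_polynomial[OF A0(1)]]
    show "\<exists>C. ?good W C"
    proof (rule face_correction[OF W tn[OF W] N(1)[OF W l], where k = k
          and \<beta> = "\<lambda>i j q. \<beta> W i j q - moment (convex hull W) (\<nu> W i) (\<nu> W j) q A0"
          and \<gamma> = "\<lambda>i w q. \<gamma> W i w q - moment (convex hull W) (t W i) w q A0"], goal_cases)
      case (1 w)
      then show ?case by (rule N(2)[OF W l])
    next
      case (2 i j)
      then show ?case by (intro functional_on_diff[OF \<beta>[OF W l] mf])
    next
      case (3 i w)
      then show ?case by (intro functional_on_diff[OF \<gamma>[OF W l] mf])
    next
      case (4 C)
      show ?case by (rule exI[of _ C], intro conjI allI ballI impI) (fact 4 | rule 4; assumption)+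
    qed
  qed
  from bchoice[OF this] obtain C where C: "\<forall>W\<in>\<W>. ?good W (C W)" by blast
  have Cvan: "C W x = 0" if "W \<in> \<W>" "v \<in> W" "bary V v x = 0" for W v x using C that by blast
  define A where "A x = 1 *\<^sub>R A0 x + 1 *\<^sub>R (\<Sum>W\<in>\<W>. C W x)" for x
  have Apoly: "A \<in> polynomials k"
    unfolding A_def[abs_def] using C by (intro polynomials_add polynomials_scaleR polynomials_sum A0) blast
  have Asym: "transpose (A x) = A x" for x
  proof -
    have "transpose (C W x) = C W x" if "W \<in> \<W>" for W using C that by blast
    then show ?thesis by (simp add: A_def transpose_add transpose_sum A0(2))
  qed
  have other: "C W x = 0" if W: "W \<in> \<W>" and W': "W' \<subseteq> V" "card W' \<le> l + 1" "W' \<noteq> W" and x: "x \<in> convex hull W'" for W W' x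
  proof -
    have "\<not> W \<subseteq> W'"
      using W W' card_subset_eq[of W' W] card_mono[of W' W] finite_subset_vertices[OF W'(1)] by (auto simp: \<W>_def)
    then obtain v where v: "v \<in> W" "v \<notin> W'" by auto
    then have "v \<in> V - W'" using W by (auto simp: \<W>_def)
    then have "bary V v x = 0" using x convex_hull_iff[OF W'(1)] by blast
    then show ?thesis using Cvan[OF W v(1)] by blast
  qed
  have Avert: "A v = a v" if v: "v \<in> V" for v
  proof -
    have "C W v = 0" if "W \<in> \<W>" for W
      by (rule other[OF that, of "{v}"]) (use v that l in \<open>auto simp: \<W>_def\<close>)
    then show ?thesis by (simp add: A_def A0(3)[OF v])
  qed
  have A_low: "A x = A0 x" if "W' \<subseteq> V" "card W' < l + 1" "x \<in> convex hull W'" for W' x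
  proof -
    have "C W x = 0" if "W \<in> \<W>" for W
      by (rule other[OF that \<open>W' \<subseteq> V\<close> _ _ \<open>x \<in> convex hull W'\<close>])
        (use \<open>card W' < l + 1\<close> that in \<open>auto simp: \<W>_def\<close>)
    then show ?thesis by (simp add: A_def)
  qed
  have A_eq: "A x = 1 *\<^sub>R A0 x + 1 *\<^sub>R C W x" if "W \<in> \<W>" "x \<in> convex hull W" for W x
  proof -
    have "C W' x = 0" if "W' \<in> \<W> - {W}" for W'
      by (rule other[of W' W]) (use that \<open>W \<in> \<W>\<close> \<open>x \<in> convex hull W\<close> in \<open>auto simp: \<W>_def\<close>)
    then have "(\<Sum>W'\<in>\<W>. C W' x) = C W x"
      using that(1) fin\<W> by (simp add: sum.remove)
    then show ?thesis by (simp add: A_def)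
  qed
  have mom_eq: "moment (convex hull W) u w q A = moment (convex hull W) u w q A0 + moment (convex hull W) u w q (C W)"
    if W: "W \<in> \<W>" and q: "q \<in> polys_on k' (convex hull W)" for W u w q k'
  proof -
    have W': "W \<subseteq> V" "convex hull W \<noteq> {}" using W by (auto simp: \<W>_def)
    have Cp: "C W \<in> polynomials k" using C W by blast
    have "moment (convex hull W) u w q A = moment (convex hull W) u w q (\<lambda>x. 1 *\<^sub>R A0 x + 1 *\<^sub>R C W x)"
      by (rule moment_cong[OF refl A_eq[OF W]])
    also have "\<dots> = 1 * moment (convex hull W) u w q A0 + 1 * moment (convex hull W) u w q (C W)"
      by (rule moment_comb[OF comp[OF W'(1)] W'(2) continuous_on_polynomial[OF A0(1)]
          continuous_on_polynomial[OF Cp] continuous_on_polys_on[OF q]])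
    finally show ?thesis by simp
  qed
  have low_eq: "moment (convex hull W) u w q A = moment (convex hull W) u w q A0"
    if "W \<subseteq> V" "card W < l + 1" for W u w q
    by (rule moment_cong[OF refl A_low[OF that]])
  have nn: "moment (convex hull W) (\<nu> W i) (\<nu> W j) q A = \<beta> W i j q"
    if W: "W \<subseteq> V" "card W = l' + 1" "l' \<in> {1..l}" and "i \<in> {1..CARD('n) - l'}" "j \<in> {i..CARD('n) - l'}"
      "q \<in> polys_on (k - (int l' + 1)) (convex hull W)" for W l' i j q
  proof (cases "l' = l")
    case True
    then have W': "W \<in> \<W>" using W by (auto simp: \<W>_def)
    then have "moment (convex hull W) (\<nu> W i) (\<nu> W j) q (C W) = \<beta> W i j q - moment (convex hull W) (\<nu> W i) (\<nu> W j) q A0"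
      using C that True by blast
    then show ?thesis using mom_eq[OF W' that(6)] by simp
  next
    case False
    then have "l' \<in> {1..L}" "card W < l + 1" using W by (auto simp: l_def)
    then show ?thesis using low_eq[OF W(1)] low(1) that by simp
  qed
  have tw: "moment (convex hull W) (t W i) w q A = \<gamma> W i w q"
    if W: "W \<subseteq> V" "card W = l' + 1" "l' \<in> {1..l}" and "i \<in> {1..l'}" "w \<in> N W"
      "q \<in> polys_on (k - (int l' + 1)) (convex hull W)" for W l' i w q
  proof (cases "l' = l")
    case True
    then have W': "W \<in> \<W>" using W by (auto simp: \<W>_def)
    then have "moment (convex hull W) (t W i) w q (C W) = \<gamma> W i w q - moment (convex hull W) (t W i) w q A0"
      using C that True by blast
    then show ?thesis using mom_eq[OF W' that(6)] by simp
  next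
    case False
    then have "l' \<in> {1..L}" "card W < l + 1" using W by (auto simp: l_def)
    then show ?thesis using low_eq[OF W(1)] low(2) that by simp
  qed
  show ?case
    using Apoly Asym Avert nn tw unfolding l_def[symmetric] by (intro bexI[of _ A] conjI allI ballI impI) auto
qed

end

section \<open>Interior moments and bubble fields\<close>

lemma integrable_lebesgue_on_compact:
  fixes g :: "'a::euclidean_space \<Rightarrow> 'b::euclidean_space"
  assumes "compact S" "continuous_on S g"
  shows "integrable (lebesgue_on S) g"
proof -
  have S: "S \<in> sets borel" using assms(1) by (simp add: compact_imp_closed)
  have "integrable lborel (\<lambda>x. indicator S x *\<^sub>R g x)"
    by (rule borel_integrable_compact[OF assms])
  then have "integrable lebesgue (\<lambda>x. indicator S x *\<^sub>R g x)"
    using borel_measurable_integrable by (subst integrable_completion) auto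
  then show ?thesis using S by (simp add: integrable_restrict_space)
qed

lemma interior_moment_comb:
  assumes T: "compact T" and c: "continuous_on T A" "continuous_on T B" "continuous_on T q"
  shows "interior_moment T q (\<lambda>x. a *\<^sub>R A x + b *\<^sub>R B x) = a * interior_moment T q A + b * interior_moment T q B"
proof -
  have i: "integrable (lebesgue_on T) (\<lambda>x. C x \<bullet> q x)" if "continuous_on T C" for C
    using that c by (intro integrable_lebesgue_on_compact[OF T] continuous_intros)
  show ?thesis
    using i[OF c(1)] i[OF c(2)] by (simp add: interior_moment_def inner_add_left)
qed

lemma interior_moment_commute: "interior_moment T p q = interior_moment T q p"
  by (simp add: interior_moment_def inner_commute)

lemma sym_polys_on_cases:
  assumes "A \<in> sym_polys_on k T"
  obtains B where "B \<in> polynomials k" "A = (\<lambda>x. if x \<in> T then B x else 0)"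
    "\<And>x. x \<in> T \<Longrightarrow> transpose (B x) = B x"
proof -
  obtain B where B: "B \<in> polynomials k" "A = (\<lambda>x. if x \<in> T then B x else 0)"
    using assms polys_on_cases[of A k T] by (auto simp: sym_polys_on_def)
  then show ?thesis using that assms by (auto simp: sym_polys_on_def sym_matrices_def)
qed

lemma fun_subspace_sym_polys_on: "fun_subspace (sym_polys_on k T)"
proof -
  have "transpose (0 :: real^'n^'n) = 0" by (simp add: transpose_def vec_eq_iff)
  then show ?thesis
    using fun_subspace_polys_on[of k T]
    by (auto simp: fun_subspace_def sym_polys_on_def sym_matrices_def transpose_add transpose_scalar)
qed

lemma fun_subspace_div_bubbles: "fun_subspace (div_bubbles k T)"
  using fun_subspace_sym_polys_on[of k T]
  by (auto simp: fun_subspace_def div_bubbles_def matrix_vector_mult_add_rdistrib scaleR_matrix_vector_assoc[symmetric])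

context full_simplex
begin

text \<open>The moment is the integral of |A|^2, so A vanishes almost everywhere on T. In the open
  simplex the set where A is nonzero is open and negligible, hence empty, and density covers the
  boundary.\<close>

lemma interior_moment_self_zero:
  assumes A: "A \<in> polys_on k (convex hull V)" and zero: "interior_moment (convex hull V) A A = 0"
  shows "A = (\<lambda>_. 0)"
proof -
  let ?T = "convex hull V"
  have comp: "compact ?T" using compact_face[of V] by simp
  have cont: "continuous_on ?T A" using continuous_on_polys_on[OF A] .
  have "integrable (lebesgue_on ?T) (\<lambda>x. A x \<bullet> A x)"
    by (intro integrable_lebesgue_on_compact comp continuous_intros cont)
  then have "AE x in lebesgue_on ?T. A x \<bullet> A x = 0"
    using zero integral_nonneg_eq_0_iff_AE[of "lebesgue_on ?T" "\<lambda>x. A x \<bullet> A x"] by (simp add: interior_moment_def)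
  moreover have T: "?T \<in> sets lebesgue" using comp lmeasurable_compact by blast
  ultimately have "AE x in lebesgue. x \<in> ?T \<longrightarrow> A x = 0"
    by (simp add: AE_restrict_space_iff)
  then obtain N where N: "negligible N" "{x. \<not> (x \<in> ?T \<longrightarrow> A x = 0)} \<subseteq> N"
    by (auto simp: eventually_ae_filter negligible_iff_null_sets)
  have "A x = 0" if x: "x \<in> ?T" for x
  proof (rule zero_on_face_by_density[OF order_refl cont _ x])
    fix y assume y: "y \<in> ?T" "\<And>v. v \<in> V \<Longrightarrow> 0 < bary V v y"
    show "A y = 0"
    proof (rule ccontr)
      assume "A y \<noteq> 0"
      define O' where "O' = (\<Inter>v\<in>V. {z. 0 < bary V v z})"
      have O': "open O'" unfolding O'_def
        by (intro open_INT finite_vertices ballI open_Collect_less continuous_intros)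
      have "O' \<subseteq> ?T" using simplex_iff by (auto simp: O'_def intro: less_imp_le)
      then have "continuous_on O' A" using cont continuous_on_subset by blast
      then have "open (O' \<inter> A -` (- {0}))"
        using O' by (intro continuous_open_preimage) auto
      moreover have "O' \<inter> A -` (- {0}) \<subseteq> N" using N(2) \<open>O' \<subseteq> ?T\<close> by auto
      then have "negligible (O' \<inter> A -` (- {0}))" using N(1) negligible_subset by blast
      moreover have "y \<in> O' \<inter> A -` (- {0})" using y(2) \<open>A y \<noteq> 0\<close> by (auto simp: O'_def)
      ultimately show False using open_not_negligible by blast
    qed
  qed
  moreover have "A x = 0" if "x \<notin> ?T" for x using A that by (auto simp: polys_on_def)
  ultimately show ?thesis by blast
qed

lemma div_bubbles_representer:
  assumes "functional_on (div_bubbles k (convex hull V)) e"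
  obtains p where "p \<in> div_bubbles k (convex hull V)"
    "\<And>q. q \<in> div_bubbles k (convex hull V) \<Longrightarrow> interior_moment (convex hull V) q p = e q"
proof -
  let ?T = "convex hull V"
  let ?B = "div_bubbles k ?T"
  have comp: "compact ?T" using compact_face[of V] by simp
  obtain G :: "(real^'n \<Rightarrow> real^'n^'n) set" where G: "finite G" "polys_on k ?T \<subseteq> fun_space.span G"
    by (rule polys_on_finite_span)
  have sub: "?B \<subseteq> polys_on k ?T" by (auto simp: div_bubbles_def sym_polys_on_def)
  then have G': "?B \<subseteq> fun_space.span G" using G(2) by blast
  have cont: "continuous_on ?T p" if "p \<in> ?B" for p
    using continuous_on_polys_on subsetD[OF sub that] by blast
  have lin: "functional_on ?B (interior_moment ?T p)" if p: "p \<in> ?B" for p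
    unfolding functional_on_def using interior_moment_comb[OF comp cont cont cont[OF p]] by blast
  have pos: "p = (\<lambda>_. 0)" if "p \<in> ?B" "interior_moment ?T p p = 0" for p
    using interior_moment_self_zero[OF subsetD[OF sub that(1)] that(2)] .
  obtain p where p: "p \<in> ?B" "\<And>q. q \<in> ?B \<Longrightarrow> interior_moment ?T p q = e q"
    by (rule fun_riesz[OF fun_subspace_div_bubbles G(1) G' lin interior_moment_commute pos assms]) blast+
  then show ?thesis using that interior_moment_commute by metis
qed

text \<open>Bubbles are defined by normals of facets, but the degrees of freedom use normals of
  faces of every dimension. Those are combinations of gradients of vertices v outside W, and each
  such gradient is a normal of the facet opposite v, which contains the face.\<close>

lemma div_bubble_normal:
  assumes A: "A \<in> div_bubbles k (convex hull V)" and W: "W \<subseteq> V" "W \<noteq> {}"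
    and x: "x \<in> convex hull W" and w: "normal_to (convex hull W) w"
  shows "A x *v w = 0"
proof -
  obtain a where a: "a \<in> W" using W by auto
  have *: "A x *v bary_grad V v = 0" if v: "v \<in> V - W" for v
  proof -
    let ?F = "convex hull (V - {v})" and ?g = "bary_grad V v"
    have vV: "v \<in> V" using v by auto
    have n: "normal_to ?F ?g"
      by (rule normal_to_bary_grad) (use facet_nonempty vV in auto)
    have g0: "norm ?g \<noteq> 0" using bary_grad_nonzero[OF vV] by simp
    then have "unit_normal ?F ((1 / norm ?g) *\<^sub>R ?g)"
      using n by (auto simp: unit_normal_def normal_to_def orthogonal_def)
    moreover have "?F \<in> subsimplices (CARD('n) - 1) (convex hull V)" using facet_iff vV by blast
    moreover have "x \<in> ?F"
    proof -
      have "W \<subseteq> V - {v}" using W v by auto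
      from subsetD[OF hull_mono[OF this, of convex] x] show ?thesis .
    qed
    ultimately have "A x *v ((1 / norm ?g) *\<^sub>R ?g) = 0" using A by (auto simp: div_bubbles_def)
    then show ?thesis using g0 by (simp add: matrix_vector_mult_scaleR)
  qed
  have "A x *v w = (\<Sum>v\<in>V - W. (w \<bullet> (v - a)) *\<^sub>R (A x *v bary_grad V v))"
    by (subst normal_expand[OF W(1) a w])
       (simp add: linear_sum[OF matrix_vector_mul_linear] matrix_vector_mult_scaleR)
  then show ?thesis using * by simp
qed

lemma div_bubble_vertex:
  assumes A: "A \<in> div_bubbles k (convex hull V)" and v: "v \<in> V"
  shows "A v = 0"
proof -
  have "A v *v w = 0 *v w" for w
  proof -
    have "normal_to (convex hull {v}) w" by (subst normal_to_iff[of "{v}" v]) (use v in auto)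
    then show ?thesis using div_bubble_normal[OF A, of "{v}" v w] v by simp
  qed
  then show ?thesis using matrix_eq[of "A v" 0] by blast
qed

lemma div_bubble_moment:
  assumes A: "A \<in> div_bubbles k (convex hull V)" and W: "W \<subseteq> V" "W \<noteq> {}"
    and w: "normal_to (convex hull W) w"
  shows "moment (convex hull W) u w q A = 0"
proof -
  have "indicat_real (convex hull W) x *\<^sub>R ((u \<bullet> (A x *v w)) * q x) = 0" for x
    using div_bubble_normal[OF A W _ w, of x] by (cases "x \<in> convex hull W") auto
  then show ?thesis unfolding moment_def set_lebesgue_integral_def by (simp only: Bochner_Integration.integral_zero)
qed

text \<open>Each normal is a nonzero multiple of a gradient, and the edges v - a with a in W form a
  dual family up to scaling. This independence permits prescribing the moments (d) on a face
  separately for every facet through it.\<close>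

lemma facet_normals_independent:
  assumes W: "W \<subseteq> V" "W \<noteq> {}"
    and nF: "\<And>v. v \<in> V \<Longrightarrow> unit_normal (convex hull (V - {v})) (nF v)"
  shows "inj_on nF (V - W)" "independent (nF ` (V - W))"
    and "\<And>v. v \<in> V - W \<Longrightarrow> normal_to (convex hull W) (nF v)"
proof -
  obtain a where a: "a \<in> W" using W by auto
  have "\<exists>s. nF v = s *\<^sub>R bary_grad V v \<and> s \<noteq> 0" if v: "v \<in> V" for v
    using facet_normal[OF v nF[OF v]] by metis
  then obtain s where s: "\<And>v. v \<in> V \<Longrightarrow> nF v = s v *\<^sub>R bary_grad V v" "\<And>v. v \<in> V \<Longrightarrow> s v \<noteq> 0"
    by metis
  have d: "(v - a) \<bullet> nF u = (if v = u then s u else 0)" if "v \<in> V - W" "u \<in> V - W" for u v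
    using that a W s bary_grad_vertex[of u v a] by (auto simp: inner_commute)
  show "inj_on nF (V - W)" "independent (nF ` (V - W))"
    by (rule independent_by_dual[where d = "\<lambda>v. v - a"]; use d s(2) in auto)+
  show "normal_to (convex hull W) (nF v)" if v: "v \<in> V - W" for v
    using normal_to_bary_grad[OF W v] s(1)[of v] v by (auto simp: normal_to_def orthogonal_def)
qed

lemma unisolvent_simplex:
  assumes n: "CARD('n) \<ge> 2" and m: "m \<le> CARD('n) - 2" and r: "r \<ge> 1"
    and tn: "\<And>l f. f \<in> subsimplices l (convex hull V) \<Longrightarrow> tn_basis l f (t f) (\<nu> f)"
    and nF: "\<And>F. F \<in> subsimplices (CARD('n) - 1) (convex hull V) \<Longrightarrow> unit_normal F (\<nu>F F)"
  shows "unisolvent r m t \<nu> \<nu>F (convex hull V)"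
  unfolding unisolvent_def
proof (intro allI impI, elim conjE, rule ex_ex1I)
  let ?T = "convex hull V" and ?k = "int r"
  have comp: "compact ?T" using compact_face[of V] by simp
  have faceI: "convex hull W \<in> subsimplices l ?T" if "W \<subseteq> V" "card W = l + 1" for W l
    using that subsimplices_iff by blast
  have facetI: "convex hull (V - {v}) \<in> subsimplices (CARD('n) - 1) ?T" if "v \<in> V" for v
    using that facet_iff by blast
  have tn': "tn_basis l (convex hull W) (t (convex hull W)) (\<nu> (convex hull W))"
    if "W \<subseteq> V" "card W = l + 1" for W l using tn faceI that by blast
  have vertexI: "{v} \<in> subsimplices 0 ?T" if "v \<in> V" for v
    using faceI[of "{v}" 0] that by simp
  fix a :: "real^'n \<Rightarrow> real^'n^'n" and b c :: "(real^'n) set \<Rightarrow> nat \<Rightarrow> nat \<Rightarrow> (real^'n \<Rightarrow> real) \<Rightarrow> real"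
    and d :: "(real^'n) set \<Rightarrow> (real^'n) set \<Rightarrow> nat \<Rightarrow> (real^'n \<Rightarrow> real) \<Rightarrow> real"
    and e :: "(real^'n \<Rightarrow> real^'n^'n) \<Rightarrow> real"
  assume a: "\<forall>v. {v} \<in> subsimplices 0 ?T \<longrightarrow> a v \<in> sym_matrices"
    and b: "\<forall>l\<in>{1..CARD('n) - 1}. \<forall>f\<in>subsimplices l ?T.
           \<forall>i\<in>{1..CARD('n) - l}. \<forall>j\<in>{i..CARD('n) - l}.
             functional_on (polys_on (int r - (int l + 1)) f) (b f i j)"
    and c: "\<forall>l\<in>{1..m}. \<forall>f\<in>subsimplices l ?T.
           \<forall>i\<in>{1..l}. \<forall>j\<in>{1..CARD('n) - l}.
             functional_on (polys_on (int r - (int l + 1)) f) (c f i j)"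
    and d: "\<forall>F\<in>subsimplices (CARD('n) - 1) ?T.
           \<forall>l\<in>{m+1..CARD('n) - 1}. \<forall>f\<in>subsimplices l F. \<forall>i\<in>{1..l}.
             functional_on (polys_on (int r - (int l + 1)) f) (d F f i)"
    and e: "functional_on (div_bubbles (int r) ?T) e"
  let ?sol = "\<lambda>A. A \<in> sym_polys_on (int r) ?T \<and>
           (\<forall>v. {v} \<in> subsimplices 0 ?T \<longrightarrow> A v = a v) \<and>
           (\<forall>l\<in>{1..CARD('n) - 1}. \<forall>f\<in>subsimplices l ?T.
              \<forall>i\<in>{1..CARD('n) - l}. \<forall>j\<in>{i..CARD('n) - l}.
                \<forall>q\<in>polys_on (int r - (int l + 1)) f.
                  moment f (\<nu> f i) (\<nu> f j) q A = b f i j q) \<and>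
           (\<forall>l\<in>{1..m}. \<forall>f\<in>subsimplices l ?T.
              \<forall>i\<in>{1..l}. \<forall>j\<in>{1..CARD('n) - l}.
                \<forall>q\<in>polys_on (int r - (int l + 1)) f.
                  moment f (t f i) (\<nu> f j) q A = c f i j q) \<and>
           (\<forall>F\<in>subsimplices (CARD('n) - 1) ?T.
              \<forall>l\<in>{m+1..CARD('n) - 1}. \<forall>f\<in>subsimplices l F. \<forall>i\<in>{1..l}.
                \<forall>q\<in>polys_on (int r - (int l + 1)) f.
                  moment f (t f i) (\<nu>F F) q A = d F f i q) \<and>
           (\<forall>q\<in>div_bubbles (int r) ?T. interior_moment ?T q A = e q)"
  show "\<exists>A. ?sol A"
  proof -
    define nf where "nf v = \<nu>F (convex hull (V - {v}))" for v
    have nf: "unit_normal (convex hull (V - {v})) (nf v)" if "v \<in> V" for v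
      unfolding nf_def using nF facetI that by blast
    \<comment> \<open>A face with at most m + 1 vertices has dimension at most m and is governed by
      (c). Beyond that the normals of the facets through W take over, one for every vertex outside
      W.\<close>
    define N where "N W = (if card W \<le> m + 1 then \<nu> (convex hull W) ` {1..CARD('n) - (card W - 1)} else nf ` (V - W))" for W
    \<comment> \<open>Data are given by an index j or by a facet, but the construction is indexed by
      normal vectors; injectivity of both families of normals makes the translation by
      \<open>inv_into\<close> consistent.\<close>
    define \<gamma> where "\<gamma> W i w = (if card W \<le> m + 1
       then c (convex hull W) i (inv_into {1..CARD('n) - (card W - 1)} (\<nu> (convex hull W)) w)
       else d (convex hull (V - {inv_into (V - W) nf w})) (convex hull W) i)" for W i w
    have nfi: "inj_on nf (V - W)" "independent (nf ` (V - W))"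
      "\<And>v. v \<in> V - W \<Longrightarrow> normal_to (convex hull W) (nf v)" if "W \<subseteq> V" "W \<noteq> {}" for W
      using facet_normals_independent[OF that, of nf] nf by blast+
    have "\<exists>A\<in>polynomials ?k. (\<forall>x. transpose (A x) = A x) \<and> (\<forall>v\<in>V. A v = a v) \<and>
      (\<forall>W l. W \<subseteq> V \<longrightarrow> card W = l + 1 \<longrightarrow> l \<in> {1..CARD('n) - 1} \<longrightarrow>
      (\<forall>i\<in>{1..CARD('n) - l}. \<forall>j\<in>{i..CARD('n) - l}. \<forall>q\<in>polys_on (?k - (int l + 1)) (convex hull W).
         moment (convex hull W) (\<nu> (convex hull W) i) (\<nu> (convex hull W) j) q A = b (convex hull W) i j q) \<and>
      (\<forall>i\<in>{1..l}. \<forall>w\<in>N W. \<forall>q\<in>polys_on (?k - (int l + 1)) (convex hull W).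
         moment (convex hull W) (t (convex hull W) i) w q A = \<gamma> W i w q))"
    proof (rule boundary_dofs_exist[where t = "\<lambda>W. t (convex hull W)" and \<nu> = "\<lambda>W. \<nu> (convex hull W)" and \<beta> = "\<lambda>W. b (convex hull W)"])
      show "1 \<le> ?k" using r by simp
      show "tn_basis l (convex hull W) (t (convex hull W)) (\<nu> (convex hull W))"
        if "W \<subseteq> V" "card W = l + 1" for W l using tn'[OF that] .
      show "independent (N W)" if W: "W \<subseteq> V" "card W = l + 1" "l \<in> {1..CARD('n) - 1}" for W l
      proof (cases "card W \<le> m + 1")
        case True
        then show ?thesis using tn'[OF W(1,2)] W(2) by (simp add: N_def tn_basis_def)
      next
        case False
        moreover have "W \<noteq> {}" using W(2) by auto
        ultimately show ?thesis using nfi(2)[OF W(1)] by (simp add: N_def)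
      qed
      show "normal_to (convex hull W) w" if W: "W \<subseteq> V" "card W = l + 1" "l \<in> {1..CARD('n) - 1}" and w: "w \<in> N W" for W l w
      proof (cases "card W \<le> m + 1")
        case True
        then show ?thesis using tn'[OF W(1,2)] W(2) w by (auto simp: N_def tn_basis_def)
      next
        case False
        then obtain v where v: "v \<in> V - W" "w = nf v" using w by (auto simp: N_def)
        have "W \<noteq> {}" using W(2) by auto
        from nfi(3)[OF W(1) this v(1)] v(2) show ?thesis by blast
      qed
      show "transpose (a v) = a v" if "v \<in> V" for v
        using a vertexI[OF that] by (auto simp: sym_matrices_def)
      show "functional_on (polys_on (?k - (int l + 1)) (convex hull W)) (b (convex hull W) i j)"
        if W: "W \<subseteq> V" "card W = l + 1" "l \<in> {1..CARD('n) - 1}" "i \<in> {1..CARD('n) - l}" "j \<in> {i..CARD('n) - l}" for W l i j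
        using b faceI[OF W(1,2)] W(3-5) by blast
      show "functional_on (polys_on (?k - (int l + 1)) (convex hull W)) (\<gamma> W i w)"
        if W: "W \<subseteq> V" "card W = l + 1" "l \<in> {1..CARD('n) - 1}" "i \<in> {1..l}" and w: "w \<in> N W" for W l i w
      proof (cases "card W \<le> m + 1")
        case True
        then have lm: "l \<in> {1..m}" using W by auto
        have "w \<in> \<nu> (convex hull W) ` {1..CARD('n) - l}" using w True W(2) by (simp add: N_def)
        then have "inv_into {1..CARD('n) - l} (\<nu> (convex hull W)) w \<in> {1..CARD('n) - l}" by (rule inv_into_into)
        then have "functional_on (polys_on (?k - (int l + 1)) (convex hull W))
           (c (convex hull W) i (inv_into {1..CARD('n) - l} (\<nu> (convex hull W)) w))"
          using c lm faceI[OF W(1,2)] W(4) by blast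
        then show ?thesis using True W(2) by (simp add: \<gamma>_def)
      next
        case False
        then have lm: "l \<in> {m+1..CARD('n) - 1}" using W by auto
        have "w \<in> nf ` (V - W)" using w False by (simp add: N_def)
        then have v: "inv_into (V - W) nf w \<in> V - W" (is "?v \<in> _") by (rule inv_into_into)
        have "convex hull W \<in> subsimplices l (convex hull (V - {?v}))"
          by (subst subsimplices_hull_iff) (use W v in auto)
        moreover have "convex hull (V - {?v}) \<in> subsimplices (CARD('n) - 1) ?T" using facetI v by blast
        ultimately have "functional_on (polys_on (?k - (int l + 1)) (convex hull W)) (d (convex hull (V - {?v})) (convex hull W) i)"
          using d lm W(4) by blast
        then show ?thesis using False by (simp add: \<gamma>_def)
      qed
    qed simp
    then obtain A where A: "A \<in> polynomials ?k" "\<forall>x. transpose (A x) = A x" "\<forall>v\<in>V. A v = a v"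
      and match: "\<forall>W l. W \<subseteq> V \<longrightarrow> card W = l + 1 \<longrightarrow> l \<in> {1..CARD('n) - 1} \<longrightarrow>
      (\<forall>i\<in>{1..CARD('n) - l}. \<forall>j\<in>{i..CARD('n) - l}. \<forall>q\<in>polys_on (?k - (int l + 1)) (convex hull W).
         moment (convex hull W) (\<nu> (convex hull W) i) (\<nu> (convex hull W) j) q A = b (convex hull W) i j q) \<and>
      (\<forall>i\<in>{1..l}. \<forall>w\<in>N W. \<forall>q\<in>polys_on (?k - (int l + 1)) (convex hull W).
         moment (convex hull W) (t (convex hull W) i) w q A = \<gamma> W i w q)"
      by (elim bexE conjE)
    define A0 where "A0 = (\<lambda>x. if x \<in> ?T then A x else 0)"
    have A0: "A0 \<in> sym_polys_on ?k ?T"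
      using polys_onI[OF A(1), of ?T] A(2) by (auto simp: sym_polys_on_def sym_matrices_def A0_def)
    have contA0: "continuous_on ?T A0" using continuous_on_polys_on A0 by (auto simp: sym_polys_on_def)
    have sub: "convex hull W \<subseteq> ?T" if "W \<subseteq> V" for W using that by (rule hull_mono)
    have momA0: "moment (convex hull W) u w q A0 = moment (convex hull W) u w q A" if W: "W \<subseteq> V" for W u w q
      by (rule moment_cong[OF refl]) (use sub[OF W] in \<open>auto simp: A0_def\<close>)
    have e': "functional_on (div_bubbles ?k ?T) (\<lambda>q. e q - interior_moment ?T q A0)"
    proof (rule functional_on_diff[OF e])
      have cB: "continuous_on ?T q" if "q \<in> div_bubbles ?k ?T" for q
        using that continuous_on_polys_on by (auto simp: div_bubbles_def sym_polys_on_def)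
      show "functional_on (div_bubbles ?k ?T) (\<lambda>q. interior_moment ?T q A0)"
        unfolding functional_on_def interior_moment_commute[of ?T _ A0]
        using interior_moment_comb[OF comp cB cB contA0] by blast
    qed
    \<comment> \<open>The interior moments still missing are supplied by a bubble field, which
      changes neither vertex values nor boundary moments.\<close>
    obtain p where p: "p \<in> div_bubbles ?k ?T"
      "\<And>q. q \<in> div_bubbles ?k ?T \<Longrightarrow> interior_moment ?T q p = e q - interior_moment ?T q A0"
      by (rule div_bubbles_representer[OF e']) blast
    have psym: "p \<in> sym_polys_on ?k ?T" using p(1) by (simp add: div_bubbles_def)
    have contp: "continuous_on ?T p" using psym continuous_on_polys_on by (auto simp: sym_polys_on_def)
    define S where "S = (\<lambda>x. 1 *\<^sub>R A0 x + 1 *\<^sub>R p x)"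
    have S: "S \<in> sym_polys_on ?k ?T"
      unfolding S_def by (rule fun_subspace_comb[OF fun_subspace_sym_polys_on A0 psym])
    have momS: "moment (convex hull W) u w q S = moment (convex hull W) u w q A"
      if W: "W \<subseteq> V" "W \<noteq> {}" and w: "normal_to (convex hull W) w" and q: "q \<in> polys_on k' (convex hull W)" for W u w q k'
    proof -
      have "moment (convex hull W) u w q S = 1 * moment (convex hull W) u w q A0 + 1 * moment (convex hull W) u w q p"
        unfolding S_def
        by (rule moment_comb[OF compact_face[OF W(1)] _ continuous_on_subset[OF contA0 sub[OF W(1)]]
            continuous_on_subset[OF contp sub[OF W(1)]] continuous_on_polys_on[OF q]]) (use W(2) in simp)
      then show ?thesis using div_bubble_moment[OF p(1) W w] momA0[OF W(1)] by simp
    qed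
    have vert: "S v = a v" if "{v} \<in> subsimplices 0 ?T" for v
    proof -
      obtain W where W: "W \<subseteq> V" "card W = 0 + 1" "{v} = convex hull W"
        using \<open>{v} \<in> subsimplices 0 ?T\<close> subsimplices_iff by blast
      then obtain u where "W = {u}" by (auto simp: card_1_singleton_iff)
      then have v: "v \<in> V" using W by auto
      then have "v \<in> ?T" by (rule hull_inc)
      then show ?thesis using A(3) v div_bubble_vertex[OF p(1) v] by (simp add: S_def A0_def)
    qed
    have nn: "moment f (\<nu> f i) (\<nu> f j) q S = b f i j q"
      if A: "l \<in> {1..CARD('n) - 1}" "f \<in> subsimplices l ?T" "i \<in> {1..CARD('n) - l}" "j \<in> {i..CARD('n) - l}"
        "q \<in> polys_on (?k - (int l + 1)) f" for l f i j q
    proof -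
      obtain W where W: "W \<subseteq> V" "card W = l + 1" "f = convex hull W" using A(2) subsimplices_iff by blast
      have Wne: "W \<noteq> {}" using W(2) by auto
      have "normal_to (convex hull W) (\<nu> (convex hull W) j)"
        using tn'[OF W(1,2)] A(3,4) by (auto simp: tn_basis_def)
      then have "moment f (\<nu> f i) (\<nu> f j) q S = moment f (\<nu> f i) (\<nu> f j) q A"
        unfolding W(3) using momS[OF W(1) Wne _ A(5)[unfolded W(3)]] by blast
      also have "\<dots> = b f i j q" using match W A by blast
      finally show ?thesis .
    qed
    have low: "moment f (t f i) (\<nu> f j) q S = c f i j q"
      if A: "l \<in> {1..m}" "f \<in> subsimplices l ?T" "i \<in> {1..l}" "j \<in> {1..CARD('n) - l}"
        "q \<in> polys_on (?k - (int l + 1)) f" for l f i j q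
    proof -
      obtain W where W: "W \<subseteq> V" "card W = l + 1" "f = convex hull W" using A(2) subsimplices_iff by blast
      have l: "l \<in> {1..CARD('n) - 1}" using A(1) m by auto
      have inj: "inj_on (\<nu> f) {1..CARD('n) - l}" using tn'[OF W(1,2)] W(3) by (auto simp: tn_basis_def)
      have Wne: "W \<noteq> {}" using W(2) by auto
      have "normal_to (convex hull W) (\<nu> (convex hull W) j)"
        using tn'[OF W(1,2)] A(4) by (auto simp: tn_basis_def)
      then have "moment f (t f i) (\<nu> f j) q S = moment f (t f i) (\<nu> f j) q A"
        unfolding W(3) using momS[OF W(1) Wne _ A(5)[unfolded W(3)]] by blast
      also have "\<dots> = \<gamma> W i (\<nu> f j) q"
      proof -
        have "\<nu> f j \<in> N W" using A(1,4) W by (auto simp: N_def)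
        then show ?thesis using match W A(3,5) l by blast
      qed
      also have "\<dots> = c f i j q"
        using W A(1,4) inj by (simp add: \<gamma>_def)
      finally show ?thesis .
    qed
    have high: "moment f (t f i) (\<nu>F F) q S = d F f i q"
      if A: "F \<in> subsimplices (CARD('n) - 1) ?T" "l \<in> {m+1..CARD('n) - 1}" "f \<in> subsimplices l F" "i \<in> {1..l}"
        "q \<in> polys_on (?k - (int l + 1)) f" for F l f i q
    proof -
      obtain v where v: "v \<in> V" "F = convex hull (V - {v})" using A(1) facet_iff by blast
      obtain W where W: "W \<subseteq> V - {v}" "card W = l + 1" "f = convex hull W"
        using A(3) unfolding v(2) using subsimplices_hull_iff[of "V - {v}"] by blast
      have WV: "W \<subseteq> V" "W \<noteq> {}" and vW: "v \<in> V - W" using W v by auto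
      have l: "l \<in> {1..CARD('n) - 1}" using A(2) by auto
      have nfv: "\<nu>F F = nf v" by (simp add: nf_def v(2))
      have "normal_to (convex hull W) (nf v)" using nfi(3)[OF WV vW] .
      then have "moment f (t f i) (\<nu>F F) q S = moment f (t f i) (\<nu>F F) q A"
        unfolding W(3) nfv using momS[OF WV _ A(5)[unfolded W(3)]] by blast
      also have "\<dots> = \<gamma> W i (\<nu>F F) q"
      proof -
        have "\<nu>F F \<in> N W" using A(2) W vW nfv by (auto simp: N_def)
        then show ?thesis using match WV W A(4,5) l by blast
      qed
      also have "\<dots> = d F f i q"
        using W A(2) v(2) inv_into_f_f[OF nfi(1)[OF WV] vW, folded nfv] by (simp add: \<gamma>_def)
      finally show ?thesis .
    qed
    have int: "interior_moment ?T q S = e q" if q: "q \<in> div_bubbles ?k ?T" for q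
    proof -
      have "continuous_on ?T q" using q continuous_on_polys_on by (auto simp: div_bubbles_def sym_polys_on_def)
      from interior_moment_comb[OF comp contA0 contp this, of 1 1] p(2)[OF q] show ?thesis
        by (simp add: S_def)
    qed
    have "?sol S" using S vert nn low high int by blast
    then show ?thesis by blast
  qed
  fix A1 A2
  assume A1: "?sol A1" and A2: "?sol A2"
  define D where "D = (\<lambda>x. 1 *\<^sub>R A1 x + (-1) *\<^sub>R A2 x)"
  have sym12: "A1 \<in> sym_polys_on ?k ?T" "A2 \<in> sym_polys_on ?k ?T" using A1 A2 by blast+
  have cont12: "continuous_on ?T A1" "continuous_on ?T A2"
    using sym12 continuous_on_polys_on by (auto simp: sym_polys_on_def)
  have D: "D \<in> sym_polys_on ?k ?T"
    unfolding D_def by (rule fun_subspace_comb[OF fun_subspace_sym_polys_on sym12])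
  obtain B where B: "B \<in> polynomials ?k" "D = (\<lambda>x. if x \<in> ?T then B x else 0)"
    "\<And>x. x \<in> ?T \<Longrightarrow> transpose (B x) = B x"
    by (rule sym_polys_on_cases[OF D]) blast
  have sub: "convex hull W \<subseteq> ?T" if "W \<subseteq> V" for W using that by (rule hull_mono)
  have momB: "moment (convex hull W) u w q B = moment (convex hull W) u w q A1 - moment (convex hull W) u w q A2"
    if W: "W \<subseteq> V" "W \<noteq> {}" and q: "q \<in> polys_on k' (convex hull W)" for W u w q k'
  proof -
    have "moment (convex hull W) u w q B = moment (convex hull W) u w q D"
      by (rule moment_cong[OF refl]) (use sub[OF W(1)] B(2) in auto)
    also have "\<dots> = 1 * moment (convex hull W) u w q A1 + (-1) * moment (convex hull W) u w q A2"
      unfolding D_def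
      by (rule moment_comb[OF compact_face[OF W(1)] _ continuous_on_subset[OF cont12(1) sub[OF W(1)]]
          continuous_on_subset[OF cont12(2) sub[OF W(1)]] continuous_on_polys_on[OF q]]) (use W(2) in simp)
    finally show ?thesis by simp
  qed
  have Bn: "B x *v \<nu>F (convex hull (V - {v})) = 0" if v: "v \<in> V" and x: "x \<in> convex hull (V - {v})" for v x
  proof (rule facet_dofs_zero_imp[where t = t and \<nu> = \<nu> and m = m and k = ?k and U = "V - {v}"])
    let ?F = "convex hull (V - {v})"
    show "V - {v} \<subseteq> V" by blast
    show "card (V - {v}) = CARD('n)" using v card_vertices by simp
    show "normal_to ?F (\<nu>F ?F)" using nF[OF facetI[OF v]] by (simp add: unit_normal_def)
    show "transpose (B x) = B x" if "x \<in> ?F" for x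
      using B(3) sub[of "V - {v}"] that by blast
    show "B u = 0" if "u \<in> V - {v}" for u
    proof -
      have u: "u \<in> V" using that by auto
      have "D u = 0" using A1 A2 vertexI[OF u] by (simp add: D_def)
      then show ?thesis using B(2) hull_inc[OF u, of convex] by simp
    qed
  next
    fix W l assume W: "W \<subseteq> V - {v}" "card W = l + 1"
    then show "tn_basis l (convex hull W) (t (convex hull W)) (\<nu> (convex hull W))" by (intro tn') auto
  next
    fix W l i j and q :: "real^'n \<Rightarrow> real"
    assume W: "W \<subseteq> V - {v}" "card W = l + 1" "l \<in> {1..CARD('n) - 1}" "i \<in> {1..CARD('n) - l}"
      "j \<in> {i..CARD('n) - l}" and q: "q \<in> polys_on (?k - (int l + 1)) (convex hull W)"
    have WV: "W \<subseteq> V" "W \<noteq> {}" using W by auto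
    have "moment (convex hull W) (\<nu> (convex hull W) i) (\<nu> (convex hull W) j) q A = b (convex hull W) i j q" if "?sol A" for A
      using that faceI[OF WV(1) W(2)] W(3-5) q by blast
    from this[OF A1] this[OF A2] momB[OF WV q]
    show "moment (convex hull W) (\<nu> (convex hull W) i) (\<nu> (convex hull W) j) q B = 0" by simp
  next
    fix W l i j and q :: "real^'n \<Rightarrow> real"
    assume W: "W \<subseteq> V - {v}" "card W = l + 1" "l \<in> {1..m}" "i \<in> {1..l}"
      "j \<in> {1..CARD('n) - l}" and q: "q \<in> polys_on (?k - (int l + 1)) (convex hull W)"
    have WV: "W \<subseteq> V" "W \<noteq> {}" using W by auto
    have "moment (convex hull W) (t (convex hull W) i) (\<nu> (convex hull W) j) q A = c (convex hull W) i j q" if "?sol A" for A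
      using that faceI[OF WV(1) W(2)] W(3-5) q by blast
    from this[OF A1] this[OF A2] momB[OF WV q]
    show "moment (convex hull W) (t (convex hull W) i) (\<nu> (convex hull W) j) q B = 0" by simp
  next
    fix W l i and q :: "real^'n \<Rightarrow> real"
    assume W: "W \<subseteq> V - {v}" "card W = l + 1" "l \<in> {m+1..CARD('n) - 1}" "i \<in> {1..l}"
      and q: "q \<in> polys_on (?k - (int l + 1)) (convex hull W)"
    let ?F = "convex hull (V - {v})"
    have WV: "W \<subseteq> V" "W \<noteq> {}" using W by auto
    have "convex hull W \<in> subsimplices l ?F"
      by (subst subsimplices_hull_iff) (use W in auto)
    then have "moment (convex hull W) (t (convex hull W) i) (\<nu>F ?F) q A = d ?F (convex hull W) i q" if "?sol A" for A
      using that facetI[OF v] W(3-4) q by blast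
    from this[OF A1] this[OF A2] momB[OF WV q]
    show "moment (convex hull W) (t (convex hull W) i) (\<nu>F ?F) q B = 0" by simp
  qed (use B(1) x in auto)
  have "D \<in> div_bubbles ?k ?T"
    unfolding div_bubbles_def
  proof (intro CollectI conjI D ballI allI impI)
    fix F x u assume F: "F \<in> subsimplices (CARD('n) - 1) ?T" and x: "x \<in> F" and u: "unit_normal F u"
    obtain v where v: "v \<in> V" "F = convex hull (V - {v})" using F facet_iff by blast
    \<comment> \<open>The given unit normal and the chosen one are multiples of the same gradient,
      so vanishing along the chosen one is enough.\<close>
    obtain s where s: "u = s *\<^sub>R bary_grad V v" by (rule facet_normal[OF v(1) u[unfolded v(2)]])
    obtain s' where s': "\<nu>F F = s' *\<^sub>R bary_grad V v" "s' \<noteq> 0"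
      using facet_normal[OF v(1) nF[OF F, unfolded v(2)]] v(2) by blast
    have "u = (s / s') *\<^sub>R \<nu>F F" using s s' by simp
    moreover have "B x *v \<nu>F F = 0" using Bn[OF v(1)] x v(2) by blast
    moreover have "D x = B x" using B(2) x sub[of "V - {v}"] v(2) by auto
    ultimately show "D x *v u = 0" by (simp add: matrix_vector_mult_scaleR)
  qed
  moreover have "interior_moment ?T q D = 0" if q: "q \<in> div_bubbles ?k ?T" for q :: "real^'n \<Rightarrow> real^'n^'n"
  proof -
    have cq: "continuous_on ?T q" using q continuous_on_polys_on by (auto simp: div_bubbles_def sym_polys_on_def)
    have "\<forall>q\<in>div_bubbles ?k ?T. interior_moment ?T q A1 = e q" using A1 by (elim conjE)
    moreover have "\<forall>q\<in>div_bubbles ?k ?T. interior_moment ?T q A2 = e q" using A2 by (elim conjE)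
    ultimately have "interior_moment ?T q A1 = e q" "interior_moment ?T q A2 = e q" using q by blast+
    then show ?thesis using interior_moment_comb[OF comp cont12 cq, of 1 "-1"] by (simp add: D_def)
  qed
  ultimately have "D = (\<lambda>_. 0)"
    using D by (intro interior_moment_self_zero[of D ?k]) (auto simp: sym_polys_on_def)
  then show "A1 = A2" by (auto simp: D_def fun_eq_iff)
qed

end


section \<open>Continuously differentiable fields and their divergence\<close>

definition grad :: "(real^'n \<Rightarrow> real) \<Rightarrow> real^'n \<Rightarrow> real^'n" where
  "grad f x = (\<chi> i. frechet_derivative f (at x) (axis i 1))"

text \<open>Differentiability is required on all of R^n. On each simplex the fields to be integrated
  come from polynomials and test functions with their global extension, so no one-sided derivatives
  at the boundary are involved.\<close>

definition C1 :: "(real^'n \<Rightarrow> real) \<Rightarrow> bool" where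
  "C1 f \<longleftrightarrow> (\<forall>x. f differentiable (at x)) \<and> continuous_on UNIV (grad f)"

definition C1_field :: "(real^'n \<Rightarrow> real^'n) \<Rightarrow> bool" where
  "C1_field u \<longleftrightarrow> (\<forall>i. C1 (\<lambda>x. u x $ i))"

definition dvg :: "(real^'n \<Rightarrow> real^'n) \<Rightarrow> real^'n \<Rightarrow> real" where
  "dvg u x = (\<Sum>i\<in>UNIV. grad (\<lambda>x. u x $ i) x $ i)"

lemma frechet_derivative_grad:
  assumes "f differentiable (at x)"
  shows "frechet_derivative f (at x) h = grad f x \<bullet> h"
proof -
  have lin: "linear (frechet_derivative f (at x))" using linear_frechet_derivative[OF assms] .
  have "h = (\<Sum>i\<in>UNIV. (h $ i) *\<^sub>R axis i 1)"
    using basis_expansion[of h] by (simp add: scalar_mult_eq_scaleR)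
  then have "frechet_derivative f (at x) h = (\<Sum>i\<in>UNIV. (h $ i) *\<^sub>R frechet_derivative f (at x) (axis i 1))"
    using linear_sum[OF lin] linear_scale[OF lin] by (metis (no_types, lifting) sum.cong)
  then show ?thesis by (simp add: inner_vec_def grad_def mult.commute)
qed

lemma C1_has_derivative: "C1 f \<Longrightarrow> (f has_derivative (\<lambda>h. grad f x \<bullet> h)) (at x)"
proof -
  assume f: "C1 f"
  then have d: "f differentiable (at x)" by (simp add: C1_def)
  moreover have "frechet_derivative f (at x) = (\<lambda>h. grad f x \<bullet> h)"
    using frechet_derivative_grad[OF d] by auto
  ultimately show ?thesis using frechet_derivative_works[of f "at x"] by simp
qed

lemma grad_unique:
  assumes "(f has_derivative (\<lambda>h. g \<bullet> h)) (at x)"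
  shows "grad f x = g"
  using frechet_derivative_at[OF assms, symmetric] by (simp add: grad_def vec_eq_iff inner_axis)

lemma C1I:
  assumes "\<And>x. (f has_derivative (\<lambda>h. g x \<bullet> h)) (at x)" "continuous_on UNIV g"
  shows "C1 f" "grad f = g"
proof -
  show *: "grad f = g" using grad_unique[OF assms(1)] by auto
  show "C1 f" unfolding C1_def * using assms by (auto simp: differentiable_def)
qed

lemma C1_continuous_grad [continuous_intros]: "C1 f \<Longrightarrow> continuous_on S (grad f)"
  unfolding C1_def using continuous_on_subset by blast

lemma C1_continuous: "C1 f \<Longrightarrow> continuous_on S f"
  by (meson C1_def continuous_at_imp_continuous_on differentiable_imp_continuous_within)

lemma C1_affine: "C1 (\<lambda>x. g \<bullet> x + c)" "grad (\<lambda>x. g \<bullet> x + c) = (\<lambda>_. g)"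
  by (rule C1I[of _ "\<lambda>_. g"]; auto intro!: derivative_eq_intros)+

lemma C1_const: "C1 (\<lambda>x. c)" "grad (\<lambda>x. c) = (\<lambda>_. 0)"
  by (rule C1I[of _ "\<lambda>_. 0"]; auto intro!: derivative_eq_intros)+

lemma C1_add:
  assumes "C1 f" "C1 g"
  shows "C1 (\<lambda>x. f x + g x)" "grad (\<lambda>x. f x + g x) = (\<lambda>x. grad f x + grad g x)"
  using assms by (auto intro!: C1I[of _ "\<lambda>x. grad f x + grad g x"] derivative_eq_intros C1_has_derivative continuous_intros
      simp: inner_add_left)

lemma C1_mult:
  assumes "C1 f" "C1 g"
  shows "C1 (\<lambda>x. f x * g x)" "grad (\<lambda>x. f x * g x) = (\<lambda>x. f x *\<^sub>R grad g x + g x *\<^sub>R grad f x)"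
proof -
  have "((\<lambda>x. f x * g x) has_derivative (\<lambda>h. (f x *\<^sub>R grad g x + g x *\<^sub>R grad f x) \<bullet> h)) (at x)" for x
    using has_derivative_mult[OF C1_has_derivative[OF assms(1), of x] C1_has_derivative[OF assms(2), of x]]
    by (simp add: inner_add_left mult.commute)
  moreover have "continuous_on UNIV (\<lambda>x. f x *\<^sub>R grad g x + g x *\<^sub>R grad f x)"
    by (intro continuous_intros assms C1_continuous[OF assms(1)] C1_continuous[OF assms(2)])
  ultimately show "C1 (\<lambda>x. f x * g x)" "grad (\<lambda>x. f x * g x) = (\<lambda>x. f x *\<^sub>R grad g x + g x *\<^sub>R grad f x)"
    by (rule C1I)+
qed

lemma C1_cmult: "C1 f \<Longrightarrow> C1 (\<lambda>x. c * f x)" "C1 f \<Longrightarrow> grad (\<lambda>x. c * f x) = (\<lambda>x. c *\<^sub>R grad f x)"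
  using C1_mult[OF C1_const(1), of f c] by (simp_all add: C1_const(2))

lemma C1_sum:
  assumes "\<And>i. i \<in> I \<Longrightarrow> C1 (f i)"
  shows "C1 (\<lambda>x. \<Sum>i\<in>I. f i x)" "grad (\<lambda>x. \<Sum>i\<in>I. f i x) = (\<lambda>x. \<Sum>i\<in>I. grad (f i) x)"
proof -
  have "((\<lambda>x. \<Sum>i\<in>I. f i x) has_derivative (\<lambda>h. (\<Sum>i\<in>I. grad (f i) x) \<bullet> h)) (at x)" for x
    using has_derivative_sum[of I f "\<lambda>i h. grad (f i) x \<bullet> h" "at x"] C1_has_derivative[OF assms]
    by (simp add: inner_sum_left)
  moreover have "continuous_on UNIV (\<lambda>x. \<Sum>i\<in>I. grad (f i) x)"
    by (intro continuous_intros assms)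
  ultimately show "C1 (\<lambda>x. \<Sum>i\<in>I. f i x)" "grad (\<lambda>x. \<Sum>i\<in>I. f i x) = (\<lambda>x. \<Sum>i\<in>I. grad (f i) x)"
    by (rule C1I)+
qed

lemma C1_prod:
  assumes "\<And>i. i \<in> I \<Longrightarrow> C1 (f i)"
  shows "C1 (\<lambda>x. \<Prod>i\<in>I. f i x)" "grad (\<lambda>x. \<Prod>i\<in>I. f i x) = (\<lambda>x. \<Sum>i\<in>I. (\<Prod>j\<in>I - {i}. f j x) *\<^sub>R grad (f i) x)"
proof -
  have "((\<lambda>x. \<Prod>i\<in>I. f i x) has_derivative (\<lambda>h. (\<Sum>i\<in>I. (\<Prod>j\<in>I - {i}. f j x) *\<^sub>R grad (f i) x) \<bullet> h)) (at x)" for x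
  proof -
    have "((\<lambda>x. \<Prod>i\<in>I. f i x) has_derivative (\<lambda>h. \<Sum>i\<in>I. (grad (f i) x \<bullet> h) * (\<Prod>j\<in>I - {i}. f j x))) (at x)"
      by (rule has_derivative_prod) (rule C1_has_derivative[OF assms])
    then show ?thesis by (simp add: inner_sum_left mult.commute)
  qed
  moreover have "continuous_on UNIV (\<lambda>x. \<Sum>i\<in>I. (\<Prod>j\<in>I - {i}. f j x) *\<^sub>R grad (f i) x)"
    by (intro continuous_intros assms C1_continuous) auto
  ultimately show "C1 (\<lambda>x. \<Prod>i\<in>I. f i x)" "grad (\<lambda>x. \<Prod>i\<in>I. f i x) = (\<lambda>x. \<Sum>i\<in>I. (\<Prod>j\<in>I - {i}. f j x) *\<^sub>R grad (f i) x)"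
    by (rule C1I)+
qed

lemma C1_compose_real:
  fixes \<theta> :: "real \<Rightarrow> real"
  assumes "C1 f" "\<And>s. (\<theta> has_real_derivative \<theta>' s) (at s)" "continuous_on UNIV \<theta>'"
  shows "C1 (\<lambda>x. \<theta> (f x))" "grad (\<lambda>x. \<theta> (f x)) = (\<lambda>x. \<theta>' (f x) *\<^sub>R grad f x)"
proof -
  have "((\<lambda>x. \<theta> (f x)) has_derivative (\<lambda>h. (\<theta>' (f x) *\<^sub>R grad f x) \<bullet> h)) (at x)" for x
    using has_derivative_compose[OF C1_has_derivative[OF assms(1)] has_field_derivative_imp_has_derivative[OF assms(2)]]
    by (simp add: mult.commute)
  moreover have "continuous_on UNIV (\<lambda>x. \<theta>' (f x) *\<^sub>R grad f x)"
    using assms by (intro continuous_intros continuous_on_compose2[OF assms(3)] C1_continuous) auto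
  ultimately show "C1 (\<lambda>x. \<theta> (f x))" "grad (\<lambda>x. \<theta> (f x)) = (\<lambda>x. \<theta>' (f x) *\<^sub>R grad f x)"
    by (rule C1I)+
qed

lemma C1_polynomial:
  assumes "p \<in> polynomials k"
  shows "C1 p"
  using assms
proof (induction rule: polynomials_induct)
  case (coord k p j)
  have "C1 (\<lambda>x. x $ j)" using C1_affine(1)[of "axis j 1" 0] by (simp add: inner_axis')
  then show ?case using C1_mult(1) coord by simp
qed (auto intro: C1_const C1_add)

lemma C1_field_continuous: "C1_field u \<Longrightarrow> continuous_on S u"
  unfolding C1_field_def by (intro continuous_on_vec_lambda[of _ "\<lambda>i x. u x $ i", simplified] C1_continuous) auto

lemma continuous_on_dvg [continuous_intros]: "C1_field u \<Longrightarrow> continuous_on S (dvg u)"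
  unfolding dvg_def[abs_def] C1_field_def by (intro continuous_intros) auto

lemma C1_inner_field: "C1_field u \<Longrightarrow> C1 (\<lambda>x. a \<bullet> u x)"
  unfolding inner_vec_def C1_field_def by (auto intro!: C1_sum(1) C1_cmult(1))

lemma C1_field_add:
  assumes "C1_field u" "C1_field w"
  shows "C1_field (\<lambda>x. u x + w x)" "dvg (\<lambda>x. u x + w x) = (\<lambda>x. dvg u x + dvg w x)"
  using assms by (auto simp: C1_field_def dvg_def C1_add sum.distrib fun_eq_iff)

lemma C1_field_scaleR:
  assumes "C1 f" "C1_field u"
  shows "C1_field (\<lambda>x. f x *\<^sub>R u x)" "dvg (\<lambda>x. f x *\<^sub>R u x) = (\<lambda>x. f x * dvg u x + grad f x \<bullet> u x)"
  using assms by (auto simp: C1_field_def dvg_def C1_mult sum.distrib sum_distrib_left inner_vec_def mult.commute fun_eq_iff)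

lemma C1_field_cscaleR:
  assumes "C1_field u"
  shows "C1_field (\<lambda>x. c *\<^sub>R u x)" "dvg (\<lambda>x. c *\<^sub>R u x) = (\<lambda>x. c * dvg u x)"
  using C1_field_scaleR[OF C1_const(1) assms, of c] by (simp_all add: C1_const(2))

lemma C1_field_zero: "C1_field (\<lambda>_. 0)" "dvg (\<lambda>_. 0) = (\<lambda>_. 0)"
  by (auto simp: C1_field_def dvg_def C1_const fun_eq_iff)

lemma C1_field_sum:
  assumes "finite I" "\<And>i. i \<in> I \<Longrightarrow> C1_field (u i)"
  shows "C1_field (\<lambda>x. \<Sum>i\<in>I. u i x)" "dvg (\<lambda>x. \<Sum>i\<in>I. u i x) = (\<lambda>x. \<Sum>i\<in>I. dvg (u i) x)"
proof -
  have "C1_field (\<lambda>x. \<Sum>i\<in>I. u i x) \<and> dvg (\<lambda>x. \<Sum>i\<in>I. u i x) = (\<lambda>x. \<Sum>i\<in>I. dvg (u i) x)"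
    using assms by (induction I rule: finite_induct) (auto simp: C1_field_zero C1_field_add)
  then show "C1_field (\<lambda>x. \<Sum>i\<in>I. u i x)" "dvg (\<lambda>x. \<Sum>i\<in>I. u i x) = (\<lambda>x. \<Sum>i\<in>I. dvg (u i) x)" by auto
qed

lemma C1_field_position: "C1_field (\<lambda>x. x - v)"
proof -
  have "C1 (\<lambda>x. (x - v) $ i)" for i
    using C1_affine(1)[of "axis i 1" "- v $ i"] by (simp add: inner_axis')
  then show ?thesis by (simp add: C1_field_def)
qed

lemma grad_zero_outside:
  assumes "compact K" "\<And>x. x \<notin> K \<Longrightarrow> f x = 0" "x \<notin> K"
  shows "grad f x = 0"
proof -
  have "(f has_derivative (\<lambda>h. 0 \<bullet> h)) (at x)"
    by (rule has_derivative_transform_within_open[where f = "\<lambda>_. 0" and s = "- K"])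
      (use assms in \<open>auto simp: open_Compl compact_imp_closed\<close>)
  then show ?thesis by (rule grad_unique)
qed

lemma dvg_zero_outside:
  assumes "compact K" "\<And>x. x \<notin> K \<Longrightarrow> u x = 0" "x \<notin> K"
  shows "dvg u x = 0"
  using grad_zero_outside[OF assms(1) _ assms(3)] assms(2) by (simp add: dvg_def)

lemma compact_support_bounded:
  fixes f :: "'a::topological_space \<Rightarrow> 'b::real_normed_vector"
  assumes "compact K" "\<And>x. x \<notin> K \<Longrightarrow> f x = 0" "continuous_on UNIV f"
  obtains B where "B \<ge> 0" "\<And>x. norm (f x) \<le> B"
proof -
  have "bounded (f ` K)"
    using assms by (intro compact_imp_bounded compact_continuous_image continuous_on_subset[OF assms(3)]) auto
  then obtain B where B: "\<And>x. x \<in> K \<Longrightarrow> norm (f x) \<le> B" by (auto simp: bounded_iff)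
  have "norm (f x) \<le> max B 0" for x using B[of x] assms(2)[of x] by (cases "x \<in> K") auto
  then show ?thesis using that[of "max B 0"] by auto
qed

lemma C1_compact_support_lipschitz:
  assumes "C1 f" "compact K" "\<And>x. x \<notin> K \<Longrightarrow> f x = 0"
  obtains B where "B \<ge> 0" "\<And>x y. \<bar>f x - f y\<bar> \<le> B * norm (x - y)"
proof -
  obtain B where B: "B \<ge> 0" "\<And>x. norm (grad f x) \<le> B"
  proof (rule compact_support_bounded[OF assms(2), of "grad f"])
    show "grad f x = 0" if "x \<notin> K" for x by (rule grad_zero_outside[OF assms(2,3) that])
    show "continuous_on UNIV (grad f)" by (rule C1_continuous_grad[OF assms(1)])
  qed blast
  have "norm (f x - f y) \<le> B * norm (x - y)" for x y
  proof (rule differentiable_bound[where S = UNIV and f' = "\<lambda>x h. grad f x \<bullet> h"])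
    show "(f has_derivative (\<bullet>) (grad f x)) (at x within UNIV)" for x
      using C1_has_derivative[OF assms(1)] by simp
    show "onorm ((\<bullet>) (grad f x)) \<le> B" for x
    proof (rule onorm_le)
      fix h
      have "norm (grad f x \<bullet> h) \<le> norm (grad f x) * norm h" by (simp add: Cauchy_Schwarz_ineq2)
      also have "\<dots> \<le> B * norm h" using B(2)[of x] by (simp add: mult_right_mono)
      finally show "norm (grad f x \<bullet> h) \<le> B * norm h" .
    qed
  qed auto
  then show ?thesis using that B(1) by auto
qed

lemma integrable_compact_support:
  fixes f :: "'a::euclidean_space \<Rightarrow> real"
  assumes "compact K" "\<And>x. x \<notin> K \<Longrightarrow> f x = 0" "continuous_on UNIV f"
  shows "integrable lborel f"
proof -
  have "integrable lborel (\<lambda>x. indicator K x *\<^sub>R f x)"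
    using assms by (intro borel_integrable_compact continuous_on_subset[OF assms(3)]) auto
  moreover have "(\<lambda>x. indicator K x *\<^sub>R f x) = f" using assms(2) by (auto simp: indicator_def fun_eq_iff)
  ultimately show ?thesis by simp
qed

text \<open>Translation invariance makes the integral of every difference quotient zero. The
  quotients converge to the directional derivative and are dominated through the Lipschitz constant,
  so the limit is zero as well.\<close>

lemma integral_grad_zero:
  fixes f :: "real^'n \<Rightarrow> real"
  assumes f: "C1 f" and K: "compact K" "\<And>x. x \<notin> K \<Longrightarrow> f x = 0"
  shows "(\<integral>x. grad f x \<bullet> e \<partial>lborel) = 0"
proof -
  obtain B where B: "B \<ge> 0" "\<And>x y. \<bar>f x - f y\<bar> \<le> B * norm (x - y)"
    using C1_compact_support_lipschitz[OF f K] by blast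
  define t where "t k = inverse (real (Suc k))" for k
  have t: "0 < t k" "t k \<le> 1" for k by (auto simp: t_def field_simps)
  have t0: "t \<longlonglongrightarrow> 0" unfolding t_def by (rule LIMSEQ_inverse_real_of_nat)
  obtain R where R: "\<And>x. x \<in> K \<Longrightarrow> norm x \<le> R"
    using compact_imp_bounded[OF K(1)] by (auto simp: bounded_iff)
  \<comment> \<open>The steps t k are at most 1, so enlarging the ball by the length of e captures
    the supports of all translates.\<close>
  define K' where "K' = cball (0::real^'n) (R + norm e)"
  have out: "f (x + t k *\<^sub>R e) = 0" "f x = 0" if "x \<notin> K'" for x k
  proof -
    have x: "norm x > R + norm e" using that by (simp add: K'_def)
    have "norm (t k *\<^sub>R e) \<le> norm e" using t[of k] by (simp add: mult_left_le_one_le)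
    then have "norm (x + t k *\<^sub>R e) > R" using x norm_diff_ineq[of x "t k *\<^sub>R e"] by linarith
    then show "f (x + t k *\<^sub>R e) = 0" using R K(2) by force
    show "f x = 0" using R[of x] K(2)[of x] x norm_ge_zero[of e] by force
  qed
  have cf: "continuous_on UNIV f" using C1_continuous[OF f] .
  have intf: "integrable lborel f" by (rule integrable_compact_support[OF K cf])
  have shift: "(\<integral>x. f (x + t k *\<^sub>R e) \<partial>lborel) = (\<integral>x. f x \<partial>lborel)" 
    and intsh: "integrable lborel (\<lambda>x. f (x + t k *\<^sub>R e))" for k
  proof -
    have bf: "f \<in> borel_measurable borel" using cf by (rule borel_measurable_continuous_onI)
    have "(\<integral>x. f x \<partial>lborel) = (\<integral>x. f x \<partial>distr lborel borel ((+) (t k *\<^sub>R e)))"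
      by (simp add: lborel_distr_plus)
    also have "\<dots> = (\<integral>x. f (t k *\<^sub>R e + x) \<partial>lborel)"
      by (rule integral_distr) (use bf in auto)
    finally show "(\<integral>x. f (x + t k *\<^sub>R e) \<partial>lborel) = (\<integral>x. f x \<partial>lborel)" by (simp add: add.commute)
    show "integrable lborel (\<lambda>x. f (x + t k *\<^sub>R e))"
      by (rule integrable_compact_support[of K'])
        (use out in \<open>auto simp: K'_def intro!: continuous_on_compose2[OF cf] continuous_intros\<close>)
  qed
  have lim: "(\<lambda>k. \<integral>x. (f (x + t k *\<^sub>R e) - f x) / t k \<partial>lborel) \<longlonglongrightarrow> (\<integral>x. grad f x \<bullet> e \<partial>lborel)"
  proof (rule integral_dominated_convergence[where w = "\<lambda>x. indicator K' x * (B * norm e)"])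
    show "(\<lambda>x. grad f x \<bullet> e) \<in> borel_measurable lborel"
      using borel_measurable_continuous_onI[OF continuous_on_inner[OF C1_continuous_grad[OF f, of UNIV] continuous_on_const[of _ e]]] by simp
    show "(\<lambda>x. (f (x + t k *\<^sub>R e) - f x) / t k) \<in> borel_measurable lborel" for k
      using borel_measurable_integrable[OF intsh[of k]] borel_measurable_integrable[OF intf] by measurable
    show "integrable lborel (\<lambda>x. indicator K' x * (B * norm e))"
      by (intro integrable_mult_left integrable_real_indicator) (auto simp: K'_def intro: emeasure_bounded_finite[unfolded infinity_ennreal_def])
    show "AE x in lborel. (\<lambda>k. (f (x + t k *\<^sub>R e) - f x) / t k) \<longlonglongrightarrow> grad f x \<bullet> e"
    proof (rule AE_I2)
      fix x
      have "((\<lambda>s. f (x + s *\<^sub>R e)) has_derivative (\<lambda>s. grad f x \<bullet> (s *\<^sub>R e))) (at 0)"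
        by (rule has_derivative_compose[of "\<lambda>s. x + s *\<^sub>R e" "\<lambda>s. s *\<^sub>R e" 0 UNIV f "\<lambda>h. grad f x \<bullet> h"])
           (auto intro!: derivative_eq_intros simp: C1_has_derivative[OF f])
      moreover have "(\<lambda>s. grad f x \<bullet> (s *\<^sub>R e)) = (*) (grad f x \<bullet> e)"
        by (auto simp: fun_eq_iff)
      ultimately have "((\<lambda>s. f (x + s *\<^sub>R e)) has_real_derivative (grad f x \<bullet> e)) (at 0)"
        by (simp only: has_field_derivative_def)
      then have "((\<lambda>h. (f (x + h *\<^sub>R e) - f x) / h) \<longlongrightarrow> grad f x \<bullet> e) (at 0)"
        by (simp add: DERIV_def)
      moreover have "filterlim t (at 0) sequentially"
      proof -
        have "t k \<noteq> 0" for k using t(1)[of k] by simp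
        then show ?thesis using t0 by (simp add: filterlim_at)
      qed
      ultimately show "(\<lambda>k. (f (x + t k *\<^sub>R e) - f x) / t k) \<longlonglongrightarrow> grad f x \<bullet> e"
        by (rule filterlim_compose)
    qed
    show "AE x in lborel. norm ((f (x + t k *\<^sub>R e) - f x) / t k) \<le> indicator K' x * (B * norm e)" for k
    proof (rule AE_I2)
      fix x
      show "norm ((f (x + t k *\<^sub>R e) - f x) / t k) \<le> indicator K' x * (B * norm e)"
        using B(2)[of "x + t k *\<^sub>R e" x] t[of k] out(1)[of x k] out(2)[of x]
        by (cases "x \<in> K'") (auto simp: divide_simps mult_ac)
    qed
  qed
  have zero: "(\<integral>x. (f (x + t k *\<^sub>R e) - f x) / t k \<partial>lborel) = 0" for k
    using shift[of k] intsh[of k] intf by simp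
  from lim[unfolded zero] show ?thesis by (simp add: LIMSEQ_const_iff)
qed

lemma integral_dvg_zero:
  fixes u :: "real^'n \<Rightarrow> real^'n"
  assumes u: "C1_field u" and K: "compact K" "\<And>x. x \<notin> K \<Longrightarrow> u x = 0"
  shows "(\<integral>x. dvg u x \<partial>lborel) = 0"
proof -
  have C: "C1 (\<lambda>x. u x $ i)" for i using u by (simp add: C1_field_def)
  have Ki: "u x $ i = 0" if "x \<notin> K" for x i using K(2)[OF that] by simp
  have *: "(\<lambda>x. grad f x $ i) = (\<lambda>x. grad f x \<bullet> axis i 1)" for f :: "real^'n \<Rightarrow> real" and i
    by (simp add: inner_axis)
  have "integrable lborel (\<lambda>x. grad (\<lambda>x. u x $ i) x $ i)" for i
  proof (rule integrable_compact_support[OF K(1)])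
    show "grad (\<lambda>x. u x $ i) x $ i = 0" if "x \<notin> K" for x
      using grad_zero_outside[OF K(1) Ki that] by simp
    show "continuous_on UNIV (\<lambda>x. grad (\<lambda>x. u x $ i) x $ i)"
      by (intro continuous_intros C)
  qed
  then show ?thesis
    unfolding dvg_def using integral_grad_zero[OF C K(1) Ki] by (simp add: *)
qed


section \<open>Fields without normal component\<close>

text \<open>A \<open>C\<^sup>1\<close> cutoff for which \<open>s ramp'(s)\<close> is bounded, so that the gradient of \<open>ramp (k \<lambda>)\<close>, although
  of size \<open>k\<close>, stays harmless against a factor of order \<open>\<lambda>\<close>.\<close>

definition ramp :: "real \<Rightarrow> real" where "ramp s = (max 0 s)\<^sup>2 / (1 + s\<^sup>2)"

definition ramp' :: "real \<Rightarrow> real" where "ramp' s = 2 * max 0 s / (1 + s\<^sup>2)\<^sup>2"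

lemma one_plus_square_pos: "(0::real) < 1 + s\<^sup>2" by (simp add: add_pos_nonneg)

lemma ramp_nonpos: "s \<le> 0 \<Longrightarrow> ramp s = 0" "s \<le> 0 \<Longrightarrow> ramp' s = 0"
  by (simp_all add: ramp_def ramp'_def)

lemma ramp_range: "0 \<le> ramp s" "ramp s \<le> 1"
  using one_plus_square_pos[of s] by (auto simp: ramp_def divide_simps max_def not_less)

lemma ramp'_nonneg: "0 \<le> ramp' s"
  by (simp add: ramp'_def)

lemma ramp'_bound: "s * ramp' s \<le> 1"
proof (cases "s \<le> 0")
  case False
  have "2 * s * s \<le> (1 + s\<^sup>2)\<^sup>2"
    using zero_le_square[of "s * s"] by (simp add: power2_eq_square algebra_simps)
  then show ?thesis using False one_plus_square_pos[of s]
    by (simp add: ramp'_def max_def divide_simps mult_ac)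
qed (simp add: ramp_nonpos)

lemma ramp_derivative: "(ramp has_real_derivative ramp' s) (at s)"
proof -
  consider "s < 0" | "s = 0" | "s > 0" by linarith
  then show ?thesis
  proof cases
    case 1
    have "(ramp has_real_derivative 0) (at s)"
      by (rule has_field_derivative_transform_within_open[where S = "{..<0}" and f = "\<lambda>_. 0"])
        (use 1 in \<open>auto simp: ramp_nonpos\<close>)
    then show ?thesis using 1 by (simp add: ramp_nonpos)
  next
    case 2
    have "(\<lambda>h. (ramp (0 + h) - ramp 0) / h) \<midarrow>0\<rightarrow> 0"
    proof (rule Lim_null_comparison[where g = "\<lambda>h. \<bar>h\<bar>"])
      have "norm ((ramp (0 + h) - ramp 0) / h) \<le> \<bar>h\<bar>" for h
      proof (cases "h \<le> 0")
        case False
        then have "ramp h \<le> h\<^sup>2" using one_plus_square_pos[of h]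
          by (simp add: ramp_def max_def divide_simps algebra_simps)
        then show ?thesis using False ramp_range(1)[of h]
          by (simp add: ramp_nonpos divide_simps power2_eq_square)
      qed (simp add: ramp_nonpos)
      then show "\<forall>\<^sub>F h in at 0. norm ((ramp (0 + h) - ramp 0) / h) \<le> \<bar>h\<bar>" by simp
      show "(\<lambda>h::real. \<bar>h\<bar>) \<midarrow>0\<rightarrow> 0" by (intro tendsto_eq_intros) auto
    qed
    then show ?thesis using 2 by (simp add: DERIV_def ramp_nonpos)
  next
    case 3
    have "((\<lambda>s. s\<^sup>2 / (1 + s\<^sup>2)) has_real_derivative (2 * s / (1 + s\<^sup>2)\<^sup>2)) (at s)"
      using one_plus_square_pos[of s]
      by (auto intro!: derivative_eq_intros simp: divide_simps power2_eq_square algebra_simps)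
    then have "(ramp has_real_derivative (2 * s / (1 + s\<^sup>2)\<^sup>2)) (at s)"
      by (rule has_field_derivative_transform_within_open[where S = "{0<..}"])
        (use 3 in \<open>auto simp: ramp_def max_def\<close>)
    then show ?thesis using 3 by (simp add: ramp'_def max_def)
  qed
qed

lemma continuous_on_ramp': "continuous_on S ramp'"
proof -
  have "(1 + s\<^sup>2)\<^sup>2 \<noteq> (0::real)" for s using one_plus_square_pos[of s] by simp
  then show ?thesis unfolding ramp'_def[abs_def] by (intro continuous_intros) auto
qed

text \<open>For fixed s > 0 the derivative at k s decays like 2 / (k s)^3, so it tends to zero even
  after multiplication by k: the cutoff leaves no trace at interior points.\<close>

lemma ramp_tendsto:
  assumes "s > 0"
  shows "(\<lambda>k. ramp (real k * s)) \<longlonglongrightarrow> 1"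
    and "(\<lambda>k. real k * ramp' (real k * s)) \<longlonglongrightarrow> 0"
proof -
  define e where "e k = inverse (real (Suc k))" for k
  have e0: "e \<longlonglongrightarrow> 0" unfolding e_def by (rule LIMSEQ_inverse_real_of_nat)
  \<comment> \<open>The index is shifted to avoid k = 0, where dividing by k would fail;
    \<open>LIMSEQ_imp_Suc\<close> undoes the shift.\<close>
  have "(\<lambda>k. ramp (real (Suc k) * s)) \<longlonglongrightarrow> 1"
  proof -
    have "ramp (real (Suc k) * s) = s\<^sup>2 / ((e k)\<^sup>2 + s\<^sup>2)" for k
    proof -
      have "ramp (real (Suc k) * s) = (real (Suc k) * s)\<^sup>2 / (1 + (real (Suc k) * s)\<^sup>2)"
        using assms by (simp add: ramp_def max_def)
      also have "\<dots> = ((real (Suc k))\<^sup>2 * s\<^sup>2) / ((real (Suc k))\<^sup>2 * ((e k)\<^sup>2 + s\<^sup>2))"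
        by (simp add: e_def power_mult_distrib distrib_left power_inverse del: of_nat_Suc)
      finally show ?thesis by (simp del: of_nat_Suc)
    qed
    moreover have "(\<lambda>k. s\<^sup>2 / ((e k)\<^sup>2 + s\<^sup>2)) \<longlonglongrightarrow> s\<^sup>2 / (0\<^sup>2 + s\<^sup>2)"
      using assms by (intro tendsto_intros e0) auto
    ultimately show ?thesis using assms by simp
  qed
  then show "(\<lambda>k. ramp (real k * s)) \<longlonglongrightarrow> 1" by (rule LIMSEQ_imp_Suc)
  have "(\<lambda>k. real (Suc k) * ramp' (real (Suc k) * s)) \<longlonglongrightarrow> 0"
  proof (rule Lim_null_comparison[where g = "\<lambda>k. 2 * (e k)\<^sup>2 / s ^ 3"])
    have "norm (real (Suc k) * ramp' (real (Suc k) * s)) \<le> 2 * (e k)\<^sup>2 / s ^ 3" for k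
    proof -
      define K where "K = real (Suc k)"
      have K: "K > 0" by (simp add: K_def)
      have "(K * s)\<^sup>2 * (K * s)\<^sup>2 \<le> (1 + (K * s)\<^sup>2) * (1 + (K * s)\<^sup>2)"
        by (intro mult_mono) auto
      then have "2 * K * (K * s) / (1 + (K * s)\<^sup>2)\<^sup>2 \<le> 2 * K * (K * s) / ((K * s)\<^sup>2 * (K * s)\<^sup>2)"
        using K assms one_plus_square_pos[of "K * s"]
        by (intro divide_left_mono mult_pos_pos zero_less_power) (auto simp: power2_eq_square)
      also have "\<dots> = 2 * (inverse K)\<^sup>2 / s ^ 3"
        using K assms by (simp add: field_simps power2_eq_square power3_eq_cube)
      finally show ?thesis
        unfolding e_def K_def[symmetric] using K assms
        by (simp add: ramp'_def max_def mult_ac)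
    qed
    then show "\<forall>\<^sub>F k in sequentially. norm (real (Suc k) * ramp' (real (Suc k) * s)) \<le> 2 * (e k)\<^sup>2 / s ^ 3" by simp
    have "(\<lambda>k. 2 * (e k)\<^sup>2 / s ^ 3) \<longlonglongrightarrow> 2 * 0\<^sup>2 / s ^ 3"
      using assms by (intro tendsto_intros e0) auto
    then show "(\<lambda>k. 2 * (e k)\<^sup>2 / s ^ 3) \<longlonglongrightarrow> 0" by simp
  qed
  then show "(\<lambda>k. real k * ramp' (real k * s)) \<longlonglongrightarrow> 0" by (rule LIMSEQ_imp_Suc)
qed

text \<open>A globally C1 function that vanishes outside an intersection of open half-spaces and
  tends to 1 inside. It turns integrals over a polyhedron into limits of integrals over the whole
  space.\<close>

definition cutoff :: "'i set \<Rightarrow> ('i \<Rightarrow> real^'n) \<Rightarrow> ('i \<Rightarrow> real) \<Rightarrow> nat \<Rightarrow> real^'n \<Rightarrow> real" where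
  "cutoff I g c k x = (\<Prod>i\<in>I. ramp (real k * (g i \<bullet> x + c i)))"

lemma C1_cutoff:
  shows "C1 (cutoff I g c k)"
    and "grad (cutoff I g c k) = (\<lambda>x. \<Sum>i\<in>I. (\<Prod>j\<in>I - {i}. ramp (real k * (g j \<bullet> x + c j))) *\<^sub>R
      (ramp' (real k * (g i \<bullet> x + c i)) *\<^sub>R (real k *\<^sub>R g i)))"
proof -
  have l: "C1 (\<lambda>x. real k * (g i \<bullet> x + c i))" "grad (\<lambda>x. real k * (g i \<bullet> x + c i)) = (\<lambda>_. real k *\<^sub>R g i)" for i
    using C1_cmult[OF C1_affine(1)] by (simp_all add: C1_affine(2))
  note r = C1_compose_real[OF l(1) ramp_derivative continuous_on_ramp']
  show "C1 (cutoff I g c k)"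
    unfolding cutoff_def[abs_def] by (rule C1_prod(1)[OF r(1)])
  show "grad (cutoff I g c k) = (\<lambda>x. \<Sum>i\<in>I. (\<Prod>j\<in>I - {i}. ramp (real k * (g j \<bullet> x + c j))) *\<^sub>R
      (ramp' (real k * (g i \<bullet> x + c i)) *\<^sub>R (real k *\<^sub>R g i)))"
    unfolding cutoff_def[abs_def] by (subst C1_prod(2)[OF r(1)]) (simp add: r(2) l(2))
qed

text \<open>The derivative of the i-th ramp contributes k ramp'(k l_i) (g_i . u), which the
  hypothesis bounds by C (k l_i) ramp'(k l_i) \<le> C. So all divergences are dominated by one
  integrable function, and the terms with derivatives vanish in the limit. The set \<open>Q\<close>
  adds a region whose boundary carries no cutoff, as required for two simplices joined along a
  facet.\<close>

lemma cutoff_limit: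
  fixes u :: "real^'n \<Rightarrow> real^'n"
  assumes I: "finite I" and u: "C1_field u" and K: "compact K" "\<And>x. x \<notin> K \<Longrightarrow> u x = 0"
    and Q: "Q \<in> sets borel"
    and bound: "\<And>x i. x \<in> Q \<Longrightarrow> (\<And>j. j \<in> I \<Longrightarrow> 0 \<le> g j \<bullet> x + c j) \<Longrightarrow> i \<in> I \<Longrightarrow>
      \<bar>g i \<bullet> u x\<bar> \<le> C * (g i \<bullet> x + c i)"
    and C: "0 \<le> C"
  shows "(\<lambda>k. LINT x:Q|lborel. dvg (\<lambda>x. cutoff I g c k x *\<^sub>R u x) x)
    \<longlonglongrightarrow> (LINT x:Q \<inter> {x. \<forall>i\<in>I. 0 < g i \<bullet> x + c i}|lborel. dvg u x)"
proof -
  let ?l = "\<lambda>i x. g i \<bullet> x + c i"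
  let ?R = "{x. \<forall>i\<in>I. 0 < g i \<bullet> x + c i}"
  have Rb: "?R \<in> sets borel"
  proof -
    have "?R = (\<Inter>i\<in>I. {x. 0 < g i \<bullet> x + c i})" by auto
    moreover have "open (\<Inter>i\<in>I. {x. 0 < g i \<bullet> x + c i})"
      using I by (intro open_INT ballI open_Collect_less continuous_intros) auto
    ultimately show ?thesis by simp
  qed
  have D: "dvg (\<lambda>x. cutoff I g c k x *\<^sub>R u x) x = cutoff I g c k x * dvg u x +
    (\<Sum>i\<in>I. (\<Prod>j\<in>I - {i}. ramp (real k * ?l j x)) * (real k * ramp' (real k * ?l i x) * (g i \<bullet> u x)))" for k x
    by (simp add: C1_field_scaleR(2)[OF C1_cutoff(1) u] C1_cutoff(2) inner_sum_left mult_ac)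
  have cdvg: "continuous_on UNIV (dvg u)" using continuous_on_dvg[OF u] .
  have dvg0: "dvg u x = 0" if "x \<notin> K" for x by (rule dvg_zero_outside[OF K that])
  obtain M where M: "M \<ge> 0" "\<And>x. norm (dvg u x) \<le> M"
    by (rule compact_support_bounded[OF K(1) dvg0 cdvg]) blast+
  have cD: "continuous_on UNIV (dvg (\<lambda>x. cutoff I g c k x *\<^sub>R u x))" for k
    by (intro continuous_on_dvg C1_field_scaleR(1) C1_cutoff u)
  have prod1: "0 \<le> (\<Prod>j\<in>J. ramp (real k * ?l j x))" "(\<Prod>j\<in>J. ramp (real k * ?l j x)) \<le> 1" for J k x
    by (auto intro: prod_nonneg prod_le_1 ramp_range)
  show ?thesis
    unfolding set_lebesgue_integral_def
  proof (rule integral_dominated_convergence[where w = "\<lambda>x. indicator K x * (M + real (card I) * C)"])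
    show "(\<lambda>x. indicat_real (Q \<inter> ?R) x *\<^sub>R dvg u x) \<in> borel_measurable lborel"
      using Q Rb borel_measurable_continuous_onI[OF cdvg] by measurable
    show "(\<lambda>x. indicat_real Q x *\<^sub>R dvg (\<lambda>x. cutoff I g c k x *\<^sub>R u x) x) \<in> borel_measurable lborel" for k
      using Q borel_measurable_continuous_onI[OF cD[of k]] by measurable
    show "integrable lborel (\<lambda>x. indicat_real K x * (M + real (card I) * C))"
      using emeasure_compact_finite[OF K(1)] K(1) by (intro integrable_mult_left integrable_real_indicator) (auto simp: compact_imp_closed)
    \<comment> \<open>As soon as one affine function is nonpositive every summand is zero: the one
      that differentiates this very factor because \<open>ramp'\<close> vanishes too, the others
      because they contain the factor.\<close>
    have vanish: "(\<Prod>j\<in>I - {i}. ramp (real k * ?l j x)) * (real k * ramp' (real k * ?l i x) * y) = 0"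
      if "j \<in> I" "?l j x \<le> 0" "i \<in> I" for i j k x y
    proof (cases "i = j")
      case True
      have "real k * ?l j x \<le> 0" using that(2) by (simp add: mult_nonneg_nonpos)
      then show ?thesis using True by (simp add: ramp_nonpos)
    next
      case False
      have "real k * ?l j x \<le> 0" using that(2) by (simp add: mult_nonneg_nonpos)
      then have "ramp (real k * ?l j x) = 0" by (simp add: ramp_nonpos)
      then have "(\<Prod>j\<in>I - {i}. ramp (real k * ?l j x)) = 0" using I that False by (intro prod_zero) auto
      then show ?thesis by simp
    qed
    have vanish': "cutoff I g c k x = 0" if "j \<in> I" "?l j x \<le> 0" for j k x
    proof -
      have "real k * ?l j x \<le> 0" using that(2) by (simp add: mult_nonneg_nonpos)
      then show ?thesis using I that(1) ramp_nonpos(1) unfolding cutoff_def by (intro prod_zero) auto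
    qed
    have Dzero: "dvg (\<lambda>x. cutoff I g c k x *\<^sub>R u x) x = 0" if "j \<in> I" "?l j x \<le> 0" for j k x
      unfolding D vanish'[OF that] by (subst sum.neutral, intro ballI, rule vanish[OF that], assumption, simp)
    show "AE x in lborel. (\<lambda>k. indicat_real Q x *\<^sub>R dvg (\<lambda>x. cutoff I g c k x *\<^sub>R u x) x)
        \<longlonglongrightarrow> indicat_real (Q \<inter> ?R) x *\<^sub>R dvg u x"
    proof (rule AE_I2)
      fix x
      show "(\<lambda>k. indicat_real Q x *\<^sub>R dvg (\<lambda>x. cutoff I g c k x *\<^sub>R u x) x)
        \<longlonglongrightarrow> indicat_real (Q \<inter> ?R) x *\<^sub>R dvg u x"
      proof (cases "x \<in> ?R")
        case True
        have 1: "(\<lambda>k. \<Prod>j\<in>J. ramp (real k * ?l j x)) \<longlonglongrightarrow> (\<Prod>j\<in>J. 1)" if "J \<subseteq> I" for J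
          using that True by (intro tendsto_prod ramp_tendsto) auto
        have "(\<lambda>k. dvg (\<lambda>x. cutoff I g c k x *\<^sub>R u x) x) \<longlonglongrightarrow>
          (\<Prod>j\<in>I. 1) * dvg u x + (\<Sum>i\<in>I. (\<Prod>j\<in>I - {i}. 1) * (0 * (g i \<bullet> u x)))"
          unfolding D unfolding cutoff_def
          using True by (intro tendsto_intros 1 ramp_tendsto) auto
        then show ?thesis using True by (auto simp: indicator_def)
      next
        case False
        then obtain j where "j \<in> I" "?l j x \<le> 0" by (auto simp: not_less)
        then have "dvg (\<lambda>x. cutoff I g c k x *\<^sub>R u x) x = 0" for k by (rule Dzero)
        then show ?thesis using False by simp
      qed
    qed
    show "AE x in lborel. norm (indicat_real Q x *\<^sub>R dvg (\<lambda>x. cutoff I g c k x *\<^sub>R u x) x)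
        \<le> indicat_real K x * (M + real (card I) * C)" for k
    proof (rule AE_I2)
      fix x
      have MC: "0 \<le> M + real (card I) * C" using M(1) C by simp
      consider "x \<notin> K" | "x \<notin> Q" | j where "j \<in> I" "?l j x \<le> 0" | "x \<in> K" "x \<in> Q" "\<forall>j\<in>I. 0 < ?l j x"
        by (meson not_less)
      then show "norm (indicat_real Q x *\<^sub>R dvg (\<lambda>x. cutoff I g c k x *\<^sub>R u x) x)
        \<le> indicat_real K x * (M + real (card I) * C)"
      proof cases
        case 1
        then show ?thesis using K(2)[OF 1] dvg0[OF 1] by (simp add: D)
      next
        case 2
        then show ?thesis using MC by (simp add: indicator_def)
      next
        case 3
        then have "dvg (\<lambda>x. cutoff I g c k x *\<^sub>R u x) x = 0" by (rule Dzero)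
        then show ?thesis using MC by (simp add: indicator_def)
      next
        case 4
        have "norm (cutoff I g c k x * dvg u x) \<le> 1 * M"
          unfolding norm_mult using prod1[of k x I] M(2)[of x] by (intro mult_mono) (auto simp: cutoff_def)
        moreover have "norm (\<Sum>i\<in>I. (\<Prod>j\<in>I - {i}. ramp (real k * ?l j x)) * (real k * ramp' (real k * ?l i x) * (g i \<bullet> u x)))
          \<le> real (card I) * C"
        proof (rule sum_norm_bound)
          fix i assume i: "i \<in> I"
          have "norm ((\<Prod>j\<in>I - {i}. ramp (real k * ?l j x)) * (real k * ramp' (real k * ?l i x) * (g i \<bullet> u x)))
            \<le> 1 * (real k * ramp' (real k * ?l i x) * \<bar>g i \<bullet> u x\<bar>)"
            unfolding norm_mult using prod1[of k x "I - {i}"] ramp'_nonneg by (intro mult_mono) auto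
          also have "\<dots> \<le> real k * ramp' (real k * ?l i x) * (C * ?l i x)"
            using bound[OF 4(2) _ i] 4(3) ramp'_nonneg by (simp add: mult_left_mono less_imp_le)
          also have "\<dots> = C * ((real k * ?l i x) * ramp' (real k * ?l i x))" by simp
          also have "\<dots> \<le> C * 1" by (intro mult_left_mono ramp'_bound C)
          finally show "norm ((\<Prod>j\<in>I - {i}. ramp (real k * ?l j x)) * (real k * ramp' (real k * ?l i x) * (g i \<bullet> u x))) \<le> C" by simp
        qed
        ultimately show ?thesis
          using 4 norm_triangle_ineq[of "cutoff I g c k x * dvg u x"] by (force simp: D)
      qed
    qed
  qed
qed

text \<open>With \<open>Q\<close> the whole space, every approximating integral is that of the
  divergence of a compactly supported field, hence zero, and so is the limit.\<close>

lemma tangential_integral_zero: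
  fixes u :: "real^'n \<Rightarrow> real^'n"
  assumes I: "finite I" and u: "C1_field u" and K: "compact K" "\<And>x. x \<notin> K \<Longrightarrow> u x = 0"
    and bound: "\<And>x i. (\<And>j. j \<in> I \<Longrightarrow> 0 \<le> g j \<bullet> x + c j) \<Longrightarrow> i \<in> I \<Longrightarrow> \<bar>g i \<bullet> u x\<bar> \<le> C * (g i \<bullet> x + c i)"
    and C: "0 \<le> C"
  shows "(LINT x:{x. \<forall>i\<in>I. 0 < g i \<bullet> x + c i}|lborel. dvg u x) = 0"
proof -
  have "(LINT x:UNIV|lborel. dvg (\<lambda>x. cutoff I g c k x *\<^sub>R u x) x) = 0" for k
    unfolding set_lebesgue_integral_def
    using integral_dvg_zero[OF C1_field_scaleR(1)[OF C1_cutoff(1) u] K(1)] K(2) by simp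
  moreover have "(\<lambda>k. LINT x:UNIV|lborel. dvg (\<lambda>x. cutoff I g c k x *\<^sub>R u x) x)
      \<longlonglongrightarrow> (LINT x:UNIV \<inter> {x. \<forall>i\<in>I. 0 < g i \<bullet> x + c i}|lborel. dvg u x)"
    by (rule cutoff_limit[OF I u K, where C = C]) (use bound C in auto)
  ultimately have "(\<lambda>k. 0) \<longlonglongrightarrow> (LINT x:UNIV \<inter> {x. \<forall>i\<in>I. 0 < g i \<bullet> x + c i}|lborel. dvg u x)"
    by simp
  then show ?thesis by (simp add: LIMSEQ_const_iff)
qed


section \<open>Divergence integrals on one and two simplices\<close>

lemma set_integrable_dvg:
  fixes u :: "real^'n \<Rightarrow> real^'n"
  assumes "C1_field u" "compact K" "\<And>x. x \<notin> K \<Longrightarrow> u x = 0" "Q \<in> sets borel"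
  shows "set_integrable lborel Q (dvg u)"
  unfolding set_integrable_def
  using integrable_compact_support[OF assms(2) dvg_zero_outside[OF assms(2,3)] continuous_on_dvg[OF assms(1)]] assms(4)
  by (intro integrable_mult_indicator) auto

lemma open_halfspace: "open {x :: real^'n. 0 < g \<bullet> x + c}" "open {x :: real^'n. g \<bullet> x + c < 0}"
  by (intro open_Collect_less continuous_intros)+

text \<open>The difference D of the fields has no normal component on the hyperplane, so its
  divergence integrates to zero over the positive side. There Y may be replaced by Y', and the two
  sides together give the integral of div Y' over the whole space.\<close>

lemma halfspace_jump:
  fixes Y Y' :: "real^'n \<Rightarrow> real^'n"
  assumes Y: "C1_field Y" "compact K" "\<And>x. x \<notin> K \<Longrightarrow> Y x = 0"
    and Y': "C1_field Y'" "compact K'" "\<And>x. x \<notin> K' \<Longrightarrow> Y' x = 0"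
    and g: "g \<noteq> 0" and eq: "\<And>x. g \<bullet> x + c = 0 \<Longrightarrow> g \<bullet> Y x = g \<bullet> Y' x"
  shows "(LINT x:{x. 0 < g \<bullet> x + c}|lborel. dvg Y x) + (LINT x:{x. g \<bullet> x + c < 0}|lborel. dvg Y' x) = 0"
proof -
  let ?P = "{x. 0 < g \<bullet> x + c}" and ?N = "{x. g \<bullet> x + c < 0}" and ?Z = "{x. g \<bullet> x = - c}"
  define D where "D x = Y x + (-1) *\<^sub>R Y' x" for x
  have D: "C1_field D" "dvg D = (\<lambda>x. dvg Y x + (-1) * dvg Y' x)"
    unfolding D_def[abs_def]
    by (rule C1_field_add(1)[OF Y(1) C1_field_cscaleR(1)[OF Y'(1)]],
        simp only: C1_field_add(2)[OF Y(1) C1_field_cscaleR(1)[OF Y'(1)]] C1_field_cscaleR(2)[OF Y'(1)])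
  have supp: "compact (K \<union> K')" "\<And>x. x \<notin> K \<union> K' \<Longrightarrow> D x = 0"
    using Y Y' by (auto simp: D_def)
  have sb: "?P \<in> sets borel" "?N \<in> sets borel" "?Z \<in> sets borel"
    using open_halfspace[of g c] closed_hyperplane[of g "- c"] by auto
  have D0: "g \<bullet> D x = 0" if "x \<notin> K \<union> K'" for x using supp(2)[OF that] by simp
  obtain B where B: "B \<ge> 0" "\<And>x y. \<bar>g \<bullet> D x - g \<bullet> D y\<bar> \<le> B * norm (x - y)"
    by (rule C1_compact_support_lipschitz[OF C1_inner_field[OF D(1)] supp(1) D0]) blast+
  have bound: "\<bar>g \<bullet> D x\<bar> \<le> (B / norm g) * (g \<bullet> x + c)" if "0 \<le> g \<bullet> x + c" for x
  proof -
    \<comment> \<open>The foot of the perpendicular from x to the hyperplane, where the normal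
      component of D vanishes; the Lipschitz bound then gives linear growth with the
      distance.\<close>
    define y where "y = x - ((g \<bullet> x + c) / (g \<bullet> g)) *\<^sub>R g"
    have "g \<bullet> y + c = 0" using g by (simp add: y_def inner_diff_right)
    then have "g \<bullet> D y = 0" using eq[of y] by (simp add: D_def inner_diff_right)
    then have "\<bar>g \<bullet> D x\<bar> \<le> B * norm (x - y)" using B(2)[of x y] by simp
    also have "norm (x - y) = (g \<bullet> x + c) / norm g"
      using that g by (simp add: y_def dot_square_norm power2_eq_square)
    finally show ?thesis by simp
  qed
  have "(LINT x:{x. \<forall>i\<in>{()}. 0 < g \<bullet> x + c}|lborel. dvg D x) = 0"
    by (rule tangential_integral_zero[OF _ D(1) supp, where C = "B / norm g"]) (use bound B(1) in auto)
  then have "(LINT x:?P|lborel. dvg Y x + (-1) * dvg Y' x) = 0" by (simp add: D(2))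
  moreover have "(LINT x:?P|lborel. dvg Y x + (-1) * dvg Y' x) = (LINT x:?P|lborel. dvg Y x) + (-1) * (LINT x:?P|lborel. dvg Y' x)"
    using set_integral_diff(2)[OF set_integrable_dvg[OF Y sb(1)] set_integrable_dvg[OF Y' sb(1)]] by simp
  moreover have "(LINT x:?P|lborel. dvg Y' x) + (LINT x:?N|lborel. dvg Y' x) = 0"
  proof -
    have "?Z \<in> null_sets lborel"
      using negligible_hyperplane[of g "- c"] g sb(3) by (simp add: negligible_iff_null_sets null_sets_completion_iff)
    then have "AE x in lborel. x \<notin> ?Z" by (rule AE_not_in)
    then have ae: "AE x in lborel. indicat_real (?P \<union> ?N) x *\<^sub>R dvg Y' x = dvg Y' x"
      by eventually_elim (auto simp: indicator_def)
    have "(LINT x:?P|lborel. dvg Y' x) + (LINT x:?N|lborel. dvg Y' x) = (LINT x:?P \<union> ?N|lborel. dvg Y' x)"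
      by (rule set_integral_Un[symmetric]) (use set_integrable_dvg[OF Y'] sb in auto)
    also have "\<dots> = (\<integral>x. dvg Y' x \<partial>lborel)"
      unfolding set_lebesgue_integral_def
    proof (rule integral_cong_AE)
      have c: "dvg Y' \<in> borel_measurable borel" by (rule borel_measurable_continuous_onI[OF continuous_on_dvg[OF Y'(1)]])
      then show "dvg Y' \<in> borel_measurable lborel" by simp
      show "(\<lambda>x. indicat_real (?P \<union> ?N) x *\<^sub>R dvg Y' x) \<in> borel_measurable lborel"
        using c sb by (intro borel_measurable_scaleR borel_measurable_indicator) auto
    qed (rule ae)
    also have "\<dots> = 0" by (rule integral_dvg_zero[OF Y'])
    finally show ?thesis .
  qed
  ultimately show ?thesis by simp
qed

definition open_simplex :: "(real^'n) set \<Rightarrow> (real^'n) set" where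
  "open_simplex V = {x. \<forall>v\<in>V. 0 < bary V v x}"

context full_simplex
begin

lemma open_open_simplex: "open (open_simplex V)"
proof -
  have "open_simplex V = (\<Inter>v\<in>V. {x. 0 < bary V v x})" by (auto simp: open_simplex_def)
  then show ?thesis by (simp add: open_INT open_Collect_less continuous_on_bary)
qed

lemma open_simplex_subset: "open_simplex V \<subseteq> convex hull V"
  using simplex_iff by (auto simp: open_simplex_def intro: less_imp_le)

text \<open>Sliding x to the facet opposite v moves it by a multiple of lambda_v(x), and the normal
  component vanishes there. The Lipschitz bound turns this into the linear bound that the cutoff
  argument asks for.\<close>

lemma simplex_tangential:
  fixes u :: "real^'n \<Rightarrow> real^'n"
  assumes u: "C1_field u" "compact K" "\<And>x. x \<notin> K \<Longrightarrow> u x = 0"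
    and zero: "\<And>v x. v \<in> V \<Longrightarrow> x \<in> convex hull (V - {v}) \<Longrightarrow> bary_grad V v \<bullet> u x = 0"
  shows "(LINT x:open_simplex V|lborel. dvg u x) = 0"
proof -
  have "\<exists>C\<ge>0. \<forall>x\<in>convex hull V. \<bar>bary_grad V v \<bullet> u x\<bar> \<le> C * bary V v x" if v: "v \<in> V" for v
  proof -
    obtain j where j: "j \<in> V" "j \<noteq> v" by (rule other_vertex)
    have u0: "bary_grad V v \<bullet> u x = 0" if "x \<notin> K" for x using u(3)[OF that] by simp
    obtain B where B: "B \<ge> 0" "\<And>x y. \<bar>bary_grad V v \<bullet> u x - bary_grad V v \<bullet> u y\<bar> \<le> B * norm (x - y)"
      by (rule C1_compact_support_lipschitz[OF C1_inner_field[OF u(1)] u(2) u0]) blast+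
    have "\<bar>bary_grad V v \<bullet> u x\<bar> \<le> (B * norm (j - v)) * bary V v x" if x: "x \<in> convex hull V" for x
    proof -
      have "bary_grad V v \<bullet> u (x + bary V v x *\<^sub>R (j - v)) = 0"
        by (rule zero[OF v slide_to_facet[OF order_refl v j x]])
      then have "\<bar>bary_grad V v \<bullet> u x\<bar> \<le> B * norm (x - (x + bary V v x *\<^sub>R (j - v)))"
        using B(2)[of x "x + bary V v x *\<^sub>R (j - v)"] by simp
      also have "norm (x - (x + bary V v x *\<^sub>R (j - v))) = bary V v x * norm (j - v)"
        using x simplex_iff v by simp
      finally show ?thesis by (simp add: mult_ac)
    qed
    then show ?thesis using B(1) by (intro exI[of _ "B * norm (j - v)"]) auto
  qed
  then have "\<forall>v\<in>V. \<exists>C. C \<ge> 0 \<and> (\<forall>x\<in>convex hull V. \<bar>bary_grad V v \<bullet> u x\<bar> \<le> C * bary V v x)" by blast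
  from bchoice[OF this] obtain C where C: "\<forall>v\<in>V. C v \<ge> 0 \<and> (\<forall>x\<in>convex hull V. \<bar>bary_grad V v \<bullet> u x\<bar> \<le> C v * bary V v x)" by blast
  \<comment> \<open>One constant for all facets: the sum dominates each nonnegative summand.\<close>
  define C' where "C' = sum C V"
  have C': "C' \<ge> 0" unfolding C'_def using C by (intro sum_nonneg) blast
  have bound: "\<bar>bary_grad V v \<bullet> u x\<bar> \<le> C' * bary V v x" if "v \<in> V" "\<And>w. w \<in> V \<Longrightarrow> 0 \<le> bary V w x" for v x
  proof -
    have x: "x \<in> convex hull V" using simplex_iff that(2) by blast
    have "C v \<le> C'" unfolding C'_def using C that(1) by (intro member_le_sum) auto
    then have "C v * bary V v x \<le> C' * bary V v x" using that by (intro mult_right_mono) auto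
    moreover have "\<bar>bary_grad V v \<bullet> u x\<bar> \<le> C v * bary V v x" using C that(1) x by blast
    ultimately show ?thesis by simp
  qed
  have "(LINT x:{x. \<forall>v\<in>V. 0 < bary_grad V v \<bullet> x + snd (bary_pair V v)}|lborel. dvg u x) = 0"
    by (rule tangential_integral_zero[OF finite_vertices u, where C = C'])
      (use bound C' in \<open>auto simp: bary_def\<close>)
  then show ?thesis by (simp add: open_simplex_def bary_def)
qed

text \<open>The normal component of \<open>x - v\<close> vanishes on every facet through \<open>v\<close> and is constant on the
  opposite one, so adding the fields on the right removes all normal components of \<open>u\<close>.\<close>

lemma vertex_fields_expand:
  fixes u :: "real^'n \<Rightarrow> real^'n"
  assumes u: "C1_field u" "compact K" "\<And>x. x \<notin> K \<Longrightarrow> u x = 0"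
  shows "(LINT x:open_simplex V|lborel. dvg u x) =
    - (\<Sum>v\<in>V. LINT x:open_simplex V|lborel. dvg (\<lambda>x. (bary_grad V v \<bullet> u x) *\<^sub>R (x - v)) x)"
proof -
  let ?w = "\<lambda>v x. (bary_grad V v \<bullet> u x) *\<^sub>R (x - v)"
  have w: "C1_field (?w v)" for v by (intro C1_field_scaleR C1_inner_field u C1_field_position)
  have w0: "?w v x = 0" if "x \<notin> K" for v x using u(3)[OF that] by simp
  have S: "C1_field (\<lambda>x. \<Sum>v\<in>V. ?w v x)" "dvg (\<lambda>x. \<Sum>v\<in>V. ?w v x) = (\<lambda>x. \<Sum>v\<in>V. dvg (?w v) x)"
    by (rule C1_field_sum[OF finite_vertices w])+
  have sb: "open_simplex V \<in> sets borel" using open_open_simplex by simp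
  have "(LINT x:open_simplex V|lborel. dvg (\<lambda>x. u x + (\<Sum>v\<in>V. ?w v x)) x) = 0"
  proof (rule simplex_tangential[OF C1_field_add(1)[OF u(1) S(1)] u(2)])
    show "u x + (\<Sum>v\<in>V. ?w v x) = 0" if "x \<notin> K" for x using u(3)[OF that] by simp
  next
    fix v x assume v: "v \<in> V" and x: "x \<in> convex hull (V - {v})"
    have bv: "bary V v x = 0" using x v convex_hull_iff[of "V - {v}"] by auto
    have "bary_grad V v \<bullet> (x - w) = (if w = v then -1 else 0)" if "w \<in> V" for w
      using bv that v by (simp add: bary_diff[symmetric] bary_vertex)
    then have "bary_grad V v \<bullet> (\<Sum>w\<in>V. ?w w x) = (\<Sum>w\<in>V. if w = v then - (bary_grad V w \<bullet> u x) else 0)"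
      unfolding inner_sum_right by (intro sum.cong) auto
    then show "bary_grad V v \<bullet> (u x + (\<Sum>v\<in>V. ?w v x)) = 0"
      using v by (simp add: inner_add_right)
  qed
  then have "(LINT x:open_simplex V|lborel. dvg u x + (\<Sum>v\<in>V. dvg (?w v) x)) = 0"
    by (simp add: C1_field_add(2)[OF u(1) S(1)] S(2))
  moreover have i: "set_integrable lborel (open_simplex V) (dvg (?w v))" for v
    by (rule set_integrable_dvg[OF w u(2) w0 sb])
  have isum: "set_integrable lborel (open_simplex V) (\<lambda>x. \<Sum>v\<in>V. dvg (?w v) x)"
    using i unfolding set_integrable_def scaleR_sum_right by (intro Bochner_Integration.integrable_sum) auto
  have "(LINT x:open_simplex V|lborel. dvg u x + (\<Sum>v\<in>V. dvg (?w v) x))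
     = (LINT x:open_simplex V|lborel. dvg u x) + (LINT x:open_simplex V|lborel. (\<Sum>v\<in>V. dvg (?w v) x))"
    by (rule set_integral_add(2)[OF set_integrable_dvg[OF u sb] isum])
  moreover have "(LINT x:open_simplex V|lborel. (\<Sum>v\<in>V. dvg (?w v) x)) = (\<Sum>v\<in>V. LINT x:open_simplex V|lborel. dvg (?w v) x)"
    using i unfolding set_integrable_def set_lebesgue_integral_def scaleR_sum_right
    by (intro Bochner_Integration.integral_sum) auto
  ultimately show ?thesis by simp
qed

end

text \<open>Both coordinates are affine and vanish on the common facet: writing x in the coordinates
  of V' leaves only the term of v'. The sign of the factor tells on which side of the facet v'
  lies.\<close>

lemma bary_change_apex:
  assumes V: "full_simplex V" and V': "full_simplex V'"
    and v: "v \<in> V" "v' \<in> V'" and U: "V' - {v'} = V - {v}"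
  shows "bary V v x = bary V' v' x * bary V v v'"
proof -
  interpret A: full_simplex V by fact
  interpret B: full_simplex V' by fact
  have "bary V v x = bary V v (\<Sum>w\<in>V'. bary V' w x *\<^sub>R w)" by (simp add: B.bary_expand)
  also have "\<dots> = (\<Sum>w\<in>V'. bary V' w x * bary V v w)" by (rule bary_affine_comb[OF B.sum_bary])
  also have "\<dots> = bary V' v' x * bary V v v' + (\<Sum>w\<in>V - {v}. bary V' w x * bary V v w)"
    using v(2) by (simp add: sum.remove[of V' v'] U)
  also have "(\<Sum>w\<in>V - {v}. bary V' w x * bary V v w) = 0"
    using v(1) A.bary_vertex by (intro sum.neutral) auto
  finally show ?thesis by simp
qed

text \<open>On the whole hyperplane lambda_v = 0, not just on the facet, x is an affine combination
  of the common vertices, and its weights are the coordinates in either simplex. This makes the two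
  families of cutoffs coincide there.\<close>

lemma bary_common_facet:
  assumes V: "full_simplex V" and V': "full_simplex V'"
    and v: "v \<in> V" "v' \<in> V'" and U: "V' - {v'} = V - {v}" and x: "bary V v x = 0" and u: "u \<in> V - {v}"
  shows "bary V' u x = bary V u x"
proof -
  interpret A: full_simplex V by fact
  interpret B: full_simplex V' by fact
  have 1: "(\<Sum>w\<in>V - {v}. bary V w x) = 1" "(\<Sum>w\<in>V - {v}. bary V w x *\<^sub>R w) = x"
    using A.sum_bary[of x] A.bary_expand[of x] v(1) x by (simp_all add: sum.remove)
  have u': "u \<in> V'" using u U by blast
  have "bary V' u x = (\<Sum>w\<in>V - {v}. bary V w x * bary V' u w)"
    using bary_affine_comb[OF 1(1), of V' u] 1(2) by simp
  also have "\<dots> = (\<Sum>w\<in>V - {v}. if w = u then bary V w x else 0)"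
  proof (intro sum.cong refl)
    fix w assume "w \<in> V - {v}"
    then have "w \<in> V'" using U by blast
    from B.bary_vertex[OF u' this] show "bary V w x * bary V' u w = (if w = u then bary V w x else 0)" by simp
  qed
  also have "\<dots> = bary V u x" using u A.finite_vertices by simp
  finally show ?thesis .
qed

text \<open>The cutoffs only involve the common vertices.  They agree on the hyperplane of the common facet,
  and the two fields have the same normal component there.\<close>

lemma common_facet_cancel:
  fixes w w' :: "real^'n \<Rightarrow> real"
  assumes V: "full_simplex V" and V': "full_simplex V'"
    and v: "v \<in> V" "v' \<in> V'" and U: "V' - {v'} = V - {v}" and opp: "bary V v v' < 0"
    and w: "C1 w" "compact K" "\<And>x. x \<notin> K \<Longrightarrow> w x = 0"
    and w': "C1 w'" "compact K'" "\<And>x. x \<notin> K' \<Longrightarrow> w' x = 0"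
    and eq: "\<And>x. x \<in> convex hull (V - {v}) \<Longrightarrow> w x = bary V v v' * w' x"
  shows "(LINT x:open_simplex V|lborel. dvg (\<lambda>x. w x *\<^sub>R (x - v)) x) +
    (LINT x:open_simplex V'|lborel. dvg (\<lambda>x. w' x *\<^sub>R (x - v')) x) = 0"
proof -
  interpret A: full_simplex V by fact
  interpret B: full_simplex V' by fact
  let ?U = "V - {v}" and ?g = "bary_grad V v" and ?c = "snd (bary_pair V v)"
  let ?P = "{x. 0 < ?g \<bullet> x + ?c}" and ?N = "{x. ?g \<bullet> x + ?c < 0}"
  let ?gA = "bary_grad V" and ?cA = "\<lambda>u. snd (bary_pair V u)"
  let ?gB = "bary_grad V'" and ?cB = "\<lambda>u. snd (bary_pair V' u)"
  let ?y = "\<lambda>x. w x *\<^sub>R (x - v)" and ?y' = "\<lambda>x. w' x *\<^sub>R (x - v')"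
  let ?Y = "\<lambda>k x. cutoff ?U ?gA ?cA k x *\<^sub>R ?y x" and ?Y' = "\<lambda>k x. cutoff ?U ?gB ?cB k x *\<^sub>R ?y' x"
  have fin: "finite ?U" by simp
  have y: "C1_field ?y" "C1_field ?y'"
    by (intro C1_field_scaleR w(1) w'(1) C1_field_position)+
  have y0: "?y x = 0" if "x \<notin> K" for x using w(3)[OF that] by simp
  have y0': "?y' x = 0" if "x \<notin> K'" for x using w'(3)[OF that] by simp
  have "(LINT x:?P|lborel. dvg (?Y k) x) + (LINT x:?N|lborel. dvg (?Y' k) x) = 0" for k
  proof (rule halfspace_jump)
    show "C1_field (?Y k)" "C1_field (?Y' k)" by (intro C1_field_scaleR(1) C1_cutoff(1) y)+
    show "compact K" "compact K'" by fact+
    show "?Y k x = 0" if "x \<notin> K" for x using y0[OF that] by simp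
    show "?Y' k x = 0" if "x \<notin> K'" for x using y0'[OF that] by simp
    show "?g \<noteq> 0" using A.bary_grad_nonzero[OF v(1)] .
    fix x assume "?g \<bullet> x + ?c = 0"
    then have bx: "bary V v x = 0" by (simp add: bary_def)
    have same: "bary V' u x = bary V u x" if "u \<in> ?U" for u
      by (rule bary_common_facet[OF V V' v U bx that])
    have cut: "cutoff ?U ?gB ?cB k x = cutoff ?U ?gA ?cA k x"
      unfolding cutoff_def by (intro prod.cong refl) (use same in \<open>simp add: bary_def\<close>)
    \<comment> \<open>The fields x - v and x - v' have different normal components, namely -1 and -
      lambda_v(v'); the factor in \<open>eq\<close> compensates for this.\<close>
    have gx: "?g \<bullet> (x - v) = -1" "?g \<bullet> (x - v') = - bary V v v'"
      using bx v(1) by (simp_all add: bary_diff[symmetric] A.bary_vertex)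
    show "?g \<bullet> ?Y k x = ?g \<bullet> ?Y' k x"
    \<comment> \<open>Off the facet some coordinate is negative and both cutoffs are zero, so
      \<open>eq\<close> is required on the facet alone.\<close>
    proof (cases "\<exists>u\<in>?U. bary V u x < 0")
      case True
      then obtain u where u: "u \<in> ?U" "bary V u x < 0" by blast
      have "ramp (real k * bary V u x) = 0" using u(2) by (intro ramp_nonpos) (simp add: mult_nonneg_nonpos)
      then have "cutoff ?U ?gA ?cA k x = 0" unfolding cutoff_def using fin u(1) by (intro prod_zero) (auto simp: bary_def)
      then show ?thesis using cut by simp
    next
      case False
      then have "x \<in> convex hull ?U"
        using bx v(1) A.convex_hull_iff[of ?U] by (auto simp: not_less)
      from eq[OF this] show ?thesis using cut gx by (simp add: inner_scaleR_right)
    qed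
  qed
  moreover have "(\<lambda>k. (LINT x:?P|lborel. dvg (?Y k) x) + (LINT x:?N|lborel. dvg (?Y' k) x)) \<longlonglongrightarrow>
    (LINT x:?P \<inter> {x. \<forall>u\<in>?U. 0 < ?gA u \<bullet> x + ?cA u}|lborel. dvg ?y x) +
    (LINT x:?N \<inter> {x. \<forall>u\<in>?U. 0 < ?gB u \<bullet> x + ?cB u}|lborel. dvg ?y' x)"
  proof (rule tendsto_add)
    obtain M where M: "M \<ge> 0" "\<And>x. norm (w x) \<le> M"
      by (rule compact_support_bounded[OF w(2,3) C1_continuous[OF w(1)]]) blast+
    show "(\<lambda>k. LINT x:?P|lborel. dvg (?Y k) x) \<longlonglongrightarrow>
      (LINT x:?P \<inter> {x. \<forall>u\<in>?U. 0 < ?gA u \<bullet> x + ?cA u}|lborel. dvg ?y x)"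
    proof (rule cutoff_limit[OF fin y(1) w(2) y0 _ _ M(1)])
      show "?P \<in> sets borel" using open_halfspace by simp
      fix x u assume "\<And>u. u \<in> ?U \<Longrightarrow> 0 \<le> ?gA u \<bullet> x + ?cA u" and u: "u \<in> ?U"
      then have nn: "0 \<le> bary V u x" by (simp add: bary_def)
      \<comment> \<open>As lambda_u(v) = 0, the product of grad lambda_u with x - v is lambda_u(x)
        itself, which yields the linear bound for the cutoff.\<close>
      have e: "?gA u \<bullet> ?y x = w x * bary V u x"
        using u v(1) by (auto simp: bary_diff[symmetric] A.bary_vertex)
      have "\<bar>?gA u \<bullet> ?y x\<bar> \<le> M * bary V u x"
        unfolding e using nn M(2)[of x] by (simp add: abs_mult mult_right_mono)
      then show "\<bar>?gA u \<bullet> ?y x\<bar> \<le> M * (?gA u \<bullet> x + ?cA u)" by (simp add: bary_def)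
    qed
  next
    obtain M where M: "M \<ge> 0" "\<And>x. norm (w' x) \<le> M"
      by (rule compact_support_bounded[OF w'(2,3) C1_continuous[OF w'(1)]]) blast+
    show "(\<lambda>k. LINT x:?N|lborel. dvg (?Y' k) x) \<longlonglongrightarrow>
      (LINT x:?N \<inter> {x. \<forall>u\<in>?U. 0 < ?gB u \<bullet> x + ?cB u}|lborel. dvg ?y' x)"
    proof (rule cutoff_limit[OF fin y(2) w'(2) y0' _ _ M(1)])
      show "?N \<in> sets borel" using open_halfspace by simp
      fix x u assume "\<And>u. u \<in> ?U \<Longrightarrow> 0 \<le> ?gB u \<bullet> x + ?cB u" and u: "u \<in> ?U"
      then have nn: "0 \<le> bary V' u x" by (simp add: bary_def)
      have e: "?gB u \<bullet> ?y' x = w' x * bary V' u x"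
      proof -
        have "u \<in> V'" "v' \<noteq> u" using u U by blast+
        then have "bary V' u v' = 0" using B.bary_vertex v(2) by simp
        then show ?thesis by (simp add: bary_diff[symmetric])
      qed
      have "\<bar>?gB u \<bullet> ?y' x\<bar> \<le> M * bary V' u x"
        unfolding e using nn M(2)[of x] by (simp add: abs_mult mult_right_mono)
      then show "\<bar>?gB u \<bullet> ?y' x\<bar> \<le> M * (?gB u \<bullet> x + ?cB u)" by (simp add: bary_def)
    qed
  qed
  moreover have "?P \<inter> {x. \<forall>u\<in>?U. 0 < ?gA u \<bullet> x + ?cA u} = open_simplex V"
    using v(1) by (auto simp: open_simplex_def bary_def)
  moreover have "?N \<inter> {x. \<forall>u\<in>?U. 0 < ?gB u \<bullet> x + ?cB u} = open_simplex V'"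
  proof -
    \<comment> \<open>By \<open>opp\<close> the apex v' lies beyond the facet, so the negative side
      of lambda_v is the positive side of the coordinate of v'.\<close>
    have "?g \<bullet> x + ?c < 0 \<longleftrightarrow> 0 < bary V' v' x" for x
    proof -
      have "?g \<bullet> x + ?c = bary V' v' x * bary V v v'"
        using bary_change_apex[OF V V' v U, of x] by (simp add: bary_def)
      then show ?thesis using opp by (simp add: mult_less_0_iff)
    qed
    moreover have "V' = insert v' ?U" using v(2) U by blast
    ultimately show ?thesis by (auto simp: open_simplex_def bary_def)
  qed
  ultimately show ?thesis by (simp add: LIMSEQ_const_iff)
qed


section \<open>Conforming meshes\<close>

text \<open>A mesh consists of point sets; extreme points recover the vertices of a simplex from the
  set, independently of any choice.\<close>

definition vertices_of :: "'a::real_vector set \<Rightarrow> 'a set" where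
  "vertices_of T = {x. x extreme_point_of T}"

lemma vertices_of_hull:
  "\<not> affine_dependent V \<Longrightarrow> vertices_of (convex hull V :: 'a::euclidean_space set) = V"
  using extreme_point_of_convex_hull_affine_independent by (auto simp: vertices_of_def)

locale conforming_mesh =
  fixes \<T> :: "(real^'n) set set"
  assumes finite_mesh: "finite \<T>"
    and full: "\<And>T. T \<in> \<T> \<Longrightarrow> full_simplex (vertices_of T)"
    and hull: "\<And>T. T \<in> \<T> \<Longrightarrow> convex hull (vertices_of T) = T"
    and conform: "\<And>T T'. T \<in> \<T> \<Longrightarrow> T' \<in> \<T> \<Longrightarrow> (T \<inter> T') face_of T"
begin

lemma inter_hull:
  assumes "T \<in> \<T>" "T' \<in> \<T>"
  obtains W where "W \<subseteq> vertices_of T" "T \<inter> T' = convex hull W"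
  using conform[OF assms] full_simplex.face_iff[OF full[OF assms(1)], of "T \<inter> T'"] hull[OF assms(1)] by auto

lemma hull_inj:
  assumes "T \<in> \<T>" "T' \<in> \<T>" "W \<subseteq> vertices_of T" "W' \<subseteq> vertices_of T'" "convex hull W = convex hull W'"
  shows "W = W'"
proof -
  have "\<not> affine_dependent W" "\<not> affine_dependent W'"
    using affine_independent_subset full assms full_simplex.affine_independent by metis+
  then show ?thesis using vertices_of_hull assms(5) by metis
qed

text \<open>The intersection is then T itself and a face of T'; since both have n + 1 vertices the
  face is not proper.\<close>

lemma inter_sub_eq:
  assumes T: "T \<in> \<T>" "T' \<in> \<T>" and sub: "T \<subseteq> T'"
  shows "T = T'"
proof -
  obtain W where W: "W \<subseteq> vertices_of T'" "T' \<inter> T = convex hull W" by (rule inter_hull[OF T(2,1)])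
  have "convex hull W = convex hull (vertices_of T)" using W(2) sub hull[OF T(1)] by auto
  then have "W = vertices_of T" by (rule hull_inj[OF T(2,1) W(1) order_refl])
  then have "vertices_of T = vertices_of T'"
    using W(1) full[OF T(1)] full[OF T(2)] card_subset_eq[of "vertices_of T'" W]
      full_simplex.finite_vertices[OF full[OF T(2)]] by (simp add: full_simplex_def)
  then show ?thesis using hull T by metis
qed

text \<open>A point with all coordinates positive lies in no proper face, so the common face of T
  and T' is all of T.\<close>

lemma open_simplex_unique:
  assumes T: "T \<in> \<T>" "T' \<in> \<T>" and x: "x \<in> open_simplex (vertices_of T)" "x \<in> T'"
  shows "T = T'"
proof -
  interpret A: full_simplex "vertices_of T" using full[OF T(1)] .
  obtain W where W: "W \<subseteq> vertices_of T" "T \<inter> T' = convex hull W" by (rule inter_hull[OF T])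
  have "x \<in> T" using A.open_simplex_subset hull[OF T(1)] x(1) by auto
  then have "x \<in> convex hull W" using x(2) W(2) by auto
  then have "\<forall>v\<in>vertices_of T - W. bary (vertices_of T) v x = 0" using A.convex_hull_iff[OF W(1)] by blast
  moreover have "\<forall>v\<in>vertices_of T. bary (vertices_of T) v x > 0" using x(1) by (simp add: open_simplex_def)
  ultimately have "W = vertices_of T" using W(1) by force
  then have "T \<subseteq> T'" using W(2) hull[OF T(1)] by auto
  then show ?thesis by (rule inter_sub_eq[OF T])
qed

text \<open>If both apexes lay on the same side, moving slightly from the barycentre of the common
  facet towards v' would lead into the interior of T while staying in T', contrary to
  conformity.\<close>

lemma opposite_sides:
  assumes T: "T \<in> \<T>" "T' \<in> \<T>" "T' \<noteq> T" and v: "v \<in> vertices_of T" "v' \<in> vertices_of T'"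
    and U: "vertices_of T' - {v'} = vertices_of T - {v}"
  shows "bary (vertices_of T) v v' < 0"
proof (rule ccontr)
  let ?V = "vertices_of T" and ?V' = "vertices_of T'"
  interpret A: full_simplex ?V using full[OF T(1)] .
  interpret B: full_simplex ?V' using full[OF T(2)] .
  assume nn: "\<not> bary ?V v v' < 0"
  obtain b where b: "b \<in> convex hull (?V - {v})" "\<And>u. u \<in> ?V - {v} \<Longrightarrow> 0 < bary ?V u b"
    using A.face_barycenter[of "?V - {v}"] A.facet_nonempty by blast
  have bv: "bary ?V v b = 0" using b(1) v(1) A.convex_hull_iff[of "?V - {v}"] by auto
  have change: "bary ?V v x = bary ?V' v' x * bary ?V v v'" for x
    by (rule bary_change_apex[OF full[OF T(1)] full[OF T(2)] v U])
  \<comment> \<open>Nor can v' lie on the hyperplane: by the change of apex the value 1 of lambda_v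
    at v is a multiple of lambda_v(v').\<close>
  have "bary ?V v v = 1" using A.bary_vertex[OF v(1,1)] by simp
  then have pos: "bary ?V v v' > 0" using nn change[of v] by (cases "bary ?V v v' = 0") auto
  have b': "bary ?V' u b = bary ?V u b" if "u \<in> ?V - {v}" for u
    by (rule bary_common_facet[OF full[OF T(1)] full[OF T(2)] v U bv that])
  have bv': "bary ?V' v' b = 0" using change[of b] bv pos by simp
  define x where "x s = (1 - s) *\<^sub>R b + s *\<^sub>R v'" for s
  have x0: "(x \<longlongrightarrow> (1 - 0) *\<^sub>R b + 0 *\<^sub>R v') (at_right 0)"
    unfolding x_def by (intro tendsto_intros)
  have "\<forall>\<^sub>F s in at_right 0. \<forall>u\<in>?V - {v}. 0 < bary ?V u (x s)"
  proof (rule eventually_ball_finite)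
    show "\<forall>u\<in>?V - {v}. \<forall>\<^sub>F s in at_right 0. 0 < bary ?V u (x s)"
    proof
      fix u assume u: "u \<in> ?V - {v}"
      have "((\<lambda>s. bary ?V u (x s)) \<longlongrightarrow> bary ?V u b) (at_right 0)"
        unfolding bary_def using x0 by (auto intro!: tendsto_intros)
      from order_tendstoD(1)[OF this b(2)[OF u]] show "\<forall>\<^sub>F s in at_right 0. 0 < bary ?V u (x s)" .
    qed
  qed simp
  moreover have "\<forall>\<^sub>F s::real in at_right 0. s \<in> {0<..<1}"
    by (rule eventually_at_right_real) simp
  ultimately have "\<forall>\<^sub>F s in at_right 0. (\<forall>u\<in>?V - {v}. 0 < bary ?V u (x s)) \<and> 0 < s \<and> s < 1"
    by eventually_elim auto
  then obtain s where s: "\<forall>u\<in>?V - {v}. 0 < bary ?V u (x s)" "0 < s" "s < 1"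
    using eventually_happens'[OF trivial_limit_at_right_real] by blast
  have "0 < bary ?V v (x s)" unfolding x_def bary_convex_comb using bv pos s by simp
  then have inT: "x s \<in> open_simplex ?V" using s(1) by (auto simp: open_simplex_def)
  have "x s \<in> convex hull ?V'"
  proof -
    have "0 \<le> bary ?V' u (x s)" if u: "u \<in> ?V'" for u
    proof (cases "u = v'")
      case True
      then show ?thesis unfolding x_def bary_convex_comb using bv' B.bary_vertex[OF v(2,2)] s by simp
    next
      case False
      then have "u \<in> ?V - {v}" using U u by blast
      then show ?thesis unfolding x_def bary_convex_comb
        using b'[of u] b(2)[of u] B.bary_vertex[OF u v(2)] s by simp
    qed
    then show ?thesis using B.simplex_iff by blast
  qed
  then have "x s \<in> T'" using hull[OF T(2)] by simp
  from open_simplex_unique[OF T(1,2) inT this] T(3) show False by simp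
qed

text \<open>A small step from x away from v leaves T but not X, so another simplex is met, and it
  still contains x if the step is small. Its intersection with T is a face containing x, hence all
  vertices of the facet, but it is not T.\<close>

lemma neighbour_exists:
  assumes T: "T \<in> \<T>" and v: "v \<in> vertices_of T"
    and x: "x \<in> convex hull (vertices_of T - {v})" "\<And>u. u \<in> vertices_of T - {v} \<Longrightarrow> 0 < bary (vertices_of T) u x"
    and X: "open X" "x \<in> X" "X \<subseteq> \<Union>\<T>"
  obtains T' v' where "T' \<in> \<T>" "T' \<noteq> T" "v' \<in> vertices_of T'" "vertices_of T' - {v'} = vertices_of T - {v}"
proof -
  let ?V = "vertices_of T"
  interpret A: full_simplex ?V using full[OF T] .
  have closedT: "closed T'" if "T' \<in> \<T>" for T'
    using full_simplex.compact_face[OF full[OF that] order_refl] hull[OF that] by (simp add: compact_imp_closed)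
  \<comment> \<open>The simplices that miss x form a closed set, so a ball around x avoids
    them.\<close>
  define C where "C = \<Union>{T' \<in> \<T>. x \<notin> T'}"
  have "closed C" unfolding C_def using finite_mesh closedT by (intro closed_Union) auto
  then have "open (X - C)" using X(1) by (rule open_Diff[rotated])
  moreover have "x \<in> X - C" using X(2) by (auto simp: C_def)
  ultimately obtain e where e: "e > 0" "ball x e \<subseteq> X - C" using open_contains_ball by blast
  \<comment> \<open>Chosen so that the step s (x - v) is shorter than e; the summand 1 keeps the
    denominator positive.\<close>
  define s where "s = e / (2 * (norm (x - v) + 1))"
  have s: "s > 0" using e(1) by (simp add: s_def add_nonneg_pos)
  define y where "y = x + s *\<^sub>R (x - v)"
  have "norm (s *\<^sub>R (x - v)) < e"
  proof -
    have "norm (s *\<^sub>R (x - v)) = s * norm (x - v)" using s by simp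
    also have "\<dots> < s * (2 * (norm (x - v) + 1))" using s by (intro mult_strict_left_mono) (auto intro: add_nonneg_pos)
    also have "\<dots> = e"
    proof -
      have "2 * (norm (x - v) + 1) > 0" by (simp add: add_nonneg_pos)
      then show ?thesis unfolding s_def by simp
    qed
    finally show ?thesis .
  qed
  then have "y \<in> ball x e" by (simp add: y_def dist_norm norm_minus_commute)
  then have y: "y \<in> X" "y \<notin> C" using e(2) by auto
  then obtain T' where T': "T' \<in> \<T>" "y \<in> T'" using X(3) by auto
  have xT': "x \<in> T'" using T' y(2) by (auto simp: C_def)
  have bx: "bary ?V v x = 0" using x(1) v A.convex_hull_iff[of "?V - {v}"] by auto
  have "bary_grad ?V v \<bullet> (x - v) = -1" using bx A.bary_vertex[OF v v] bary_diff[of ?V v x v] by simp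
  then have "bary ?V v y = - s" unfolding y_def bary_add using bx by simp
  then have "y \<notin> T" using A.simplex_iff[of y] hull[OF T] v s by force
  then have ne: "T' \<noteq> T" using T'(2) by auto
  obtain W where W: "W \<subseteq> ?V" "T \<inter> T' = convex hull W" by (rule inter_hull[OF T T'(1)])
  have "x \<in> T" using A.convex_hull_iff[of "?V - {v}"] A.simplex_iff[of x] x(1) hull[OF T] by auto
  then have "x \<in> convex hull W" using xT' W(2) by auto
  then have "\<forall>u\<in>?V - W. bary ?V u x = 0" using A.convex_hull_iff[OF W(1)] by blast
  then have sub: "?V - {v} \<subseteq> W" using x(2) by force
  have "W \<noteq> ?V"
  proof
    assume "W = ?V"
    then have "T \<subseteq> T'" using W(2) hull[OF T] by auto
    then show False using inter_sub_eq[OF T T'(1)] ne by simp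
  qed
  then have WU: "W = ?V - {v}" using sub W(1) by blast
  obtain W' where W': "W' \<subseteq> vertices_of T'" "T' \<inter> T = convex hull W'" by (rule inter_hull[OF T'(1) T])
  have "W = W'" by (rule hull_inj[OF T T'(1) W(1) W'(1)]) (use W(2) W'(2) in auto)
  interpret B: full_simplex "vertices_of T'" using full[OF T'(1)] .
  have "card W' = CARD('n)"
    unfolding \<open>W = W'\<close>[symmetric] WU using v A.card_vertices by (simp add: card_Diff_singleton)
  then have "card (vertices_of T' - W') = 1"
    using B.card_vertices W'(1) by (simp add: card_Diff_subset B.finite_subset_vertices)
  then obtain v' where "vertices_of T' - W' = {v'}" by (auto simp: card_1_singleton_iff)
  then have "v' \<in> vertices_of T'" "vertices_of T' - {v'} = ?V - {v}" using W'(1) \<open>W = W'\<close> WU by auto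
  then show ?thesis using that T'(1) ne by blast
qed

text \<open>\<open>P\<close> lists every facet together with the simplex on one side of it, and
  \<open>R\<close> links it to the same facet seen from the other side. Linked terms cancel. On a
  facet without partner the field vanishes, since points of X in its relative interior would have a
  neighbour across it.\<close>

lemma sum_dvg_zero:
  fixes u :: "(real^'n) set \<Rightarrow> real^'n \<Rightarrow> real^'n"
  assumes u: "\<And>T. T \<in> \<T> \<Longrightarrow> C1_field (u T)" and K: "compact K" "\<And>T x. x \<notin> K \<Longrightarrow> u T x = 0"
    and X: "open X" "K \<subseteq> X" "X \<subseteq> \<Union>\<T>"
    and jump: "\<And>T T' v v' x. T \<in> \<T> \<Longrightarrow> T' \<in> \<T> \<Longrightarrow> T' \<noteq> T \<Longrightarrow> v \<in> vertices_of T \<Longrightarrow> v' \<in> vertices_of T' \<Longrightarrow>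
      vertices_of T' - {v'} = vertices_of T - {v} \<Longrightarrow> x \<in> convex hull (vertices_of T - {v}) \<Longrightarrow>
      bary_grad (vertices_of T) v \<bullet> u T x = bary_grad (vertices_of T) v \<bullet> u T' x"
  shows "(\<Sum>T\<in>\<T>. LINT x:open_simplex (vertices_of T)|lborel. dvg (u T) x) = 0"
proof -
  define P where "P = Sigma \<T> vertices_of"
  define a where "a = (\<lambda>(T, v). LINT x:open_simplex (vertices_of T)|lborel.
    dvg (\<lambda>x. (bary_grad (vertices_of T) v \<bullet> u T x) *\<^sub>R (x - v)) x)"
  define R where "R z z' \<longleftrightarrow> z' \<in> P \<and> fst z' \<noteq> fst z \<and> vertices_of (fst z') - {snd z'} = vertices_of (fst z) - {snd z}" for z z'
  have uniq: "z1 = z2" if z: "z \<in> P" and R: "R z z1" "R z z2" for z z1 z2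
  proof -
    obtain T v T1 v1 T2 v2 where eq: "z = (T, v)" "z1 = (T1, v1)" "z2 = (T2, v2)" by (cases z; cases z1; cases z2)
    have T: "T \<in> \<T>" "T1 \<in> \<T>" "T2 \<in> \<T>" "T1 \<noteq> T" "T2 \<noteq> T" and v: "v \<in> vertices_of T" "v1 \<in> vertices_of T1" "v2 \<in> vertices_of T2"
      and U: "vertices_of T1 - {v1} = vertices_of T - {v}" "vertices_of T2 - {v2} = vertices_of T - {v}"
      using z R by (auto simp: eq P_def R_def)
    have "T1 = T2"
    proof (rule ccontr)
      assume "T1 \<noteq> T2"
      \<comment> \<open>Three simplices at one facet are impossible: T1 and T2 both lie opposite to
        T, thus on the same side, yet they would also lie opposite to each other.\<close>
      then have "bary (vertices_of T1) v1 v2 < 0"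
        using opposite_sides[OF T(2,3) _ v(2,3)] U by auto
      moreover have "bary (vertices_of T) v v1 < 0" "bary (vertices_of T) v v2 < 0"
        using opposite_sides[OF T(1,2,4) v(1,2) U(1)] opposite_sides[OF T(1,3,5) v(1,3) U(2)] .
      moreover have "bary (vertices_of T) v v2 = bary (vertices_of T1) v1 v2 * bary (vertices_of T) v v1"
        by (rule bary_change_apex[OF full[OF T(1)] full[OF T(2)] v(1,2) U(1)])
      ultimately show False by (metis mult_neg_neg not_less_iff_gr_or_eq)
    qed
    moreover have "v1 = v2" using U v \<open>T1 = T2\<close> by blast
    ultimately show ?thesis by (simp add: eq)
  qed
  have Rsym: "R z' z" if "z \<in> P" "R z z'" for z z' using that by (auto simp: R_def)
  have cancel: "a z + a z' = 0" if z: "z \<in> P" and R: "R z z'" for z z'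
  proof -
    obtain T v T' v' where eq: "z = (T, v)" "z' = (T', v')" by (cases z; cases z')
    have T: "T \<in> \<T>" "T' \<in> \<T>" "T' \<noteq> T" and v: "v \<in> vertices_of T" "v' \<in> vertices_of T'"
      and U: "vertices_of T' - {v'} = vertices_of T - {v}"
      using z R by (auto simp: eq P_def R_def)
    let ?V = "vertices_of T" and ?V' = "vertices_of T'"
    note opp = opposite_sides[OF T v U]
    \<comment> \<open>Proportional coordinates have proportional gradients, which converts the jump
      condition into the scaling needed for the cancellation.\<close>
    have grads: "bary_grad ?V v = bary ?V v v' *\<^sub>R bary_grad ?V' v'"
    proof -
      have c: "bary ?V v x = bary ?V' v' x * bary ?V v v'" for x
        by (rule bary_change_apex[OF full[OF T(1)] full[OF T(2)] v U])
      have "bary_grad ?V v \<bullet> y = (bary ?V v v' *\<^sub>R bary_grad ?V' v') \<bullet> y" for y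
      proof -
        have "bary_grad ?V v \<bullet> (y - 0) = bary ?V v y - bary ?V v 0" by (simp only: bary_diff)
        also have "\<dots> = (bary ?V' v' y - bary ?V' v' 0) * bary ?V v v'"
          using c[of y] c[of 0] by (simp only: left_diff_distrib)
        also have "\<dots> = (bary_grad ?V' v' \<bullet> (y - 0)) * bary ?V v v'" by (simp only: bary_diff)
        finally show ?thesis by simp
      qed
      then show ?thesis by (metis vector_eq_rdot)
    qed
    have "(LINT x:open_simplex ?V|lborel. dvg (\<lambda>x. (bary_grad ?V v \<bullet> u T x) *\<^sub>R (x - v)) x) +
      (LINT x:open_simplex ?V'|lborel. dvg (\<lambda>x. (bary_grad ?V' v' \<bullet> u T' x) *\<^sub>R (x - v')) x) = 0"
    proof (rule common_facet_cancel[OF full[OF T(1)] full[OF T(2)] v U opp _ K(1) _ _ K(1)])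
      show "C1 (\<lambda>x. bary_grad ?V v \<bullet> u T x)" "C1 (\<lambda>x. bary_grad ?V' v' \<bullet> u T' x)"
        by (intro C1_inner_field u T)+
      show "bary_grad ?V v \<bullet> u T x = 0" "bary_grad ?V' v' \<bullet> u T' x = 0" if "x \<notin> K" for x
        using K(2)[OF that] by simp_all
      show "bary_grad ?V v \<bullet> u T x = bary ?V v v' * (bary_grad ?V' v' \<bullet> u T' x)"
        if "x \<in> convex hull (?V - {v})" for x
        using jump[OF T v U that] grads by (metis inner_scaleR_left)
    qed
    then show ?thesis by (simp add: a_def eq)
  qed
  have alone: "a z = 0" if z: "z \<in> P" and R: "\<nexists>z'. R z z'" for z
  proof -
    obtain T v where eq: "z = (T, v)" by (cases z)
    have T: "T \<in> \<T>" and v: "v \<in> vertices_of T" using z by (auto simp: eq P_def)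
    let ?V = "vertices_of T"
    interpret A: full_simplex ?V using full[OF T] .
    have noR: False if "T' \<in> \<T>" "T' \<noteq> T" "v' \<in> vertices_of T'" "vertices_of T' - {v'} = ?V - {v}" for T' v'
      using R that by (auto simp: R_def eq P_def)
    have zero: "u T x = 0" if x: "x \<in> convex hull (?V - {v})" for x
    proof (rule A.zero_on_face_by_density[OF _ C1_field_continuous[OF u[OF T]] _ x])
      fix y assume y: "y \<in> convex hull (?V - {v})" "\<And>w. w \<in> ?V - {v} \<Longrightarrow> 0 < bary ?V w y"
      show "u T y = 0"
      proof (rule ccontr)
        assume "u T y \<noteq> 0"
        then have "y \<in> X" using K(2) X(2) by blast
        then show False using neighbour_exists[OF T v y X(1) _ X(3)] noR by metis
      qed
    qed auto
    have "(LINT x:open_simplex ?V|lborel. dvg (\<lambda>x. (bary_grad ?V v \<bullet> u T x) *\<^sub>R (x - v)) x) = 0"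
    proof (rule A.simplex_tangential[OF _ K(1)])
      show "C1_field (\<lambda>x. (bary_grad ?V v \<bullet> u T x) *\<^sub>R (x - v))"
        by (intro C1_field_scaleR C1_inner_field u T C1_field_position)
      show "(bary_grad ?V v \<bullet> u T x) *\<^sub>R (x - v) = 0" if "x \<notin> K" for x using K(2)[OF that] by simp
      fix w x assume w: "w \<in> ?V" and x: "x \<in> convex hull (?V - {w})"
      show "bary_grad ?V w \<bullet> ((bary_grad ?V v \<bullet> u T x) *\<^sub>R (x - v)) = 0"
      proof (cases "w = v")
        case True
        then show ?thesis using zero x by simp
      next
        case False
        have "bary ?V w x = 0" using x w A.convex_hull_iff[of "?V - {w}"] by auto
        moreover have "bary ?V w v = 0" using A.bary_vertex[OF w v] False by auto
        ultimately have "bary_grad ?V w \<bullet> (x - v) = 0" by (simp add: bary_diff[symmetric])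
        then show ?thesis by simp
      qed
    qed
    then show ?thesis by (simp add: a_def eq)
  qed
  \<comment> \<open>The partner if there is one, otherwise the pair itself. In the latter case the
    term is zero, hence equal to its negative, and \<sigma> is an involution on \<open>P\<close> in
    either case.\<close>
  define \<sigma> where "\<sigma> z = (if \<exists>z'. R z z' then SOME z'. R z z' else z)" for z
  have \<sigma>R: "R z (\<sigma> z)" if "\<exists>z'. R z z'" for z using someI_ex[OF that] that by (simp add: \<sigma>_def)
  have \<sigma>P: "\<sigma> z \<in> P" if "z \<in> P" for z
    using \<sigma>R[of z] that by (cases "\<exists>z'. R z z'") (auto simp: R_def \<sigma>_def)
  have \<sigma>\<sigma>: "\<sigma> (\<sigma> z) = z" if z: "z \<in> P" for z
  proof (cases "\<exists>z'. R z z'")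
    case True
    have 1: "R (\<sigma> z) z" by (rule Rsym[OF z \<sigma>R[OF True]])
    then have "R (\<sigma> z) (\<sigma> (\<sigma> z))" by (intro \<sigma>R) blast
    then show ?thesis using uniq[OF \<sigma>P[OF z]] 1 by blast
  next
    case False
    then have "\<sigma> z = z" by (simp add: \<sigma>_def)
    then show ?thesis by simp
  qed
  have neg: "- a (\<sigma> z) = a z" if z: "z \<in> P" for z
  proof (cases "\<exists>z'. R z z'")
    case True
    then show ?thesis using cancel[OF z \<sigma>R[OF True]] by simp
  next
    case False
    then have "\<sigma> z = z" by (simp add: \<sigma>_def)
    then show ?thesis using alone[OF z False] by simp
  qed
  \<comment> \<open>Reindexing by the involution shows that the sum equals its own negative.\<close>
  have "sum a P = (\<Sum>z\<in>P. - a z)"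
    by (rule sum.reindex_bij_witness[of P \<sigma> \<sigma>]) (fact \<sigma>\<sigma> \<sigma>P neg)+
  then have "sum a P = 0" by (simp add: sum_negf)
  moreover have "sum a P = (\<Sum>T\<in>\<T>. \<Sum>v\<in>vertices_of T. a (T, v))"
    unfolding P_def using finite_mesh full_simplex.finite_vertices[OF full] by (subst sum.Sigma) auto
  moreover have "(LINT x:open_simplex (vertices_of T)|lborel. dvg (u T) x) = - (\<Sum>v\<in>vertices_of T. a (T, v))" if "T \<in> \<T>" for T
    using full_simplex.vertex_fields_expand[OF full[OF that] u[OF that] K(1) K(2)] by (simp add: a_def)
  ultimately show ?thesis by (simp add: sum_negf)
qed

end


section \<open>Piecewise polynomial fields in H(div)\<close>

lemma conforming_mesh_simplicial:
  fixes \<T> :: "(real^'n) set set"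
  assumes "simplicial_mesh \<Omega> \<T>"
  shows "conforming_mesh \<T>"
proof -
  have tri: "triangulation \<T>" and full: "\<And>T. T \<in> \<T> \<Longrightarrow> int DIM(real^'n) simplex T"
    using assms by (auto simp: simplicial_mesh_def)
  have "full_simplex (vertices_of T) \<and> convex hull (vertices_of T) = T" if T: "T \<in> \<T>" for T
  proof -
    obtain V where V: "full_simplex V" "T = convex hull V" using full_simplexE[OF full[OF T]] by blast
    then have "vertices_of T = V" using vertices_of_hull full_simplex.affine_independent by blast
    then show ?thesis using V by simp
  qed
  then show ?thesis
    using tri by (simp add: conforming_mesh_def triangulation_def)
qed

lemma test_function_C1:
  fixes \<phi> :: "real^'n \<Rightarrow> real"
  assumes "test_function \<Omega> \<phi>"
  shows "C1 \<phi>"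
proof -
  have "Ck (Suc 0) \<phi>" using assms unfolding test_function_def by blast
  then have d: "\<phi> differentiable (at x)" and c: "continuous_on UNIV (\<lambda>x. frechet_derivative \<phi> (at x) v)" for x v
    by simp_all
  have "continuous_on UNIV (grad \<phi>)"
    unfolding grad_def[abs_def] by (intro continuous_on_vec_lambda c)
  then show ?thesis using d by (simp add: C1_def)
qed

lemma row_nth: "row i A = A $ i"
  by (simp add: row_def vec_eq_iff)

lemma C1_field_row:
  fixes B :: "real^'n \<Rightarrow> real^'n^'n"
  assumes "B \<in> polynomials k"
  shows "C1_field (\<lambda>x. row i (B x))"
proof -
  have "(\<lambda>x. B x $ i $ j) \<in> polynomials k" for j
    by (rule polynomials_linear_image[OF _ assms, of "\<lambda>M. M $ i $ j"]) (auto intro!: linearI)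
  then show ?thesis by (auto simp: C1_field_def row_nth intro: C1_polynomial)
qed

lemma integral_lebesgue_on_eq_lborel:
  fixes f :: "'a::euclidean_space \<Rightarrow> real"
  assumes "f \<in> borel_measurable borel" "open \<Omega>" "\<And>x. x \<notin> \<Omega> \<Longrightarrow> f x = 0"
  shows "(\<integral>x. f x \<partial>lebesgue_on \<Omega>) = (\<integral>x. f x \<partial>lborel)"
proof -
  have "(\<integral>x. f x \<partial>lebesgue_on \<Omega>) = (\<integral>x. indicator \<Omega> x *\<^sub>R f x \<partial>lebesgue)"
    using assms(2) by (intro integral_restrict_space) auto
  also have "(\<lambda>x. indicator \<Omega> x *\<^sub>R f x) = f" using assms(3) by (auto simp: indicator_def fun_eq_iff)
  finally show ?thesis using assms(1) by (simp add: integral_completion)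
qed

section \<open>Functions glued from the simplices of a mesh\<close>

context conforming_mesh
begin

text \<open>The value is taken from the simplex whose interior contains x and is zero on the
  skeleton, a null set. A sum of indicators is measurable without choosing a simplex for each
  point.\<close>

definition mesh_sum :: "((real^'n) set \<Rightarrow> real^'n \<Rightarrow> 'b::real_vector) \<Rightarrow> real^'n \<Rightarrow> 'b" where
  "mesh_sum h x = (\<Sum>T\<in>\<T>. indicat_real (open_simplex (vertices_of T)) x *\<^sub>R h T x)"

lemma mesh_sum_eq:
  assumes "T \<in> \<T>" "x \<in> open_simplex (vertices_of T)"
  shows "mesh_sum h x = h T x"
proof -
  have uniq: "T' = T" if "T' \<in> \<T>" "x \<in> open_simplex (vertices_of T')" for T'
  proof -
    have "x \<in> T" using full_simplex.open_simplex_subset[OF full[OF assms(1)]] hull[OF assms(1)] assms(2) by auto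
    then show ?thesis using open_simplex_unique[OF that(1) assms(1) that(2)] by simp
  qed
  have "mesh_sum h x = (\<Sum>T'\<in>\<T>. if T' = T then h T x else 0)"
    unfolding mesh_sum_def
  proof (rule sum.cong[OF refl])
    fix T' assume T': "T' \<in> \<T>"
    show "indicat_real (open_simplex (vertices_of T')) x *\<^sub>R h T' x = (if T' = T then h T x else 0)"
    proof (cases "T' = T")
      case True
      then show ?thesis using assms(2) by simp
    next
      case False
      then have "x \<notin> open_simplex (vertices_of T')" using uniq[OF T'] by blast
      then show ?thesis using False by simp
    qed
  qed
  then show ?thesis using finite_mesh assms(1) by simp
qed

lemma open_simplex_borel: "T \<in> \<T> \<Longrightarrow> open_simplex (vertices_of T) \<in> sets borel"
  using full_simplex.open_open_simplex[OF full] by simp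

lemma mesh_sum_measurable:
  fixes h :: "(real^'n) set \<Rightarrow> real^'n \<Rightarrow> 'b::euclidean_space"
  assumes "\<And>T. T \<in> \<T> \<Longrightarrow> continuous_on UNIV (h T)"
  shows "mesh_sum h \<in> borel_measurable borel"
  unfolding mesh_sum_def[abs_def]
  using open_simplex_borel borel_measurable_continuous_onI[OF assms]
  by (intro borel_measurable_sum borel_measurable_scaleR borel_measurable_indicator) auto

lemma integral_mesh_sum:
  fixes h :: "(real^'n) set \<Rightarrow> real^'n \<Rightarrow> real"
  assumes "\<And>T. T \<in> \<T> \<Longrightarrow> continuous_on UNIV (h T)" "compact K" "\<And>T x. x \<notin> K \<Longrightarrow> h T x = 0"
  shows "(\<integral>x. mesh_sum h x \<partial>lborel) = (\<Sum>T\<in>\<T>. LINT x:open_simplex (vertices_of T)|lborel. h T x)"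
  unfolding mesh_sum_def set_lebesgue_integral_def
  using integrable_compact_support[OF assms(2,3,1)] open_simplex_borel
  by (intro Bochner_Integration.integral_sum integrable_mult_indicator) auto

lemma mesh_sum_bounded:
  fixes h :: "(real^'n) set \<Rightarrow> real^'n \<Rightarrow> 'b::real_normed_vector"
  assumes "\<And>T. T \<in> \<T> \<Longrightarrow> continuous_on UNIV (h T)"
  obtains M where "\<And>x. norm (mesh_sum h x) \<le> M"
proof -
  have "\<exists>M\<ge>0. \<forall>x\<in>T. norm (h T x) \<le> M" if T: "T \<in> \<T>" for T
  proof -
    have "compact T" using full_simplex.compact_face[OF full[OF T] order_refl] hull[OF T] by simp
    then have "bounded (h T ` T)"
      using continuous_on_subset[OF assms[OF T]] by (intro compact_imp_bounded compact_continuous_image) auto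
    then obtain M where "\<And>x. x \<in> T \<Longrightarrow> norm (h T x) \<le> M" by (auto simp: bounded_iff)
    then show ?thesis by (intro exI[of _ "max M 0"]) (auto simp: le_max_iff_disj)
  qed
  then have "\<forall>T\<in>\<T>. \<exists>M. M \<ge> 0 \<and> (\<forall>x\<in>T. norm (h T x) \<le> M)" by blast
  from bchoice[OF this] obtain M where M: "\<forall>T\<in>\<T>. M T \<ge> 0 \<and> (\<forall>x\<in>T. norm (h T x) \<le> M T)" by blast
  have "norm (mesh_sum h x) \<le> sum M \<T>" for x
    unfolding mesh_sum_def
  proof (rule order_trans[OF norm_sum], rule sum_mono)
    fix T assume T: "T \<in> \<T>"
    show "norm (indicat_real (open_simplex (vertices_of T)) x *\<^sub>R h T x) \<le> M T"
    proof (cases "x \<in> open_simplex (vertices_of T)")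
      case True
      then have "x \<in> T" using full_simplex.open_simplex_subset[OF full[OF T]] hull[OF T] by auto
      then show ?thesis using M T True by simp
    next
      case False
      then show ?thesis using M T by simp
    qed
  qed
  then show ?thesis using that by blast
qed

text \<open>A point of T outside its open simplex has a vanishing coordinate, hence lies on one of
  finitely many hyperplanes.\<close>

lemma AE_in_open_simplex: "AE x in lebesgue. x \<in> \<Union>\<T> \<longrightarrow> (\<exists>T\<in>\<T>. x \<in> open_simplex (vertices_of T))"
proof -
  define N where "N = (\<Union>T\<in>\<T>. \<Union>v\<in>vertices_of T. {x. bary_grad (vertices_of T) v \<bullet> x = - snd (bary_pair (vertices_of T) v)})"
  have "negligible N"
    unfolding N_def
    using finite_mesh full_simplex.finite_vertices[OF full] full_simplex.bary_grad_nonzero[OF full]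
    by (intro negligible_Union finite_imageI) (auto intro!: negligible_Union finite_imageI negligible_hyperplane)
  then have "AE x in lebesgue. x \<notin> N" by (intro AE_not_in) (simp add: negligible_iff_null_sets)
  then show ?thesis
  proof eventually_elim
    case (elim x)
    show ?case
    proof
      assume "x \<in> \<Union>\<T>"
      then obtain T where T: "T \<in> \<T>" "x \<in> T" by auto
      interpret A: full_simplex "vertices_of T" using full[OF T(1)] .
      have "0 < bary (vertices_of T) v x" if v: "v \<in> vertices_of T" for v
      proof -
        have "0 \<le> bary (vertices_of T) v x" using A.simplex_iff T v hull[OF T(1)] by auto
        moreover have "bary (vertices_of T) v x \<noteq> 0" using elim T(1) v by (auto simp: N_def bary_def eq_neg_iff_add_eq_0)
        ultimately show ?thesis by simp
      qed
      then show "\<exists>T\<in>\<T>. x \<in> open_simplex (vertices_of T)" using T(1) by (auto simp: open_simplex_def)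
    qed
  qed
qed

text \<open>The weak divergence is the piecewise one, \<open>g\<close>. By the product rule its
  defining identity says that the integrals of div(\<phi> A_i) over the simplices sum to zero. This
  holds because \<phi> vanishes outside a compact subset of \<Omega> and the normal components agree
  on common facets.\<close>

lemma piecewise_polynomial_H_div:
  fixes B :: "(real^'n) set \<Rightarrow> real^'n \<Rightarrow> real^'n^'n"
  assumes A: "A \<in> L2_sym \<Omega>" and \<Omega>: "open \<Omega>" "bounded \<Omega>" "\<Omega> \<subseteq> \<Union>\<T>"
    and B: "\<And>T. T \<in> \<T> \<Longrightarrow> B T \<in> polynomials k"
    and AB: "\<And>T. T \<in> \<T> \<Longrightarrow> AE x in lebesgue_on (T \<inter> \<Omega>). A x = B T x"
    and jump: "\<And>T T' v v' x. T \<in> \<T> \<Longrightarrow> T' \<in> \<T> \<Longrightarrow> T' \<noteq> T \<Longrightarrow> v \<in> vertices_of T \<Longrightarrow> v' \<in> vertices_of T' \<Longrightarrow>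
      vertices_of T' - {v'} = vertices_of T - {v} \<Longrightarrow> x \<in> convex hull (vertices_of T - {v}) \<Longrightarrow>
      B T x *v bary_grad (vertices_of T) v = B T' x *v bary_grad (vertices_of T) v"
  shows "A \<in> H_div_sym \<Omega>"
proof -
  define d where "d T x = (\<chi> i. dvg (\<lambda>x. row i (B T x)) x)" for T x
  define g where "g = mesh_sum d"
  note Bf = C1_field_row[OF B]
  have cd: "continuous_on UNIV (d T)" if "T \<in> \<T>" for T
    unfolding d_def[abs_def] by (intro continuous_on_vec_lambda continuous_on_dvg Bf that)
  have gm: "g \<in> borel_measurable borel" unfolding g_def by (rule mesh_sum_measurable[OF cd])
  have g_i: "g x $ i = mesh_sum (\<lambda>T. dvg (\<lambda>x. row i (B T x))) x" for x i
    by (simp add: g_def mesh_sum_def d_def)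
  obtain M where M: "\<And>x. norm (g x) \<le> M" unfolding g_def by (rule mesh_sum_bounded[OF cd]) blast+
  have gml: "g \<in> borel_measurable (lebesgue_on \<Omega>)"
    using gm \<Omega>(1) by (intro measurable_restrict_space1 measurable_completion) auto
  have g2: "g \<in> L2_on \<Omega>"
  proof -
    have "integrable (lebesgue_on \<Omega>) (\<lambda>x. (norm (g x))\<^sup>2)"
    proof (rule Bochner_Integration.integrable_bound)
      have "\<Omega> \<in> lmeasurable" using \<Omega> by (simp add: lmeasurable_open)
      then show "integrable (lebesgue_on \<Omega>) (\<lambda>x. M\<^sup>2)"
        by (intro finite_measure.integrable_const finite_measure_lebesgue_on)
      show "(\<lambda>x. (norm (g x))\<^sup>2) \<in> borel_measurable (lebesgue_on \<Omega>)" using gml by measurable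
      show "AE x in lebesgue_on \<Omega>. norm ((norm (g x))\<^sup>2) \<le> norm (M\<^sup>2)"
        using M by (intro AE_I2) (simp add: power_mono)
    qed
    then show ?thesis using gml by (simp add: L2_on_def)
  qed
  have AEA: "AE x in lebesgue_on \<Omega>. \<exists>T\<in>\<T>. x \<in> open_simplex (vertices_of T) \<and> A x = B T x"
  proof -
    have Ts: "T \<inter> \<Omega> \<in> sets lebesgue" if "T \<in> \<T>" for T
    proof -
      have "compact T" using full_simplex.compact_face[OF full[OF that] order_refl] hull[OF that] by simp
      then show ?thesis using \<Omega>(1) by (intro sets.Int) (auto simp: compact_imp_closed)
    qed
    have "AE x in lebesgue. x \<in> T \<inter> \<Omega> \<longrightarrow> A x = B T x" if "T \<in> \<T>" for T
      using AB[OF that] Ts[OF that] by (simp add: AE_restrict_space_iff)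
    then have "AE x in lebesgue. \<forall>T\<in>\<T>. x \<in> T \<inter> \<Omega> \<longrightarrow> A x = B T x"
      using finite_mesh by (simp add: AE_ball_countable countable_finite)
    then have "AE x in lebesgue. x \<in> \<Omega> \<longrightarrow> (\<exists>T\<in>\<T>. x \<in> open_simplex (vertices_of T) \<and> A x = B T x)"
      using AE_in_open_simplex
    proof eventually_elim
      case (elim x)
      show ?case
      proof
        assume x: "x \<in> \<Omega>"
        then obtain T where T: "T \<in> \<T>" "x \<in> open_simplex (vertices_of T)" using elim(2) \<Omega>(3) by blast
        then have "x \<in> T" using full_simplex.open_simplex_subset[OF full[OF T(1)]] hull[OF T(1)] by auto
        then show "\<exists>T\<in>\<T>. x \<in> open_simplex (vertices_of T) \<and> A x = B T x" using elim(1) T x by auto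
      qed
    qed
    then show ?thesis using \<Omega>(1) by (simp add: AE_restrict_space_iff)
  qed
  have Am: "A \<in> borel_measurable (lebesgue_on \<Omega>)" using A by (simp add: L2_sym_def L2_on_def)
  have "weak_row_div \<Omega> A g"
    unfolding weak_row_div_def
  proof (intro allI impI)
    fix \<phi> i assume \<phi>: "test_function \<Omega> \<phi>"
    obtain K where K: "compact K" "K \<subseteq> \<Omega>" "\<And>x. x \<notin> K \<Longrightarrow> \<phi> x = 0"
      using \<phi> by (auto simp: test_function_def)
    have C: "C1 \<phi>" by (rule test_function_C1[OF \<phi>])
    have fr: "frechet_derivative \<phi> (at x) h = grad \<phi> x \<bullet> h" for x h
      by (rule frechet_derivative_grad) (use C in \<open>simp add: C1_def\<close>)
    have grad0: "grad \<phi> x = 0" if "x \<notin> K" for x by (rule grad_zero_outside[OF K(1,3) that])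
    define u where "u T x = (if T \<in> \<T> then \<phi> x *\<^sub>R row i (B T x) else 0)" for T x
    have u: "u T = (\<lambda>x. \<phi> x *\<^sub>R row i (B T x))" if "T \<in> \<T>" for T using that by (auto simp: u_def)
    define h1 where "h1 T x = grad \<phi> x \<bullet> row i (B T x)" for T x
    define h2 where "h2 T x = \<phi> x * dvg (\<lambda>x. row i (B T x)) x" for T x
    have ch1: "continuous_on UNIV (h1 T)" if "T \<in> \<T>" for T
      unfolding h1_def[abs_def] by (intro continuous_on_inner C1_continuous_grad C C1_field_continuous Bf that)
    have ch2: "continuous_on UNIV (h2 T)" if "T \<in> \<T>" for T
      unfolding h2_def[abs_def] by (intro continuous_on_mult continuous_on_dvg C1_continuous C Bf that)
    have h10: "h1 T x = 0" if "x \<notin> K" for T x using grad0[OF that] by (simp add: h1_def)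
    have h20: "h2 T x = 0" if "x \<notin> K" for T x using K(3)[OF that] by (simp add: h2_def)
    have out: "mesh_sum h1 x = 0" "mesh_sum h2 x = 0" if "x \<notin> \<Omega>" for x
    proof -
      have "x \<notin> K" using that K(2) by blast
      then show "mesh_sum h1 x = 0" "mesh_sum h2 x = 0" by (simp_all add: mesh_sum_def h10 h20)
    qed
    have "(\<integral>x. frechet_derivative \<phi> (at x) (row i (A x)) \<partial>lebesgue_on \<Omega>) = (\<integral>x. mesh_sum h1 x \<partial>lebesgue_on \<Omega>)"
      unfolding fr
    proof (rule integral_cong_AE)
      have "grad \<phi> \<in> borel_measurable (lebesgue_on \<Omega>)"
        using borel_measurable_continuous_onI[OF C1_continuous_grad[OF C]]
        by (intro measurable_restrict_space1 measurable_completion) auto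
      moreover have "(\<lambda>x. row i (A x)) \<in> borel_measurable (lebesgue_on \<Omega>)"
        unfolding row_nth
        by (rule measurable_compose[OF Am borel_measurable_continuous_onI[OF continuous_on_component[OF continuous_on_id]]])
      ultimately show "(\<lambda>x. grad \<phi> x \<bullet> row i (A x)) \<in> borel_measurable (lebesgue_on \<Omega>)"
        by (rule borel_measurable_inner)
      show "mesh_sum h1 \<in> borel_measurable (lebesgue_on \<Omega>)"
        using mesh_sum_measurable[OF ch1] by (intro measurable_restrict_space1 measurable_completion) auto
      show "AE x in lebesgue_on \<Omega>. grad \<phi> x \<bullet> row i (A x) = mesh_sum h1 x"
        using AEA
      proof eventually_elim
        case (elim x)
        then obtain T where T: "T \<in> \<T>" "x \<in> open_simplex (vertices_of T)" "A x = B T x" by blast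
        then show ?case using mesh_sum_eq[OF T(1,2), of h1] by (simp add: h1_def)
      qed
    qed
    also have "\<dots> = (\<integral>x. mesh_sum h1 x \<partial>lborel)"
      by (rule integral_lebesgue_on_eq_lborel[OF mesh_sum_measurable[OF ch1] \<Omega>(1) out(1)])
    also have "\<dots> = (\<Sum>T\<in>\<T>. LINT x:open_simplex (vertices_of T)|lborel. h1 T x)"
      by (rule integral_mesh_sum[OF ch1 K(1) h10])
    finally have 1: "(\<integral>x. frechet_derivative \<phi> (at x) (row i (A x)) \<partial>lebesgue_on \<Omega>) =
      (\<Sum>T\<in>\<T>. LINT x:open_simplex (vertices_of T)|lborel. h1 T x)" .
    have "(\<lambda>x. (g x $ i) * \<phi> x) = mesh_sum h2"
      by (simp add: g_i mesh_sum_def h2_def fun_eq_iff sum_distrib_left mult_ac)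
    then have "(\<integral>x. (g x $ i) * \<phi> x \<partial>lebesgue_on \<Omega>) = (\<integral>x. mesh_sum h2 x \<partial>lebesgue_on \<Omega>)" by simp
    also have "\<dots> = (\<integral>x. mesh_sum h2 x \<partial>lborel)"
      by (rule integral_lebesgue_on_eq_lborel[OF mesh_sum_measurable[OF ch2] \<Omega>(1) out(2)])
    also have "\<dots> = (\<Sum>T\<in>\<T>. LINT x:open_simplex (vertices_of T)|lborel. h2 T x)"
      by (rule integral_mesh_sum[OF ch2 K(1) h20])
    finally have 2: "(\<integral>x. (g x $ i) * \<phi> x \<partial>lebesgue_on \<Omega>) =
      (\<Sum>T\<in>\<T>. LINT x:open_simplex (vertices_of T)|lborel. h2 T x)" .
    have uf: "C1_field (u T)" if "T \<in> \<T>" for T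
      unfolding u[OF that] by (rule C1_field_scaleR(1)[OF C Bf[OF that]])
    have u0: "u T x = 0" if "x \<notin> K" for T x using K(3)[OF that] by (simp add: u_def)
    have "(\<Sum>T\<in>\<T>. LINT x:open_simplex (vertices_of T)|lborel. dvg (u T) x) = 0"
    proof (rule sum_dvg_zero[OF uf K(1) u0 \<Omega>(1) K(2) \<Omega>(3)])
      fix T T' v v' x
      assume *: "T \<in> \<T>" "T' \<in> \<T>" "T' \<noteq> T" "v \<in> vertices_of T" "v' \<in> vertices_of T'"
        "vertices_of T' - {v'} = vertices_of T - {v}" "x \<in> convex hull (vertices_of T - {v})"
      \<comment> \<open>The normal component of the i-th row is the i-th entry of the matrix times
        the gradient; here the row-wise divergence meets the continuity of A n.\<close>
      have "bary_grad (vertices_of T) v \<bullet> row i M = (M *v bary_grad (vertices_of T) v) $ i" for M :: "real^'n^'n"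
        by (simp add: row_nth matrix_vector_mul_component inner_commute)
      then show "bary_grad (vertices_of T) v \<bullet> u T x = bary_grad (vertices_of T) v \<bullet> u T' x"
        using jump[OF *] * by (simp add: u)
    qed
    moreover have "(LINT x:open_simplex (vertices_of T)|lborel. dvg (u T) x) =
      (LINT x:open_simplex (vertices_of T)|lborel. h2 T x) + (LINT x:open_simplex (vertices_of T)|lborel. h1 T x)"
      if T: "T \<in> \<T>" for T
    proof -
      have "dvg (u T) = (\<lambda>x. h2 T x + h1 T x)"
        unfolding u[OF T] C1_field_scaleR(2)[OF C Bf[OF T]] by (simp add: h1_def h2_def)
      moreover have "set_integrable lborel (open_simplex (vertices_of T)) (h1 T)"
        "set_integrable lborel (open_simplex (vertices_of T)) (h2 T)"
        unfolding set_integrable_def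
        by (rule integrable_mult_indicator; simp add: open_simplex_borel[OF T]
          integrable_compact_support[OF K(1) h10 ch1[OF T]] integrable_compact_support[OF K(1) h20 ch2[OF T]])+
      ultimately show ?thesis using set_integral_add(2) by metis
    qed
    ultimately show "(\<integral>x. frechet_derivative \<phi> (at x) (row i (A x)) \<partial>lebesgue_on \<Omega>)
          = - (\<integral>x. (g x $ i) * \<phi> x \<partial>lebesgue_on \<Omega>)"
      unfolding 1 2 by (simp add: sum.distrib)
  qed
  then show ?thesis using A g2 by (auto simp: H_div_sym_def)
qed

end

section \<open>From single-valued degrees of freedom to a continuous normal component\<close>

theorem theorem4p9:
  fixes \<Omega> :: "(real^'n) set"
    and \<T> :: "(real^'n) set set"
    and m r :: nat
    and t \<nu> :: "(real^'n) set \<Rightarrow> nat \<Rightarrow> real^'n"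
    and \<nu>F :: "(real^'n) set \<Rightarrow> real^'n"
  assumes "CARD('n) \<ge> 2" and "m \<le> CARD('n) - 2" and "r \<ge> 1"
    and "bounded_domain \<Omega>" and "simplicial_mesh \<Omega> \<T>"
    and "\<And>l f. f \<in> mesh_subsimplices l \<T> \<Longrightarrow> tn_basis l f (t f) (\<nu> f)"
    and "\<And>F. F \<in> mesh_subsimplices (CARD('n) - 1) \<T> \<Longrightarrow> unit_normal F (\<nu>F F)"
  shows "(\<forall>T\<in>\<T>. unisolvent r m t \<nu> \<nu>F T) \<and>
         fe_space \<Omega> \<T> r m t \<nu> \<nu>F \<subseteq> H_div_sym \<Omega>"
proof
  interpret M: conforming_mesh \<T> by (rule conforming_mesh_simplicial[OF assms(5)])
  have sub_mesh: "f \<in> mesh_subsimplices l \<T>" if "T \<in> \<T>" "f \<in> subsimplices l T" for T f l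
    using that by (auto simp: mesh_subsimplices_def)
  show "\<forall>T\<in>\<T>. unisolvent r m t \<nu> \<nu>F T"
  proof
    fix T assume T: "T \<in> \<T>"
    have "unisolvent r m t \<nu> \<nu>F (convex hull (vertices_of T))"
      by (rule full_simplex.unisolvent_simplex[OF M.full[OF T] assms(1-3)])
        (simp_all only: M.hull[OF T], intro assms(6,7) sub_mesh[OF T], assumption,
          intro assms(6,7) sub_mesh[OF T], assumption)
    then show "unisolvent r m t \<nu> \<nu>F T" using M.hull[OF T] by simp
  qed
  show "fe_space \<Omega> \<T> r m t \<nu> \<nu>F \<subseteq> H_div_sym \<Omega>"
  proof
    fix A assume "A \<in> fe_space \<Omega> \<T> r m t \<nu> \<nu>F"
    then obtain p where A: "A \<in> L2_sym \<Omega>"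
      and p: "\<forall>T\<in>\<T>. p T \<in> sym_polys_on (int r) T \<and> (AE x in lebesgue_on (T \<inter> \<Omega>). A x = p T x)"
      and sv_a: "\<forall>v. {v} \<in> mesh_subsimplices 0 \<T> \<longrightarrow> single_valued_across \<T> p {v} (\<lambda>B. B v)"
      and sv_b: "\<forall>l\<in>{1..CARD('n) - 1}. \<forall>f\<in>mesh_subsimplices l \<T>.
        \<forall>i\<in>{1..CARD('n) - l}. \<forall>j\<in>{i..CARD('n) - l}. \<forall>q\<in>polys_on (int r - (int l + 1)) f.
          single_valued_across \<T> p f (moment f (\<nu> f i) (\<nu> f j) q)"
      and sv_c: "\<forall>l\<in>{1..m}. \<forall>f\<in>mesh_subsimplices l \<T>.
        \<forall>i\<in>{1..l}. \<forall>j\<in>{1..CARD('n) - l}. \<forall>q\<in>polys_on (int r - (int l + 1)) f.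
          single_valued_across \<T> p f (moment f (t f i) (\<nu> f j) q)"
      and sv_d: "\<forall>F\<in>mesh_subsimplices (CARD('n) - 1) \<T>.
        \<forall>l\<in>{m+1..CARD('n) - 1}. \<forall>f\<in>subsimplices l F. \<forall>i\<in>{1..l}. \<forall>q\<in>polys_on (int r - (int l + 1)) f.
          single_valued_across \<T> p F (moment f (t f i) (\<nu>F F) q)"
      unfolding fe_space_def by blast
    \<comment> \<open>Each p T is zero outside T; neighbours are compared through polynomials on all
      of R^n.\<close>
    have "\<forall>T\<in>\<T>. \<exists>B. B \<in> polynomials (int r) \<and> (\<forall>x\<in>T. p T x = B x) \<and> (\<forall>x\<in>T. transpose (B x) = B x)"
    proof
      fix T assume "T \<in> \<T>"
      then have "p T \<in> sym_polys_on (int r) T" using p by blast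
      then obtain B where "B \<in> polynomials (int r)" "p T = (\<lambda>x. if x \<in> T then B x else 0)"
        "\<And>x. x \<in> T \<Longrightarrow> transpose (B x) = B x" by (rule sym_polys_on_cases) blast
      then show "\<exists>B. B \<in> polynomials (int r) \<and> (\<forall>x\<in>T. p T x = B x) \<and> (\<forall>x\<in>T. transpose (B x) = B x)"
        by (intro exI[of _ B]) simp
    qed
    from bchoice[OF this] obtain B where "\<forall>T\<in>\<T>. B T \<in> polynomials (int r) \<and> (\<forall>x\<in>T. p T x = B T x) \<and>
      (\<forall>x\<in>T. transpose (B T x) = B T x)" by blast
    then have B: "\<And>T. T \<in> \<T> \<Longrightarrow> B T \<in> polynomials (int r)"
      "\<And>T x. T \<in> \<T> \<Longrightarrow> x \<in> T \<Longrightarrow> p T x = B T x" "\<And>T x. T \<in> \<T> \<Longrightarrow> x \<in> T \<Longrightarrow> transpose (B T x) = B T x"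
      by blast+
    have jump: "B T x *v bary_grad (vertices_of T) v = B T' x *v bary_grad (vertices_of T) v"
      if T: "T \<in> \<T>" "T' \<in> \<T>" and v: "v \<in> vertices_of T" "v' \<in> vertices_of T'"
        and U: "vertices_of T' - {v'} = vertices_of T - {v}" and x: "x \<in> convex hull (vertices_of T - {v})"
      for T T' v v' x
    proof -
      let ?V = "vertices_of T" and ?U = "vertices_of T - {v}" and ?F = "convex hull (vertices_of T - {v})"
      interpret S: full_simplex ?V using M.full[OF T(1)] .
      have UT: "convex hull W \<subseteq> T" "convex hull W \<subseteq> T'" if "W \<subseteq> ?U" for W
      proof -
        have "W \<subseteq> ?V" "W \<subseteq> vertices_of T'" using that U by blast+
        from this[THEN hull_mono, of convex] show "convex hull W \<subseteq> T" "convex hull W \<subseteq> T'"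
          unfolding M.hull[OF T(1)] M.hull[OF T(2)] .
      qed
      have face: "convex hull W \<in> mesh_subsimplices l \<T>" if "W \<subseteq> ?U" "card W = l + 1" for W l
      proof -
        have "W \<subseteq> ?V" using that(1) by blast
        from S.hull_in_subsimplices[OF this that(2)] show ?thesis
          unfolding M.hull[OF T(1)] by (rule sub_mesh[OF T(1)])
      qed
      have facet: "?F \<in> mesh_subsimplices (CARD('n) - 1) \<T>"
      proof -
        have "?F \<in> subsimplices (CARD('n) - 1) (convex hull ?V)" using S.facet_iff v(1) by blast
        then show ?thesis unfolding M.hull[OF T(1)] by (rule sub_mesh[OF T(1)])
      qed
      \<comment> \<open>The difference of the two polynomials has zero degrees of freedom on the
        common facet, so its normal component vanishes there by the lemma that also gives
        uniqueness.\<close>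
      define D where "D x = 1 *\<^sub>R B T x + (-1) *\<^sub>R B T' x" for x
      have Dp: "D \<in> polynomials (int r)"
        unfolding D_def[abs_def] by (intro polynomials_add polynomials_scaleR B(1) T)
      \<comment> \<open>Here f is the sub-simplex across which the moment is single-valued: the face
        W itself for (b) and (c), but the facet for (d).\<close>
      have momD: "moment (convex hull W) a b q D = 0"
        if W: "W \<subseteq> ?U" "W \<noteq> {}" and q: "q \<in> polys_on k (convex hull W)"
          and s: "single_valued_across \<T> p f (moment (convex hull W) a b q)" and f: "f \<subseteq> T" "f \<subseteq> T'" for W a b q k f
      proof -
        have WV: "W \<subseteq> ?V" using W(1) by blast
        have "moment (convex hull W) a b q D = 1 * moment (convex hull W) a b q (B T) + (-1) * moment (convex hull W) a b q (B T')"
          unfolding D_def[abs_def]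
          by (rule moment_comb[OF S.compact_face[OF WV] _ continuous_on_polynomial[OF B(1)[OF T(1)]]
              continuous_on_polynomial[OF B(1)[OF T(2)]] continuous_on_polys_on[OF q]]) (use W(2) in simp)
        moreover have "moment (convex hull W) a b q (p T) = moment (convex hull W) a b q (B T)"
          by (rule moment_cong[OF refl B(2)[OF T(1)]]) (use UT(1)[OF W(1)] in blast)
        moreover have "moment (convex hull W) a b q (p T') = moment (convex hull W) a b q (B T')"
          by (rule moment_cong[OF refl B(2)[OF T(2)]]) (use UT(2)[OF W(1)] in blast)
        moreover have "moment (convex hull W) a b q (p T) = moment (convex hull W) a b q (p T')"
          using s f T unfolding single_valued_across_def by blast
        ultimately show ?thesis by simp
      qed
      have nF: "unit_normal ?F (\<nu>F ?F)" by (rule assms(7)[OF facet])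
      have "D x *v \<nu>F ?F = 0"
      proof (rule S.facet_dofs_zero_imp[where U = ?U and k = "int r" and t = t and \<nu> = \<nu> and m = m])
        show "?U \<subseteq> ?V" by blast
        show "card ?U = CARD('n)" using v(1) S.card_vertices by simp
        show "normal_to ?F (\<nu>F ?F)" using nF by (simp add: unit_normal_def)
        show "transpose (D y) = D y" if "y \<in> ?F" for y
        proof -
          have "y \<in> T" "y \<in> T'" using that UT[of ?U] by blast+
          from B(3)[OF T(1) this(1)] B(3)[OF T(2) this(2)] show ?thesis
            by (simp only: D_def transpose_add transpose_scalar)
        qed
        show "D w = 0" if w: "w \<in> ?U" for w
        proof -
          have sv: "single_valued_across \<T> p {w} (\<lambda>B. B w)"
            using sv_a face[of "{w}" 0] w by simp
          have wT: "w \<in> T" "w \<in> T'" using UT[of "{w}"] w by simp_all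
          then have "p T w = p T' w" using sv T unfolding single_valued_across_def by blast
          then show ?thesis using B(2) T wT by (simp add: D_def)
        qed
      next
        fix W l assume "W \<subseteq> ?U" "card W = l + 1"
        then show "tn_basis l (convex hull W) (t (convex hull W)) (\<nu> (convex hull W))"
          by (intro assms(6) face)
      next
        fix W l i j and q :: "real^'n \<Rightarrow> real"
        assume W: "W \<subseteq> ?U" "card W = l + 1" "l \<in> {1..CARD('n) - 1}" "i \<in> {1..CARD('n) - l}" "j \<in> {i..CARD('n) - l}"
          and q: "q \<in> polys_on (int r - (int l + 1)) (convex hull W)"
        have ne: "W \<noteq> {}" using W(2) by auto
        have "single_valued_across \<T> p (convex hull W) (moment (convex hull W) (\<nu> (convex hull W) i) (\<nu> (convex hull W) j) q)"
          using sv_b face[OF W(1,2)] W(3-5) q by blast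
        from momD[OF W(1) ne q this UT[OF W(1)]]
        show "moment (convex hull W) (\<nu> (convex hull W) i) (\<nu> (convex hull W) j) q D = 0" .
      next
        fix W l i j and q :: "real^'n \<Rightarrow> real"
        assume W: "W \<subseteq> ?U" "card W = l + 1" "l \<in> {1..m}" "i \<in> {1..l}" "j \<in> {1..CARD('n) - l}"
          and q: "q \<in> polys_on (int r - (int l + 1)) (convex hull W)"
        have ne: "W \<noteq> {}" using W(2) by auto
        have "single_valued_across \<T> p (convex hull W) (moment (convex hull W) (t (convex hull W) i) (\<nu> (convex hull W) j) q)"
          using sv_c face[OF W(1,2)] W(3-5) q by blast
        from momD[OF W(1) ne q this UT[OF W(1)]]
        show "moment (convex hull W) (t (convex hull W) i) (\<nu> (convex hull W) j) q D = 0" .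
      next
        fix W l i and q :: "real^'n \<Rightarrow> real"
        assume W: "W \<subseteq> ?U" "card W = l + 1" "l \<in> {m+1..CARD('n) - 1}" "i \<in> {1..l}"
          and q: "q \<in> polys_on (int r - (int l + 1)) (convex hull W)"
        have ne: "W \<noteq> {}" using W(2) by auto
        have "convex hull W \<in> subsimplices l ?F"
          using S.subsimplices_hull_iff[of ?U] W(1,2) by blast
        then have "single_valued_across \<T> p ?F (moment (convex hull W) (t (convex hull W) i) (\<nu>F ?F) q)"
          using sv_d facet W(3,4) q by blast
        from momD[OF W(1) ne q this UT[OF order_refl]]
        show "moment (convex hull W) (t (convex hull W) i) (\<nu>F ?F) q D = 0" .
      qed (use Dp x in auto)
      moreover obtain s where "\<nu>F ?F = s *\<^sub>R bary_grad ?V v" "s \<noteq> 0"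
        by (rule S.facet_normal[OF v(1) nF])
      ultimately have "D x *v bary_grad ?V v = 0" by (simp add: matrix_vector_mult_scaleR)
      then show ?thesis by (simp add: D_def matrix_vector_mult_diff_rdistrib)
    qed
    have \<Omega>: "open \<Omega>" "bounded \<Omega>" "\<Omega> \<subseteq> \<Union>\<T>"
      using assms(4,5) closure_subset[of \<Omega>] by (auto simp: bounded_domain_def simplicial_mesh_def)
    show "A \<in> H_div_sym \<Omega>"
    proof (rule M.piecewise_polynomial_H_div[OF A \<Omega> B(1)])
      fix T assume T: "T \<in> \<T>"
      have "AE x in lebesgue_on (T \<inter> \<Omega>). A x = p T x" using p T by blast
      moreover have "AE x in lebesgue_on (T \<inter> \<Omega>). x \<in> T" by (rule AE_I2) simp
      ultimately show "AE x in lebesgue_on (T \<inter> \<Omega>). A x = B T x"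
        by eventually_elim (use B(2)[OF T] in auto)
    qed (use jump in blast)+
  qed
qed

end
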